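(* Fix any constant $\varepsilon\in[0,1/9)$. Assume the PCP-for-PPAD conjecture. Then there exists a constant $\delta>0$ such that finding an $(\varepsilon,\delta)$-approximate market equilibrium in simple Fisher markets is PPAD-hard (i.e., there is a simple family of Fisher markets such that the search problem restricted to inputs from that family is PPAD-hard).
   Context: **Fisher markets.** A Fisher market is a tuple $(G,B,(e_i)_{i\in B},(u_i)_{i\in B})$: $G$ is a finite set of divisible goods, one unit of each available; $B$ is a finite set of buyers; $e_i>0$ is the budget of buyer $i$; $u_i:\mathbb R_{\ge 0}^{|G|}\to\mathbb R_{\ge 0}$ is the utility function of buyer $i$, assumed separable piecewise-linear concave (SPLC): $u_i(x_i)=\sum_{j\in G}u_{i,j}(x_{i,j})$, where each $u_{i,j}:\mathbb R_{\ge0}\to\mathbb R_{\ge0}$ is continuous, piecewise-linear, concave, non-decreasing, with $u_{i,j}(0)=0$. The utilities are *linear capped* if each $u_{i,j}(x)=\min\{a x,b\}$ for some $a\in\mathbb R_{\ge0}$, $b\in\mathbb R_{\ge0}\cup\{+\infty\}$. **Approximate equilibrium.** For prices $p\in\mathbb R_{\ge0}^{|G|}$ let $F_i(p)=\{x_i\in\mathbb R_{\ge0}^{|G|}:\sum_j p_jx_{i,j}\le e_i\}$, $U_i^*=\max_{x_i\in F_i(p)}u_i(x_i)\in\mathbb R_{\ge0}\cup\{+\infty\}$. A bundle $x_i$ is $(1-\delta)$-optimal for $i$ at $p$ if $x_i\in F_i(p)$ and $u_i(x_i)\ge(1-\delta)U_i^*$. For $\varepsilon,\delta\in[0,1]$,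 an $(\varepsilon,\delta)$-approximate market equilibrium is a pair $(p,x)$, $x=(x_i)_{i\in B}$, such that each $x_i$ is $(1-\delta)$-optimal for buyer $i$ at $p$, and each good $j$ satisfies $|\sum_{i\in B}x_{i,j}-1|\le\varepsilon$. **Search problem.** Input: a Fisher market with SPLC utilities (budgets and the endpoints/values of each linear piece given explicitly as rationals) such that for every buyer $i$ there is a good $j$ with $u_{i,j}$ strictly increasing. Output: an $(\varepsilon,\delta)$-approximate market equilibrium. **Simple family.** A family of Fisher markets is *simple* if utilities are SPLC linear capped, all buyers have budget $e_i=1$, and there are constants such that in every market of the family: every buyer $i$ has non-zero $u_{i,j}$ for at most a constant number of goods $j$; for every good $j$, $u_{i,j}$ is non-zero for at most a constant number of buyers $i$; for every buyer $i$, the non-zero slopes in the functions $u_{i,j}$ have ratio bounded by a constant; and furthermore, for every buyer $i$ there is a good $j$ such that $u_{i,j}$ is linear (uncapped) with strictly positive slope. **Pure-Circuit.** An instance is $(V,C)$ with nodes $V=[n]$ and gates $C$, each gate of the form $(T,u,v,w)$ with $u,v,w\in V$ distinct and $T\in\{\mathsf{NAND},\mathsf{PURIFY}\}$. For NAND, $u,v$ are inputs and $w$ the output; for PURIFY, $u$ is the input and $v,w$ the outputs. Each node is the output of exactly one gate. An assignment $\mathbf x:V\to\{0,1,\bot\}$ satisfies a NAND gate if ($\mathbf x[u]=\mathbf x[v]=1\Rightarrow\mathbf x[w]=0$) and ($\mathbf x[u]=0$ or $\mathbf x[v]=0$ $\Rightarrow\mathbf x[w]=1$); it satisfies a PURIFY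 gate if $\{\mathbf x[v],\mathbf x[w]\}\cap\{0,1\}\ne\emptyset$ and ($\mathbf x[u]\in\{0,1\}\Rightarrow\mathbf x[v]=\mathbf x[w]=\mathbf x[u]$). The $\delta$-Pure-Circuit problem: given $(V,C)$, find $\mathbf x:V\to\{0,1,\bot\}$ satisfying at least a $(1-\delta)$ fraction of the gates. **PCP-for-PPAD conjecture.** There exists a constant $\delta>0$ such that $\delta$-Pure-Circuit is PPAD-hard, even when every node is the input to exactly one gate. PPAD-hardness is with respect to polynomial-time reductions between search problems. *)

theory Defs
  imports "HOL-Analysis.Analysis" "HOL-Computational_Algebra.Polynomial"
begin

section \<open>Polynomial-time computation\<close>

text \<open>
  The machine model is the WHILE language over binary trees (Jones, Computability and
  Complexity from a Programming Perspective), with logarithmic cost: an assignment costs one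
  plus the size of the tree written. The total size of the store is therefore at most
  the size of the input plus the elapsed time, so this model and Turing machines simulate each
  other with polynomial overhead. The size of a tree is the number of its \<open>CONS\<close> nodes.
\<close>

datatype sexp = NIL | CONS sexp sexp

fun hd_sexp :: "sexp \<Rightarrow> sexp" where
  "hd_sexp NIL = NIL"
| "hd_sexp (CONS a b) = a"

fun tl_sexp :: "sexp \<Rightarrow> sexp" where
  "tl_sexp NIL = NIL"
| "tl_sexp (CONS a b) = b"

datatype com =
    SetNil nat
  | Copy nat nat
  | Join nat nat nat
  | Head nat nat
  | Tail nat nat
  | Seq com com
  | Cond nat com com
  | While nat com

type_synonym store = "nat \<Rightarrow> sexp"

inductive exec :: "com \<Rightarrow> store \<Rightarrow> nat \<Rightarrow> store \<Rightarrow> bool" where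
  SetNil: "exec (SetNil x) s 1 (s(x := NIL))"
| Copy: "exec (Copy x y) s (1 + size (s y)) (s(x := s y))"
| Join: "exec (Join x y z) s (1 + size (CONS (s y) (s z))) (s(x := CONS (s y) (s z)))"
| Head: "exec (Head x y) s (1 + size (hd_sexp (s y))) (s(x := hd_sexp (s y)))"
| Tail: "exec (Tail x y) s (1 + size (tl_sexp (s y))) (s(x := tl_sexp (s y)))"
| Seq: "exec c1 s t1 s' \<Longrightarrow> exec c2 s' t2 s'' \<Longrightarrow> exec (Seq c1 c2) s (t1 + t2) s''"
| CondTrue: "s x \<noteq> NIL \<Longrightarrow> exec c1 s t s' \<Longrightarrow> exec (Cond x c1 c2) s (1 + t) s'"
| CondFalse: "s x = NIL \<Longrightarrow> exec c2 s t s' \<Longrightarrow> exec (Cond x c1 c2) s (1 + t) s'"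
| WhileFalse: "s x = NIL \<Longrightarrow> exec (While x c) s 1 s"
| WhileTrue: "s x \<noteq> NIL \<Longrightarrow> exec c s t1 s' \<Longrightarrow> exec (While x c) s' t2 s'' \<Longrightarrow>
    exec (While x c) s (1 + t1 + t2) s''"

inductive_cases exec_SetNilE: "exec (SetNil x) s t s'"
inductive_cases exec_CopyE: "exec (Copy x y) s t s'"
inductive_cases exec_JoinE: "exec (Join x y z) s t s'"
inductive_cases exec_HeadE: "exec (Head x y) s t s'"
inductive_cases exec_TailE: "exec (Tail x y) s t s'"
inductive_cases exec_SeqE: "exec (Seq c1 c2) s t s'"
inductive_cases exec_CondE: "exec (Cond x c1 c2) s t s'"
inductive_cases exec_WhileE: "exec (While x c) s t s'"

lemma exec_deterministic:
  "exec c s t s' \<Longrightarrow> exec c s u s'' \<Longrightarrow> u = t \<and> s'' = s'"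
proof (induction arbitrary: u s'' rule: exec.induct)
  case (SetNil x s)
  then show ?case by (rule exec_SetNilE) simp
next
  case (Copy x y s)
  then show ?case by (rule exec_CopyE) simp
next
  case (Join x y z s)
  then show ?case by (rule exec_JoinE) simp
next
  case (Head x y s)
  then show ?case by (rule exec_HeadE) simp
next
  case (Tail x y s)
  then show ?case by (rule exec_TailE) simp
next
  case (Seq c1 s t1 s' c2 t2 s2)
  from Seq.prems show ?case by (rule exec_SeqE) (use Seq.IH in blast)
next
  case (CondTrue s x c1 t s' c2)
  from CondTrue.prems show ?case
    by (rule exec_CondE) (use CondTrue.IH CondTrue.hyps(1) in \<open>metis plus_1_eq_Suc\<close>)+
next
  case (CondFalse s x c2 t s' c1)
  from CondFalse.prems show ?case
    by (rule exec_CondE) (use CondFalse.IH CondFalse.hyps(1) in \<open>metis plus_1_eq_Suc\<close>)+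
next
  case (WhileFalse s x c)
  from WhileFalse.prems show ?case
    by (rule exec_WhileE) (use WhileFalse.hyps in simp_all)
next
  case (WhileTrue s x c t1 s1 t2 s2)
  from WhileTrue.prems show ?case
  proof (rule exec_WhileE)
    assume "s x = NIL"
    with WhileTrue.hyps show ?thesis by simp
  next
    fix t1' s1' t2'
    assume u: "u = Suc (t1' + t2')"
      and c: "exec c s t1' s1'" and w: "exec (While x c) s1' t2' s''"
    from WhileTrue.IH(1)[OF c] have 1: "t1' = t1" "s1' = s1" by simp_all
    from WhileTrue.IH(2)[OF w[unfolded 1]] have "t2' = t2" "s'' = s2" by simp_all
    with u 1 show ?thesis by simp
  qed
qed

text \<open>Input and output are both held in variable 0.\<close>

definition poly_time :: "(sexp \<Rightarrow> sexp) \<Rightarrow> bool" where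
  "poly_time f \<longleftrightarrow> (\<exists>c (p :: nat poly). \<forall>x. \<exists>t s.
     exec c ((\<lambda>_. NIL)(0 := x)) t s \<and> s 0 = f x \<and> t \<le> poly p (size x))"

definition poly_time_decidable :: "sexp set \<Rightarrow> bool" where
  "poly_time_decidable L \<longleftrightarrow> (\<exists>f. poly_time f \<and> (\<forall>x. x \<in> L \<longleftrightarrow> f x \<noteq> NIL))"

section \<open>Encodings\<close>

fun enc_list :: "('a \<Rightarrow> sexp) \<Rightarrow> 'a list \<Rightarrow> sexp" where
  "enc_list e [] = NIL"
| "enc_list e (x # xs) = CONS (e x) (enc_list e xs)"

definition enc_pair :: "('a \<Rightarrow> sexp) \<Rightarrow> ('b \<Rightarrow> sexp) \<Rightarrow> 'a \<times> 'b \<Rightarrow> sexp" where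
  "enc_pair e1 e2 z = CONS (e1 (fst z)) (e2 (snd z))"

fun enc_bool :: "bool \<Rightarrow> sexp" where
  "enc_bool False = NIL"
| "enc_bool True = CONS NIL NIL"

text \<open>
  Unary notation is used only for node and wire names and for counts. In valid instances these
  are linear in the number of items listed explicitly (every Pure-Circuit node is the output of
  a gate, a circuit lists its outputs, a buyer lists a utility for each good), so unary and
  binary are polynomially equivalent there. Numerical data are binary, least significant bit
  first.
\<close>

fun enc_unary :: "nat \<Rightarrow> sexp" where
  "enc_unary 0 = NIL"
| "enc_unary (Suc n) = CONS NIL (enc_unary n)"

fun bits :: "nat \<Rightarrow> bool list" where
  "bits n = (if n = 0 then [] else odd n # bits (n div 2))"

declare bits.simps [simp del]

definition enc_nat :: "nat \<Rightarrow> sexp" where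
  "enc_nat n = enc_list enc_bool (bits n)"

definition enc_int :: "int \<Rightarrow> sexp" where
  "enc_int i = enc_pair enc_bool enc_nat (i < 0, nat \<bar>i\<bar>)"

text \<open>A rational is a numerator and a positive denominator in lowest terms.\<close>

definition enc_rat :: "rat \<Rightarrow> sexp" where
  "enc_rat q = enc_pair enc_int enc_int (quotient_of q)"

lemma inj_enc_list: "inj e \<Longrightarrow> inj (enc_list e)"
proof (rule injI)
  fix xs ys assume "inj e" "enc_list e xs = enc_list e ys"
  then show "xs = ys"
    by (induction xs arbitrary: ys) (case_tac ys; auto dest: injD)+
qed

lemma inj_enc_pair: "inj e1 \<Longrightarrow> inj e2 \<Longrightarrow> inj (enc_pair e1 e2)"
  by (rule injI) (auto simp: enc_pair_def prod_eq_iff dest: injD)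

lemma inj_enc_bool: "inj enc_bool"
  by (rule injI) (case_tac x; case_tac y; simp)

lemma inj_enc_unary: "inj enc_unary"
proof (rule injI)
  fix m n assume "enc_unary m = enc_unary n"
  then show "m = n" by (induction m arbitrary: n) (case_tac n; auto)+
qed

lemma bits_inject: "bits m = bits n \<Longrightarrow> m = n"
proof (induction m arbitrary: n rule: less_induct)
  case (less m)
  show ?case
  proof (cases "m = 0 \<or> n = 0")
    case True
    with less.prems show ?thesis
      by (auto simp: bits.simps[of m] bits.simps[of n] bits.simps[of 0] split: if_splits)
  next
    case False
    with less.prems have "odd m = odd n" "bits (m div 2) = bits (n div 2)"
      by (simp_all add: bits.simps[of m] bits.simps[of n])
    moreover from this(2) False have "m div 2 = n div 2" by (intro less.IH) auto
    ultimately show ?thesis by (metis even_two_times_div_two odd_two_times_div_two_succ)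
  qed
qed

lemma inj_enc_nat: "inj enc_nat"
  by (rule injI) (auto simp: enc_nat_def dest: bits_inject injD[OF inj_enc_list[OF inj_enc_bool]])

lemma inj_enc_int: "inj enc_int"
proof (rule injI)
  fix i j assume "enc_int i = enc_int j"
  then have "(i < 0, nat \<bar>i\<bar>) = (j < 0, nat \<bar>j\<bar>)"
    unfolding enc_int_def by (rule injD[OF inj_enc_pair[OF inj_enc_bool inj_enc_nat]])
  then show "i = j" by (cases "i < 0") auto
qed

lemma inj_enc_rat: "inj enc_rat"
  by (rule injI)
    (auto simp: enc_rat_def quotient_of_inject_eq
      dest: injD[OF inj_enc_pair[OF inj_enc_int inj_enc_int]])

section \<open>Search problems, PPAD\<close>

record search_problem =
  instances :: "sexp set"
  solutions :: "sexp \<Rightarrow> sexp set"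

definition reducible :: "search_problem \<Rightarrow> search_problem \<Rightarrow> bool" where
  "reducible A B \<longleftrightarrow> (\<exists>f g. poly_time f \<and> poly_time g \<and>
     (\<forall>x \<in> instances A. f x \<in> instances B \<and>
       (\<forall>y \<in> solutions B (f x). g (CONS x y) \<in> solutions A x)))"

definition TFNP :: "search_problem set" where
  "TFNP = {A. poly_time_decidable (instances A) \<and>
     poly_time_decidable {CONS x y |x y. x \<in> instances A \<and> y \<in> solutions A x} \<and>
     (\<exists>p :: nat poly. \<forall>x \<in> instances A. \<forall>y \<in> solutions A x. size y \<le> poly p (size x)) \<and>
     (\<forall>x \<in> instances A. solutions A x \<noteq> {})}"

text \<open>
  A Boolean circuit on \<open>n\<close> inputs is a list of gates together with a list of output wires;
  wires \<open>0, \<dots>, n - 1\<close> are the inputs and wire \<open>n + k\<close> is the output of gate \<open>k\<close>.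
\<close>

datatype bgate = And_Gate nat nat | Or_Gate nat nat | Not_Gate nat

type_synonym circuit = "bgate list \<times> nat list"

fun gate_wires :: "bgate \<Rightarrow> nat set" where
  "gate_wires (And_Gate i j) = {i, j}"
| "gate_wires (Or_Gate i j) = {i, j}"
| "gate_wires (Not_Gate i) = {i}"

fun gate_value :: "bool list \<Rightarrow> bgate \<Rightarrow> bool" where
  "gate_value ws (And_Gate i j) \<longleftrightarrow> ws ! i \<and> ws ! j"
| "gate_value ws (Or_Gate i j) \<longleftrightarrow> ws ! i \<or> ws ! j"
| "gate_value ws (Not_Gate i) \<longleftrightarrow> \<not> ws ! i"

definition valid_circuit :: "nat \<Rightarrow> nat \<Rightarrow> circuit \<Rightarrow> bool" where
  "valid_circuit n m = (\<lambda>(gs, os).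
     (\<forall>k < length gs. \<forall>i \<in> gate_wires (gs ! k). i < n + k) \<and>
     length os = m \<and> (\<forall>i \<in> set os. i < n + length gs))"

definition eval_circuit :: "circuit \<Rightarrow> bool list \<Rightarrow> bool list" where
  "eval_circuit = (\<lambda>(gs, os) v.
     let ws = foldl (\<lambda>ws g. ws @ [gate_value ws g]) v gs in map (\<lambda>i. ws ! i) os)"

fun enc_bgate :: "bgate \<Rightarrow> sexp" where
  "enc_bgate (And_Gate i j) = CONS (enc_unary 0) (CONS (enc_unary i) (enc_unary j))"
| "enc_bgate (Or_Gate i j) = CONS (enc_unary 1) (CONS (enc_unary i) (enc_unary j))"
| "enc_bgate (Not_Gate i) = CONS (enc_unary 2) (enc_unary i)"

definition enc_circuit :: "circuit \<Rightarrow> sexp" where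
  "enc_circuit = enc_pair (enc_list enc_bgate) (enc_list enc_unary)"

text \<open>An instance is \<open>(n, S, P)\<close> with \<open>S\<close> the successor and \<open>P\<close> the predecessor circuit.\<close>

type_synonym eol = "nat \<times> circuit \<times> circuit"

definition enc_eol :: "eol \<Rightarrow> sexp" where
  "enc_eol = enc_pair enc_unary (enc_pair enc_circuit enc_circuit)"

definition valid_eol :: "eol \<Rightarrow> bool" where
  "valid_eol = (\<lambda>(n, S, P). valid_circuit n n S \<and> valid_circuit n n P \<and>
     eval_circuit P (replicate n False) = replicate n False \<and>
     eval_circuit S (replicate n False) \<noteq> replicate n False)"

definition eol_solution :: "eol \<Rightarrow> bool list \<Rightarrow> bool" where
  "eol_solution = (\<lambda>(n, S, P) v. length v = n \<and>
     (eval_circuit P (eval_circuit S v) \<noteq> v \<or>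
      eval_circuit S (eval_circuit P v) \<noteq> v \<and> v \<noteq> replicate n False))"

definition end_of_line :: search_problem where
  "end_of_line = \<lparr>
     instances = {enc_eol I |I. valid_eol I},
     solutions = (\<lambda>z. {enc_list enc_bool v |I v. z = enc_eol I \<and> eol_solution I v})\<rparr>"

definition PPAD :: "search_problem set" where
  "PPAD = {A \<in> TFNP. reducible A end_of_line}"

definition PPAD_hard :: "search_problem \<Rightarrow> bool" where
  "PPAD_hard B \<longleftrightarrow> (\<forall>A \<in> PPAD. reducible A B)"

section \<open>Pure-Circuit\<close>

text \<open>\<open>NAND u v w\<close> has inputs \<open>u, v\<close> and output \<open>w\<close>; \<open>PURIFY u v w\<close> has input \<open>u\<close> and outputs \<open>v, w\<close>.\<close>

datatype gate = NAND nat nat nat | PURIFY nat nat nat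

datatype pval = Zero | One | Bot

fun gate_nodes :: "gate \<Rightarrow> nat list" where
  "gate_nodes (NAND u v w) = [u, v, w]"
| "gate_nodes (PURIFY u v w) = [u, v, w]"

fun gate_inputs :: "gate \<Rightarrow> nat set" where
  "gate_inputs (NAND u v w) = {u, v}"
| "gate_inputs (PURIFY u v w) = {u}"

fun gate_outputs :: "gate \<Rightarrow> nat set" where
  "gate_outputs (NAND u v w) = {w}"
| "gate_outputs (PURIFY u v w) = {v, w}"

fun satisfies :: "(nat \<Rightarrow> pval) \<Rightarrow> gate \<Rightarrow> bool" where
  "satisfies x (NAND u v w) \<longleftrightarrow>
     (x u = One \<and> x v = One \<longrightarrow> x w = Zero) \<and>
     (x u = Zero \<or> x v = Zero \<longrightarrow> x w = One)"
| "satisfies x (PURIFY u v w) \<longleftrightarrow>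
     {x v, x w} \<inter> {Zero, One} \<noteq> {} \<and>
     (x u \<in> {Zero, One} \<longrightarrow> x v = x u \<and> x w = x u)"

text \<open>The nodes are \<open>0, \<dots>, n - 1\<close>. Unique outputs rule out repeated gates in the list.\<close>

type_synonym pure_circuit = "nat \<times> gate list"

definition valid_pure_circuit :: "pure_circuit \<Rightarrow> bool" where
  "valid_pure_circuit = (\<lambda>(n, C).
     (\<forall>g \<in> set C. distinct (gate_nodes g) \<and> set (gate_nodes g) \<subseteq> {..<n}) \<and>
     (\<forall>v < n. \<exists>!k. k < length C \<and> v \<in> gate_outputs (C ! k)))"

definition single_input_use :: "pure_circuit \<Rightarrow> bool" where
  "single_input_use = (\<lambda>(n, C). \<forall>v < n. \<exists>!k. k < length C \<and> v \<in> gate_inputs (C ! k))"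

definition pure_circuit_solution :: "real \<Rightarrow> pure_circuit \<Rightarrow> pval list \<Rightarrow> bool" where
  "pure_circuit_solution \<delta> = (\<lambda>(n, C) xs. length xs = n \<and>
     real (card {k. k < length C \<and> satisfies (\<lambda>v. xs ! v) (C ! k)}) \<ge> (1 - \<delta>) * real (length C))"

fun enc_gate :: "gate \<Rightarrow> sexp" where
  "enc_gate (NAND u v w) =
     CONS (enc_unary 0) (CONS (enc_unary u) (CONS (enc_unary v) (enc_unary w)))"
| "enc_gate (PURIFY u v w) =
     CONS (enc_unary 1) (CONS (enc_unary u) (CONS (enc_unary v) (enc_unary w)))"

fun enc_pval :: "pval \<Rightarrow> sexp" where
  "enc_pval Zero = enc_unary 0"
| "enc_pval One = enc_unary 1"
| "enc_pval Bot = enc_unary 2"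

definition enc_pure_circuit :: "pure_circuit \<Rightarrow> sexp" where
  "enc_pure_circuit = enc_pair enc_unary (enc_list enc_gate)"

lemma inj_enc_bgate: "inj enc_bgate"
proof (rule injI)
  fix g h assume "enc_bgate g = enc_bgate h"
  then show "g = h"
    by (cases g; cases h) (auto simp: numeral_2_eq_2 dest: injD[OF inj_enc_unary])
qed

lemma inj_enc_eol: "inj enc_eol"
  unfolding enc_eol_def enc_circuit_def
  by (intro inj_enc_pair inj_enc_list inj_enc_unary inj_enc_bgate)

lemma inj_enc_gate: "inj enc_gate"
proof (rule injI)
  fix g h assume "enc_gate g = enc_gate h"
  then show "g = h"
    by (cases g; cases h) (auto dest: injD[OF inj_enc_unary])
qed

lemma inj_enc_pval: "inj enc_pval"
  by (rule injI) (case_tac x; case_tac y; simp add: numeral_2_eq_2)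

lemma inj_enc_pure_circuit: "inj enc_pure_circuit"
  unfolding enc_pure_circuit_def
  by (intro inj_enc_pair inj_enc_list inj_enc_unary inj_enc_gate)

definition pure_circuit_problem :: "real \<Rightarrow> pure_circuit set \<Rightarrow> search_problem" where
  "pure_circuit_problem \<delta> F = \<lparr>
     instances = {enc_pure_circuit I |I. valid_pure_circuit I \<and> I \<in> F},
     solutions = (\<lambda>z. {enc_list enc_pval xs |I xs.
       z = enc_pure_circuit I \<and> pure_circuit_solution \<delta> I xs})\<rparr>"

definition PCP_for_PPAD_conjecture :: bool where
  "PCP_for_PPAD_conjecture \<longleftrightarrow>
     (\<exists>\<delta>::real. \<delta> > 0 \<and> PPAD_hard (pure_circuit_problem \<delta> {I. single_input_use I}))"

section \<open>Fisher markets\<close>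

text \<open>
  Bundles, prices and univariate utilities are total functions of which only the values at
  goods in \<open>goods M\<close>, buyers in \<open>buyers M\<close> and amounts in \<open>{0..}\<close> matter.
\<close>

record ('b, 'g) market =
  goods :: "'g set"
  buyers :: "'b set"
  budget :: "'b \<Rightarrow> real"
  util :: "'b \<Rightarrow> 'g \<Rightarrow> real \<Rightarrow> real"

definition piecewise_linear :: "(real \<Rightarrow> real) \<Rightarrow> bool" where
  "piecewise_linear f \<longleftrightarrow> (\<exists>T. finite T \<and>
     (\<forall>a b. 0 \<le> a \<and> a < b \<and> {a<..<b} \<inter> T = {} \<longrightarrow>
       (\<exists>m c. \<forall>x \<in> {a<..<b}. f x = m * x + c)))"

definition plc_utility :: "(real \<Rightarrow> real) \<Rightarrow> bool" where
  "plc_utility f \<longleftrightarrow> (\<forall>x \<ge> 0. f x \<ge> 0) \<and> continuous_on {0..} f \<and> piecewise_linear f \<and>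
     concave_on {0..} f \<and> mono_on {0..} f \<and> f 0 = 0"

text \<open>
  Without buyers no good can be sold and no approximate equilibrium would exist, so the set
  of buyers is required to be nonempty.
\<close>

definition fisher_market :: "('b, 'g) market \<Rightarrow> bool" where
  "fisher_market M \<longleftrightarrow> finite (goods M) \<and> finite (buyers M) \<and> buyers M \<noteq> {} \<and>
     (\<forall>i \<in> buyers M. budget M i > 0) \<and>
     (\<forall>i \<in> buyers M. \<forall>j \<in> goods M. plc_utility (util M i j))"

definition bundle_utility :: "('b, 'g) market \<Rightarrow> 'b \<Rightarrow> ('g \<Rightarrow> real) \<Rightarrow> real" where
  "bundle_utility M i y = (\<Sum>j \<in> goods M. util M i j (y j))"

definition budget_set :: "('b, 'g) market \<Rightarrow> ('g \<Rightarrow> real) \<Rightarrow> 'b \<Rightarrow> ('g \<Rightarrow> real) set" where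
  "budget_set M p i =
     {y. (\<forall>j \<in> goods M. y j \<ge> 0) \<and> (\<Sum>j \<in> goods M. p j * y j) \<le> budget M i}"

definition opt_utility :: "('b, 'g) market \<Rightarrow> ('g \<Rightarrow> real) \<Rightarrow> 'b \<Rightarrow> ereal" where
  "opt_utility M p i = (SUP y \<in> budget_set M p i. ereal (bundle_utility M i y))"

definition approx_optimal ::
  "real \<Rightarrow> ('b, 'g) market \<Rightarrow> ('g \<Rightarrow> real) \<Rightarrow> 'b \<Rightarrow> ('g \<Rightarrow> real) \<Rightarrow> bool" where
  "approx_optimal \<delta> M p i y \<longleftrightarrow> y \<in> budget_set M p i \<and>
     ereal (bundle_utility M i y) \<ge> ereal (1 - \<delta>) * opt_utility M p i"

definition approx_equilibrium ::
  "real \<Rightarrow> real \<Rightarrow> ('b, 'g) market \<Rightarrow> ('g \<Rightarrow> real) \<Rightarrow> ('b \<Rightarrow> 'g \<Rightarrow> real) \<Rightarrow> bool" where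
  "approx_equilibrium \<epsilon> \<delta> M p x \<longleftrightarrow> (\<forall>j \<in> goods M. p j \<ge> 0) \<and>
     (\<forall>i \<in> buyers M. approx_optimal \<delta> M p i (x i)) \<and>
     (\<forall>j \<in> goods M. \<bar>(\<Sum>i \<in> buyers M. x i j) - 1\<bar> \<le> \<epsilon>)"

section \<open>Simple families\<close>

definition linear_capped :: "(real \<Rightarrow> real) \<Rightarrow> bool" where
  "linear_capped f \<longleftrightarrow> (\<exists>a \<ge> 0. \<exists>b :: ereal. b \<ge> 0 \<and> (\<forall>x \<ge> 0. ereal (f x) = min (ereal (a * x)) b))"

definition nonzero_utility :: "(real \<Rightarrow> real) \<Rightarrow> bool" where
  "nonzero_utility f \<longleftrightarrow> (\<exists>x \<ge> 0. f x \<noteq> 0)"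

definition slopes :: "(real \<Rightarrow> real) \<Rightarrow> real set" where
  "slopes f = {m. \<exists>a b c. 0 \<le> a \<and> a < b \<and> (\<forall>x \<in> {a..b}. f x = m * x + c)}"

definition simple_family :: "('b, 'g) market set \<Rightarrow> bool" where
  "simple_family F \<longleftrightarrow>
     (\<forall>M \<in> F. fisher_market M \<and>
       (\<forall>i \<in> buyers M. budget M i = 1 \<and>
         (\<forall>j \<in> goods M. linear_capped (util M i j)) \<and>
         (\<exists>j \<in> goods M. \<exists>a > 0. \<forall>x \<ge> 0. util M i j x = a * x))) \<and>
     (\<exists>K :: nat. \<forall>M \<in> F. \<forall>i \<in> buyers M. card {j \<in> goods M. nonzero_utility (util M i j)} \<le> K) \<and>
     (\<exists>K :: nat. \<forall>M \<in> F. \<forall>j \<in> goods M. card {i \<in> buyers M. nonzero_utility (util M i j)} \<le> K) \<and>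
     (\<exists>K :: real. \<forall>M \<in> F. \<forall>i \<in> buyers M.
       \<forall>m \<in> (\<Union>j \<in> goods M. slopes (util M i j)) - {0}.
       \<forall>m' \<in> (\<Union>j \<in> goods M. slopes (util M i j)) - {0}. m / m' \<le> K)"

section \<open>The market equilibrium search problem\<close>

text \<open>
  A univariate utility is given by the right endpoints of its bounded linear pieces, each with
  the value there, and the slope of the final unbounded piece. The first piece starts at
  \<open>(0, 0)\<close>.
\<close>

type_synonym pieces = "(rat \<times> rat) list \<times> rat"

fun eval_pieces_from :: "rat \<times> rat \<Rightarrow> pieces \<Rightarrow> real \<Rightarrow> real" where
  "eval_pieces_from (t0, v0) ([], s) x = of_rat v0 + of_rat s * (x - of_rat t0)"
| "eval_pieces_from (t0, v0) ((t, v) # bs, s) x =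
     (if x \<le> of_rat t then of_rat v0 + of_rat ((v - v0) / (t - t0)) * (x - of_rat t0)
      else eval_pieces_from (t, v) (bs, s) x)"

definition eval_pieces :: "pieces \<Rightarrow> real \<Rightarrow> real" where
  "eval_pieces = eval_pieces_from (0, 0)"

text \<open>
  The number of goods, and for each buyer the budget and one univariate utility per good.
\<close>

type_synonym market_data = "nat \<times> (rat \<times> pieces list) list"

definition market_of :: "market_data \<Rightarrow> (nat, nat) market" where
  "market_of = (\<lambda>(n, bs). \<lparr>
     goods = {..<n},
     buyers = {..<length bs},
     budget = (\<lambda>i. of_rat (fst (bs ! i))),
     util = (\<lambda>i j. eval_pieces (snd (bs ! i) ! j))\<rparr>)"

definition valid_market_data :: "market_data \<Rightarrow> bool" where
  "valid_market_data = (\<lambda>(n, bs).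
     (\<forall>(e, us) \<in> set bs. length us = n \<and> (\<forall>(ps, s) \<in> set us. sorted_wrt (<) (0 # map fst ps))) \<and>
     fisher_market (market_of (n, bs)) \<and>
     (\<forall>i < length bs. \<exists>j < n. strict_mono_on {0..} (util (market_of (n, bs)) i j)))"

definition enc_pieces :: "pieces \<Rightarrow> sexp" where
  "enc_pieces = enc_pair (enc_list (enc_pair enc_rat enc_rat)) enc_rat"

definition enc_market :: "market_data \<Rightarrow> sexp" where
  "enc_market = enc_pair enc_unary (enc_list (enc_pair enc_rat (enc_list enc_pieces)))"

text \<open>Prices of all goods, and for each buyer the allocated amounts of all goods.\<close>

type_synonym outcome_data = "rat list \<times> rat list list"

definition market_solution :: "real \<Rightarrow> real \<Rightarrow> market_data \<Rightarrow> outcome_data \<Rightarrow> bool" where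
  "market_solution \<epsilon> \<delta> = (\<lambda>(n, bs) (ps, xs).
     length ps = n \<and> length xs = length bs \<and> (\<forall>ys \<in> set xs. length ys = n) \<and>
     approx_equilibrium \<epsilon> \<delta> (market_of (n, bs))
       (\<lambda>j. of_rat (ps ! j)) (\<lambda>i j. of_rat (xs ! i ! j)))"

definition enc_outcome :: "outcome_data \<Rightarrow> sexp" where
  "enc_outcome = enc_pair (enc_list enc_rat) (enc_list (enc_list enc_rat))"

lemma inj_enc_market: "inj enc_market"
  unfolding enc_market_def enc_pieces_def
  by (intro inj_enc_pair inj_enc_list inj_enc_unary inj_enc_rat)

lemma inj_enc_outcome: "inj enc_outcome"
  unfolding enc_outcome_def by (intro inj_enc_pair inj_enc_list inj_enc_rat)

definition market_problem :: "real \<Rightarrow> real \<Rightarrow> (nat, nat) market set \<Rightarrow> search_problem" where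
  "market_problem \<epsilon> \<delta> F = \<lparr>
     instances = {enc_market D |D. valid_market_data D \<and> market_of D \<in> F},
     solutions = (\<lambda>z. {enc_outcome A |D A. z = enc_market D \<and> market_solution \<epsilon> \<delta> D A})\<rparr>"

end

theory Submission
  imports Defs
begin

text \<open>
  A reader is a buyer with budget 1 that values one good linearly (its target) and another one
  (its source) with a much larger slope up to a small cap: it spends what its cap costs on the
  source and the remaining money on the target. A group of readers thus lowers the price of the
  target when the price of the source is high, and stops supporting it altogether once the source
  price exceeds the inverse of the cap. Together with one buyer per good that wants only this
  good, which keeps all prices bounded away from 0, such groups implement negation gates with
  enough gain to absorb market clearing errors below 1/9. Two groups reading the same source into
  one target form a \<open>NAND\<close> gate. Two groups reading the same source with different
  thresholds have outputs of which at least one is pure whatever the source price is, and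
  negating both gives a \<open>PURIFY\<close> gate.

  A buyer that is only approximately optimal may waste a small part of its budget anywhere, so
  that the waste may accumulate on some goods. On average it is small, hence only few gates have
  a good with much waste; this is where a constant fraction of unsatisfied gates is needed.
\<close>

section \<open>Polynomial-time functions\<close>

text \<open>Two requirements on the slope \<open>5000\<close> pull against each other. It must beat
  the ratio of source price to target price, or a reader does not fill its cap; but the error of a
  nearly optimal reader grows with it. The price bounds are found without it: no price is below 4/5,
  and a good with little waste costs at most 2000, because boundedly many readers value it. The
  source then gives at least twice as much utility for the money. Prices of goods with much waste
  are not controlled one by one, but all prices together are at most 9/8 of the total budget, and
  this bounds the sum of the errors. The readers of a good consume at most 5/6 of a unit, so a group
  that saturates at source price \<open>d\<close> commands up to \<open>5 / 6 * d\<close>, while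
  about \<open>(10 / 9 - 5 / 6) * d = 5 / 18 * d\<close> of incoming money lifts a price to
  \<open>d\<close>. This gain of about 3 pays for the two thresholds of \<open>PURIFY\<close>: one
  group must be switched off at a source price at which the other one is still strong.\<close>

definition merge :: "nat \<Rightarrow> store \<Rightarrow> store \<Rightarrow> store" where
  "merge n s r = (\<lambda>v. if v < n then s v else r v)"

fun uses_below :: "nat \<Rightarrow> com \<Rightarrow> bool" where
  "uses_below n (SetNil x) \<longleftrightarrow> x < n"
| "uses_below n (Copy x y) \<longleftrightarrow> x < n \<and> y < n"
| "uses_below n (Join x y z) \<longleftrightarrow> x < n \<and> y < n \<and> z < n"
| "uses_below n (Head x y) \<longleftrightarrow> x < n \<and> y < n"
| "uses_below n (Tail x y) \<longleftrightarrow> x < n \<and> y < n"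
| "uses_below n (Seq c d) \<longleftrightarrow> uses_below n c \<and> uses_below n d"
| "uses_below n (Cond x c d) \<longleftrightarrow> x < n \<and> uses_below n c \<and> uses_below n d"
| "uses_below n (While x c) \<longleftrightarrow> x < n \<and> uses_below n c"

lemma uses_below_mono: "uses_below m c \<Longrightarrow> m \<le> n \<Longrightarrow> uses_below n c"
  by (induction c) auto

lemma uses_below_exists: "\<exists>n. uses_below n c"
proof (induction c)
  case (Seq c d)
  then obtain m n where "uses_below m c" "uses_below n d" by blast
  then show ?case by (intro exI[of _ "max m n"]) (auto elim: uses_below_mono)
next
  case (Cond x c d)
  then obtain m n where "uses_below m c" "uses_below n d" by blast
  then show ?case by (intro exI[of _ "max (Suc x) (max m n)"]) (auto elim: uses_below_mono)
next
  case (While x c)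
  then obtain n where "uses_below n c" by blast
  then show ?case by (intro exI[of _ "max (Suc x) n"]) (auto elim: uses_below_mono)
next
  case (SetNil x) show ?case by (intro exI[of _ "Suc x"]) simp
next
  case (Copy x y) show ?case by (intro exI[of _ "Suc (x + y)"]) simp
next
  case (Join x y z) show ?case by (intro exI[of _ "Suc (x + y + z)"]) simp
next
  case (Head x y) show ?case by (intro exI[of _ "Suc (x + y)"]) simp
next
  case (Tail x y) show ?case by (intro exI[of _ "Suc (x + y)"]) simp
qed

lemma merge_upd: "x < n \<Longrightarrow> merge n (s(x := a)) r = (merge n s r)(x := a)"
  by (auto simp: merge_def)

lemma merge_below: "x < n \<Longrightarrow> merge n s r x = s x"
  by (simp add: merge_def)

text \<open>The program never looks at registers from \<open>n\<close> on, so their content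
  \<open>r\<close> rides along and neither the run nor its cost depends on it.\<close>

lemma exec_frame: "exec c s t s' \<Longrightarrow> uses_below n c \<Longrightarrow> exec c (merge n s r) t (merge n s' r)"
proof (induction rule: exec.induct)
  case (SetNil x s)
  then show ?case using exec.SetNil[of x "merge n s r"] by (simp only: merge_upd uses_below.simps)
next
  case (Copy x y s)
  then show ?case using exec.Copy[of x y "merge n s r"] by (simp only: merge_upd merge_below uses_below.simps)
next
  case (Join x y z s)
  then show ?case using exec.Join[of x y z "merge n s r"] by (simp only: merge_upd merge_below uses_below.simps)
next
  case (Head x y s)
  then show ?case using exec.Head[of x y "merge n s r"] by (simp only: merge_upd merge_below uses_below.simps)
next
  case (Tail x y s)
  then show ?case using exec.Tail[of x y "merge n s r"] by (simp only: merge_upd merge_below uses_below.simps)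
next
  case (Seq c1 s t1 s' c2 t2 s'')
  then show ?case by (auto intro: exec.Seq)
next
  case (CondTrue s x c1 t s' c2)
  then show ?case by (intro exec.CondTrue) (auto simp: merge_below)
next
  case (CondFalse s x c2 t s' c1)
  then show ?case by (intro exec.CondFalse) (auto simp: merge_below)
next
  case (WhileFalse s x c)
  then show ?case by (intro exec.WhileFalse) (auto simp: merge_below)
next
  case (WhileTrue s x c t1 s' t2 s'')
  then show ?case by (intro exec.WhileTrue) (auto simp: merge_below)
qed

text \<open>An assignment costs more than the size of the tree it writes, so a register that changed
  holds a tree that was paid for during the run.\<close>

lemma exec_size: "exec c s t s' \<Longrightarrow> s' v = s v \<or> size (s' v) \<le> t"
  by (induction rule: exec.induct) auto

text \<open>Register 0 is spared because it holds the input. The language has no idle command, so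
  the base case clears a scratch register.\<close>

fun clear :: "nat \<Rightarrow> com" where
  "clear 0 = SetNil 1"
| "clear (Suc k) = Seq (clear k) (SetNil (Suc k))"

lemma exec_clear:
  "exec (clear k) s (Suc k) (\<lambda>v. if 1 \<le> v \<and> v \<le> max 1 k then NIL else s v)"
proof (induction k)
  case 0
  have "(\<lambda>v. if 1 \<le> v \<and> v \<le> max 1 0 then NIL else s v) = s(1 := NIL)" by auto
  then show ?case using exec.SetNil[of 1 s] by (simp only: clear.simps One_nat_def)
next
  case (Suc k)
  have eq: "(\<lambda>v. if 1 \<le> v \<and> v \<le> max 1 (Suc k) then NIL else s v)
      = (\<lambda>v. if 1 \<le> v \<and> v \<le> max 1 k then NIL else s v)(Suc k := NIL)"
    by (auto simp: fun_eq_iff)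
  from exec.Seq[OF Suc.IH exec.SetNil[of "Suc k"]] show ?case
    unfolding eq by simp
qed

section \<open>Polynomial bounds in the size of the input\<close>

lemma poly_nat_mono: "x \<le> y \<Longrightarrow> poly p x \<le> poly p (y :: nat)"
  by (induction p) (auto intro: add_mono mult_mono)

definition poly_bounded :: "(sexp \<Rightarrow> nat) \<Rightarrow> bool" where
  "poly_bounded h \<longleftrightarrow> (\<exists>p. \<forall>x. h x \<le> poly p (size x))"

lemma poly_bounded_const: "poly_bounded (\<lambda>_. k)"
  unfolding poly_bounded_def by (intro exI[of _ "[:k:]"]) simp

lemma poly_bounded_size: "poly_bounded size"
  unfolding poly_bounded_def by (intro exI[of _ "[:0, 1:]"]) simp

lemma poly_bounded_add:
  "poly_bounded g \<Longrightarrow> poly_bounded h \<Longrightarrow> poly_bounded (\<lambda>x. g x + h x)"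
  proof -
  assume "poly_bounded g" "poly_bounded h"
  then obtain p q where "\<And>x. g x \<le> poly p (size x)" "\<And>x. h x \<le> poly q (size x)"
    unfolding poly_bounded_def by blast
  then have "g x + h x \<le> poly (p + q) (size x)" for x by (simp add: add_mono)
  then show ?thesis unfolding poly_bounded_def by blast
qed

lemma poly_bounded_Suc: "poly_bounded g \<Longrightarrow> poly_bounded (\<lambda>x. Suc (g x))"
  using poly_bounded_add[OF poly_bounded_const[of 1], of g] by simp

lemma poly_bounded_mult:
  "poly_bounded g \<Longrightarrow> poly_bounded h \<Longrightarrow> poly_bounded (\<lambda>x. g x * h x)"
  proof -
  assume "poly_bounded g" "poly_bounded h"
  then obtain p q where "\<And>x. g x \<le> poly p (size x)" "\<And>x. h x \<le> poly q (size x)"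
    unfolding poly_bounded_def by blast
  then have "g x * h x \<le> poly (p * q) (size x)" for x by (simp add: mult_mono)
  then show ?thesis unfolding poly_bounded_def by blast
qed

lemma poly_bounded_poly: "poly_bounded g \<Longrightarrow> poly_bounded (\<lambda>x. poly p (g x))"
  proof -
  assume "poly_bounded g"
  then obtain q where "\<And>x. g x \<le> poly q (size x)"
    unfolding poly_bounded_def by blast
  then have "poly p (g x) \<le> poly (pcompose p q) (size x)" for x
    by (simp add: poly_pcompose poly_nat_mono)
  then show ?thesis unfolding poly_bounded_def by blast
qed

lemmas poly_bounded_intros =
  poly_bounded_const poly_bounded_size poly_bounded_Suc poly_bounded_add poly_bounded_mult poly_bounded_poly

lemma poly_bounded_mono: "poly_bounded h \<Longrightarrow> (\<And>x. g x \<le> h x) \<Longrightarrow> poly_bounded g"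
  unfolding poly_bounded_def using order_trans by blast

text \<open>Clearing the scratch registers first makes a program reusable from any store.\<close>

lemma poly_time_reusable:
  assumes "poly_time f"
  obtains c n p where
    "\<And>s. \<exists>t s'. exec c s t s' \<and> s' 0 = f (s 0) \<and> (\<forall>v\<ge>n. s' v = s v) \<and> t \<le> poly p (size (s 0))"
proof -
  from assms obtain c p where c: "\<And>x. \<exists>t s. exec c ((\<lambda>_. NIL)(0 := x)) t s \<and> s 0 = f x \<and>
      t \<le> poly p (size x)"
    unfolding poly_time_def by blast
  obtain n0 where "uses_below n0 c" using uses_below_exists by blast
  define n where "n = n0 + 2"
  have n: "uses_below n c" using \<open>uses_below n0 c\<close> by (rule uses_below_mono) (simp add: n_def)
  have "\<exists>t s'. exec (Seq (clear n) c) s t s' \<and> s' 0 = f (s 0) \<and> (\<forall>v\<ge>Suc n. s' v = s v) \<and>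
      t \<le> poly ([:Suc n:] + p) (size (s 0))" for s
  proof -
    let ?r = "\<lambda>v. if 1 \<le> v \<and> v \<le> max 1 n then NIL else s v"
    obtain t s' where s': "exec c ((\<lambda>_. NIL)(0 := s 0)) t s'" "s' 0 = f (s 0)"
      "t \<le> poly p (size (s 0))" using c by blast
    \<comment> \<open>Below \<open>n\<close> the cleared store agrees with the initial store of
      \<open>poly_time\<close> on input \<open>s 0\<close>, so the run of \<open>c\<close> transfers
      by framing.\<close>
    have "merge n ((\<lambda>_. NIL)(0 := s 0)) ?r = ?r"
    proof
      fix v show "merge n ((\<lambda>_. NIL)(0 := s 0)) ?r v = ?r v"
        by (cases v) (auto simp: merge_def n_def)
    qed
    with exec_frame[OF s'(1) n, of ?r] have "exec c ?r t (merge n s' ?r)" by simp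
    from exec.Seq[OF exec_clear this] show ?thesis
      by (intro exI conjI, assumption) (use s' in \<open>auto simp: merge_def n_def\<close>)
  qed
  then show ?thesis by (rule that)
qed

lemma poly_time_size_bound:
  assumes "poly_time f"
  obtains p where "\<And>x. size (f x) \<le> poly p (size x)"
proof -
  from assms obtain c p where c: "\<And>x. \<exists>t s. exec c ((\<lambda>_. NIL)(0 := x)) t s \<and> s 0 = f x \<and>
      t \<le> poly p (size x)"
    unfolding poly_time_def by blast
  have "size (f x) \<le> poly ([:0, 1:] + p) (size x)" for x
  proof -
    obtain t s where "exec c ((\<lambda>_. NIL)(0 := x)) t s" "s 0 = f x" "t \<le> poly p (size x)"
      using c by blast
    with exec_size[of c _ t s 0] show ?thesis by fastforce
  qed
  then show ?thesis by (rule that)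
qed

lemma poly_bounded_poly_time:
  "poly_time f \<Longrightarrow> poly_bounded (\<lambda>x. size (f x))"
  by (meson poly_bounded_def poly_time_size_bound)

text \<open>A program used as a subroutine with argument register \<open>y\<close> and result
  register \<open>x\<close>. The registers below \<open>m\<close> are its scratch space; all others
  except \<open>x\<close> survive the call.\<close>

definition calls :: "(nat \<Rightarrow> nat \<Rightarrow> com) \<Rightarrow> nat \<Rightarrow> nat poly \<Rightarrow> (sexp \<Rightarrow> sexp) \<Rightarrow> bool" where
  "calls c n p f \<longleftrightarrow> (\<forall>m x y s. n \<le> m \<longrightarrow> m \<le> y \<longrightarrow> (\<exists>t s'. exec (c x y) s t s' \<and> s' x = f (s y) \<and>
     (\<forall>v\<ge>m. v \<noteq> x \<longrightarrow> s' v = s v) \<and> t \<le> poly p (size (s y))))"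

lemma callsD:
  assumes "calls c n p f" "n \<le> m" "m \<le> y"
  shows "\<exists>t s'. exec (c x y) s t s' \<and> s' x = f (s y) \<and>
     (\<forall>v\<ge>m. v \<noteq> x \<longrightarrow> s' v = s v) \<and> t \<le> poly p (size (s y))"
  using assms unfolding calls_def by blast

lemma poly_time_call:
  assumes "poly_time f"
  obtains c n p where "calls c n p f"
proof -
  obtain c n p where c:
    "\<And>s. \<exists>t s'. exec c s t s' \<and> s' 0 = f (s 0) \<and> (\<forall>v\<ge>n. s' v = s v) \<and> t \<le> poly p (size (s 0))"
    using poly_time_reusable[OF assms] by blast
  obtain q where q: "\<And>x. size (f x) \<le> poly q (size x)"
    using poly_time_size_bound[OF assms] by blast
  have "\<exists>t s'. exec (Seq (Seq (Copy 0 y) c) (Copy x 0)) s t s' \<and> s' x = f (s y) \<and>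
       (\<forall>v\<ge>m. v \<noteq> x \<longrightarrow> s' v = s v) \<and> t \<le> poly ([:2, 1:] + p + q) (size (s y))"
    if m: "max 1 n \<le> m" "m \<le> y" for m x y s
  proof -
    obtain t s' where s': "exec c (s(0 := s y)) t s'" "s' 0 = f (s y)" "\<forall>v\<ge>n. s' v = (s(0 := s y)) v"
      "t \<le> poly p (size (s y))" using c[of "s(0 := s y)"] by auto
    show ?thesis
      using exec.Seq[OF exec.Seq[OF exec.Copy[of 0 y s] s'(1)] exec.Copy[of x 0 s']]
      apply (intro exI conjI, assumption)
      using s' m q[of "s y"] by auto
  qed
  note * = this
  have "calls (\<lambda>x y. Seq (Seq (Copy 0 y) c) (Copy x 0)) (max 1 n) ([:2, 1:] + p + q) f"
    unfolding calls_def by (intro allI impI, rule *) assumption+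
  then show ?thesis by (rule that)
qed

section \<open>Closure properties of polynomial-time functions\<close>

lemma poly_timeI:
  assumes "\<And>x. \<exists>t s. exec c ((\<lambda>_. NIL)(0 := x)) t s \<and> s 0 = f x \<and> t \<le> h x" "poly_bounded h"
  shows "poly_time f"
proof -
  obtain p where p: "\<And>x. h x \<le> poly p (size x)" using assms(2) unfolding poly_bounded_def by blast
  have "\<exists>t s. exec c ((\<lambda>_. NIL)(0 := x)) t s \<and> s 0 = f x \<and> t \<le> poly p (size x)" for x
    using assms(1)[of x] order_trans[OF _ p[of x]] by blast
  then show ?thesis unfolding poly_time_def by (intro exI[of _ c] exI[of _ p] allI)
qed

lemma poly_time_id [intro]: "poly_time (\<lambda>x. x)"
proof (rule poly_timeI)
  fix x
  show "\<exists>t s. exec (Copy 0 0) ((\<lambda>_. NIL)(0 := x)) t s \<and> s 0 = x \<and> t \<le> 1 + size x"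
    using exec.Copy[of 0 0 "(\<lambda>_. NIL)(0 := x)"] by (intro exI conjI, assumption) auto
qed (intro poly_bounded_intros)

lemma poly_time_comp:
  assumes "poly_time f" "poly_time g"
  shows "poly_time (\<lambda>x. f (g x))"
proof -
  obtain c n p where c:
    "\<And>s. \<exists>t s'. exec c s t s' \<and> s' 0 = f (s 0) \<and> (\<forall>v\<ge>n. s' v = s v) \<and> t \<le> poly p (size (s 0))"
    using poly_time_reusable[OF assms(1)] by blast
  obtain d m q where d:
    "\<And>s. \<exists>t s'. exec d s t s' \<and> s' 0 = g (s 0) \<and> (\<forall>v\<ge>m. s' v = s v) \<and> t \<le> poly q (size (s 0))"
    using poly_time_reusable[OF assms(2)] by blast
  show ?thesis
  proof (rule poly_timeI)
    show "poly_bounded (\<lambda>x. poly q (size x) + poly p (size (g x)))"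
      by (intro poly_bounded_intros poly_bounded_poly_time[OF assms(2)])
    fix x
    obtain t s where s: "exec d ((\<lambda>_. NIL)(0 := x)) t s" "s 0 = g x" "t \<le> poly q (size x)"
      using d[of "(\<lambda>_. NIL)(0 := x)"] by auto
    obtain t' s' where "exec c s t' s'" "s' 0 = f (g x)" "t' \<le> poly p (size (g x))"
      using c[of s] s(2) by auto
    with s show "\<exists>t s. exec (Seq d c) ((\<lambda>_. NIL)(0 := x)) t s \<and> s 0 = f (g x) \<and>
        t \<le> poly q (size x) + poly p (size (g x))"
      by (intro exI[of _ "t + t'"] exI[of _ s'] conjI exec.Seq[of d _ t s]) auto
  qed
qed

lemma poly_time_hd [intro]: "poly_time f \<Longrightarrow> poly_time (\<lambda>x. hd_sexp (f x))"
proof (rule poly_time_comp[where f = hd_sexp])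
  have "size (hd_sexp x) \<le> size x" for x by (cases x) auto
  note le = this
  show "poly_time hd_sexp"
  proof (rule poly_timeI)
    fix x
    show "\<exists>t s. exec (Head 0 0) ((\<lambda>_. NIL)(0 := x)) t s \<and> s 0 = hd_sexp x \<and> t \<le> 1 + size x"
      by (intro exI conjI, rule exec.Head) (use le[of x] in auto)
  qed (intro poly_bounded_intros)
qed

lemma poly_time_tl [intro]: "poly_time f \<Longrightarrow> poly_time (\<lambda>x. tl_sexp (f x))"
proof (rule poly_time_comp[where f = tl_sexp])
  have "size (tl_sexp x) \<le> size x" for x by (cases x) auto
  note le = this
  show "poly_time tl_sexp"
  proof (rule poly_timeI)
    fix x
    show "\<exists>t s. exec (Tail 0 0) ((\<lambda>_. NIL)(0 := x)) t s \<and> s 0 = tl_sexp x \<and> t \<le> 1 + size x"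
      by (intro exI conjI, rule exec.Tail) (use le[of x] in auto)
  qed (intro poly_bounded_intros)
qed

lemma poly_time_cons [intro]:
  assumes "poly_time f" "poly_time g"
  shows "poly_time (\<lambda>x. CONS (f x) (g x))"
proof -
  obtain c n p where c: "calls c n p f"
    using poly_time_call[OF assms(1)] by blast
  obtain d m q where d: "calls d m q g"
    using poly_time_call[OF assms(2)] by blast
  define X where "X = Suc (max m n)"
  have X: "m \<le> X" "n \<le> X" by (auto simp: X_def)
  show ?thesis
  proof (rule poly_timeI)
    fix x
    let ?s = "((\<lambda>_. NIL)(0 := x))(X := x)"
    have 0: "exec (Copy X 0) ((\<lambda>_. NIL)(0 := x)) (1 + size x) ?s"
      using exec.Copy[of X 0 "(\<lambda>_. NIL)(0 := x)"] by simp
    obtain t1 s1 where s1: "exec (c (X + 1) X) ?s t1 s1" "s1 (X + 1) = f x" "s1 X = x"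
      "t1 \<le> poly p (size x)"
      using callsD[OF c X(2) order_refl, of "X + 1" ?s] by auto
    obtain t2 s2 where s2: "exec (d (X + 2) X) s1 t2 s2" "s2 (X + 2) = g x" "s2 (X + 1) = f x"
      "t2 \<le> poly q (size x)"
      using callsD[OF d X(1) order_refl, of "X + 2" s1] s1 by auto
    from exec.Seq[OF exec.Seq[OF exec.Seq[OF 0 s1(1)] s2(1)] exec.Join[of 0 "X + 1" "X + 2" s2]]
    show "\<exists>t s. exec (Seq (Seq (Seq (Copy X 0) (c (X + 1) X)) (d (X + 2) X)) (Join 0 (X + 1) (X + 2)))
        ((\<lambda>_. NIL)(0 := x)) t s \<and> s 0 = CONS (f x) (g x) \<and>
        t \<le> size x + poly p (size x) + poly q (size x) + size (f x) + size (g x) + 3"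
      apply (intro exI conjI, assumption) using s1 s2 by auto
  next
    show "poly_bounded (\<lambda>x. size x + poly p (size x) + poly q (size x) + size (f x) + size (g x) + 3)"
      by (intro poly_bounded_intros poly_bounded_poly_time[OF assms(1)] poly_bounded_poly_time[OF assms(2)])
  qed
qed

lemma poly_time_const [intro]: "poly_time (\<lambda>_. k)"
proof (induction k)
  case NIL
  show ?case
  proof (rule poly_timeI)
    fix x
    show "\<exists>t s. exec (SetNil 0) ((\<lambda>_. NIL)(0 := x)) t s \<and> s 0 = NIL \<and> t \<le> 1"
      using exec.SetNil[of 0 "(\<lambda>_. NIL)(0 := x)"] by (intro exI conjI, assumption) auto
  qed (intro poly_bounded_intros)
qed (rule poly_time_cons)

lemma poly_time_if [intro]:
  assumes "poly_time b" "poly_time f" "poly_time g"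
  shows "poly_time (\<lambda>x. if b x = NIL then f x else g x)"
proof -
  obtain c n p where c: "calls c n p b"
    using poly_time_call[OF assms(1)] by blast
  obtain d1 m1 q1 where d1: "calls d1 m1 q1 f"
    using poly_time_call[OF assms(2)] by blast
  obtain d2 m2 q2 where d2: "calls d2 m2 q2 g"
    using poly_time_call[OF assms(3)] by blast
  define X where "X = Suc (max n (max m1 m2))"
  have X: "n \<le> X" "m1 \<le> X" "m2 \<le> X" by (auto simp: X_def)
  show ?thesis
  proof (rule poly_timeI)
    fix x
    let ?s = "((\<lambda>_. NIL)(0 := x))(X := x)"
    have 0: "exec (Copy X 0) ((\<lambda>_. NIL)(0 := x)) (1 + size x) ?s"
      using exec.Copy[of X 0 "(\<lambda>_. NIL)(0 := x)"] by simp
    obtain t1 s1 where s1: "exec (c (X + 1) X) ?s t1 s1" "s1 (X + 1) = b x" "s1 X = x"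
      "t1 \<le> poly p (size x)"
      using callsD[OF c X(1) order_refl, of "X + 1" ?s] by auto
    have "\<exists>t s. exec (Cond (X + 1) (d2 0 X) (d1 0 X)) s1 t s \<and>
        s 0 = (if b x = NIL then f x else g x) \<and> t \<le> 1 + poly q1 (size x) + poly q2 (size x)"
    proof (cases "b x = NIL")
      case True
      obtain t s where "exec (d1 0 X) s1 t s" "s 0 = f x" "t \<le> poly q1 (size x)"
        using callsD[OF d1 X(2) order_refl, of "0" s1] s1 by auto
      with True s1(2) exec.CondFalse[of s1 "X + 1" "d1 0 X" t s "d2 0 X"] show ?thesis
        by (intro exI[of _ "1 + t"] exI[of _ s]) auto
    next
      case False
      obtain t s where "exec (d2 0 X) s1 t s" "s 0 = g x" "t \<le> poly q2 (size x)"
        using callsD[OF d2 X(3) order_refl, of "0" s1] s1 by auto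
      with False s1(2) exec.CondTrue[of s1 "X + 1" "d2 0 X" t s "d1 0 X"] show ?thesis
        by (intro exI[of _ "1 + t"] exI[of _ s]) auto
    qed
    then obtain t s where s: "exec (Cond (X + 1) (d2 0 X) (d1 0 X)) s1 t s"
        "s 0 = (if b x = NIL then f x else g x)" "t \<le> 1 + poly q1 (size x) + poly q2 (size x)"
      by blast
    from exec.Seq[OF exec.Seq[OF 0 s1(1)] s(1)]
    show "\<exists>t s. exec (Seq (Seq (Copy X 0) (c (X + 1) X)) (Cond (X + 1) (d2 0 X) (d1 0 X)))
        ((\<lambda>_. NIL)(0 := x)) t s \<and> s 0 = (if b x = NIL then f x else g x) \<and>
        t \<le> size x + poly p (size x) + poly q1 (size x) + poly q2 (size x) + 2"
      apply (intro exI conjI, assumption) using s s1 by auto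
  next
    show "poly_bounded (\<lambda>x. size x + poly p (size x) + poly q1 (size x) + poly q2 (size x) + 2)"
      by (intro poly_bounded_intros)
  qed
qed

section \<open>Folds over lists as loops\<close>

fun sfold :: "(sexp \<Rightarrow> sexp) \<Rightarrow> sexp \<Rightarrow> sexp \<Rightarrow> sexp \<Rightarrow> sexp" where
  "sfold f c NIL a = a"
| "sfold f c (CONS h t) a = sfold f c t (f (CONS c (CONS h a)))"

text \<open>\<open>L\<close>, \<open>A\<close>, \<open>C\<close> and \<open>H\<close> are the
  registers of the remaining list, the accumulator, the fixed context and a scratch tree.
  \<open>G\<close> bounds the growth of the accumulator in one step and \<open>M\<close> the sizes
  in the whole loop; both are fixed beforehand so that one time bound serves every
  iteration.\<close>

definition loops :: "(nat \<Rightarrow> nat \<Rightarrow> nat \<Rightarrow> nat \<Rightarrow> com) \<Rightarrow> nat \<Rightarrow> nat poly \<Rightarrow> nat poly \<Rightarrow> (sexp \<Rightarrow> sexp) \<Rightarrow> bool" where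
  "loops b n p q f \<longleftrightarrow> (\<forall>L A C H s M G. n \<le> L \<longrightarrow> n \<le> A \<longrightarrow> n \<le> C \<longrightarrow> n \<le> H \<longrightarrow> distinct [L, A, C, H] \<longrightarrow>
     poly q (size (s C) + size (s L)) \<le> G \<longrightarrow>
     size (s C) + 2 * size (s L) + size (s A) + size (s L) * G \<le> M \<longrightarrow>
     (\<exists>t s'. exec (While L (b L A C H)) s t s' \<and> s' A = sfold f (s C) (s L) (s A) \<and>
      t \<le> 1 + size (s L) * poly p M))"

text \<open>The growth of the accumulator in a step may depend on the context and the element but
  not on the accumulator itself, since repeated doubling would make it exponential. Under this
  hypothesis \<open>size A + size L * G\<close> never increases: every iteration shortens the list
  and adds at most \<open>G\<close>.\<close>

lemma sfold_time:
  assumes f: "poly_time f" and g: "\<And>c h a. size (f (CONS c (CONS h a))) \<le> size a + poly q (size c + size h)"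
  obtains b n p where "loops b n p q f"
proof -
  obtain c n p where c: "calls c n p f"
    using poly_time_call[OF f] by blast
  let ?b = "\<lambda>L A C H. Seq (Seq (Seq (Seq (Head H L) (Join H H A)) (Join H C H)) (c A H)) (Tail L L)"
  have "\<exists>t s'. exec (While L (?b L A C H)) s t s' \<and> s' A = sfold f (s C) (s L) (s A) \<and>
      t \<le> 1 + size (s L) * poly ([:10, 4:] + pcompose p [:2, 1:]) M"
    if LA: "n \<le> L" "n \<le> A" "n \<le> C" "n \<le> H" "distinct [L, A, C, H]"
     and G: "poly q (size (s C) + size (s L)) \<le> G"
     and M: "size (s C) + 2 * size (s L) + size (s A) + size (s L) * G \<le> M" for L A C H s M G
    using G M
  proof (induction "s L" arbitrary: s)
    case NIL
    then show ?case
      by (intro exI[of _ 1] exI[of _ s]) (auto intro: exec.WhileFalse[of s L, simplified])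
  next
    case (CONS h l)
    note sL = CONS(3)[symmetric]
    let ?s1 = "s(H := CONS (s C) (CONS h (s A)))"
    have 1: "exec (Seq (Seq (Head H L) (Join H H A)) (Join H C H)) s
        (1 + size h + (1 + size (CONS h (s A))) + (1 + size (CONS (s C) (CONS h (s A))))) ?s1"
      using exec.Seq[OF exec.Seq[OF exec.Head[of H L s] exec.Join[of H H A]] exec.Join[of H C H]] sL LA
      by auto
    have "n \<le> n" "n \<le> H" using LA by auto
    from callsD[OF c this, of A ?s1]
    obtain t2 s2 where s2: "exec (c A H) ?s1 t2 s2" "s2 A = f (CONS (s C) (CONS h (s A)))"
      "\<forall>v\<ge>n. v \<noteq> A \<longrightarrow> s2 v = ?s1 v" "t2 \<le> poly p (size (CONS (s C) (CONS h (s A))))"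
      by auto
    let ?s3 = "s2(L := l)"
    have 3: "exec (Tail L L) s2 (1 + size l) ?s3"
      using exec.Tail[of L L s2] s2(3) sL LA by auto
    have s3: "?s3 L = l" "?s3 C = s C" "?s3 A = f (CONS (s C) (CONS h (s A)))"
      using s2 LA by auto
    have G3: "poly q (size (?s3 C) + size (?s3 L)) \<le> G"
      using poly_nat_mono[of "size (s C) + size l" "size (s C) + size (s L)" q] CONS.prems(1)
      by (simp add: s3 sL del: fun_upd_apply)
    have "poly q (size (s C) + size h) \<le> G"
      using poly_nat_mono[of "size (s C) + size h" "size (s C) + size (s L)" q] CONS.prems(1)
      by (simp add: sL)
    with g[of "s C" h "s A"] have gA: "size (?s3 A) \<le> size (s A) + G" using s3 by simp
    have M3: "size (?s3 C) + 2 * size (?s3 L) + size (?s3 A) + size (?s3 L) * G \<le> M"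
      using gA CONS.prems(2) by (simp add: s3 sL algebra_simps del: fun_upd_apply)
    obtain t4 s4 where
      s4: "exec (While L (?b L A C H)) ?s3 t4 s4" "s4 A = sfold f (?s3 C) (?s3 L) (?s3 A)"
      "t4 \<le> 1 + size (?s3 L) * poly ([:10, 4:] + pcompose p [:2, 1:]) M"
      using CONS.hyps(2)[OF s3(1)[symmetric] G3 M3] by blast
    have s4A: "s4 A = sfold f (s C) (s L) (s A)"
      unfolding s4(2) s3 sL by simp
    have t4: "t4 \<le> 1 + size l * poly ([:10, 4:] + pcompose p [:2, 1:]) M"
      using s4(3) unfolding s3 .
    have b: "exec (?b L A C H) s (1 + size h + (1 + size (CONS h (s A))) + (1 + size (CONS (s C) (CONS h (s A)))) + t2 + (1 + size l)) ?s3"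
      using exec.Seq[OF exec.Seq[OF 1 s2(1)] 3] by simp
    have "poly p (size (CONS (s C) (CONS h (s A)))) \<le> poly p (2 + M)"
      by (rule poly_nat_mono) (use CONS.prems(2) in \<open>simp add: sL\<close>)
    moreover have "3 * size h + 2 * size (s A) + size (s C) + size l \<le> 4 * M"
      using CONS.prems(2) by (simp add: sL)
    ultimately have "1 + (1 + size h + (1 + size (CONS h (s A))) + (1 + size (CONS (s C) (CONS h (s A)))) + t2 + (1 + size l)) + t4
        \<le> 1 + size (s L) * poly ([:10, 4:] + pcompose p [:2, 1:]) M"
      using s2(4) t4 by (simp add: sL poly_pcompose algebra_simps)
    moreover have "exec (While L (?b L A C H)) s
        (1 + (1 + size h + (1 + size (CONS h (s A))) + (1 + size (CONS (s C) (CONS h (s A)))) + t2 + (1 + size l)) + t4) s4"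
      by (rule exec.WhileTrue[OF _ b s4(1)]) (simp add: sL)
    ultimately show ?case using s4A by blast
  qed
  note * = this
  have "loops ?b n ([:10, 4:] + pcompose p [:2, 1:]) q f"
    unfolding loops_def by (intro allI impI, rule *) assumption+
  then show ?thesis by (rule that)
qed

lemma poly_time_sfold [intro]:
  assumes f: "poly_time f" and "poly_time c" "poly_time l" "poly_time a"
    and g: "\<And>c h a. size (f (CONS c (CONS h a))) \<le> size a + poly q (size c + size h)"
  shows "poly_time (\<lambda>x. sfold f (c x) (l x) (a x))"
proof -
  obtain b n p where b: "loops b n p q f"
    using sfold_time[OF f g] by blast
  obtain cc nc pc where cc: "calls cc nc pc c"
    using poly_time_call[OF assms(2)] by blast
  obtain cl nl pl where cl: "calls cl nl pl l"
    using poly_time_call[OF assms(3)] by blast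
  obtain ca na pa where ca: "calls ca na pa a"
    using poly_time_call[OF assms(4)] by blast
  define X where "X = Suc (n + nc + nl + na)"
  have X: "n \<le> X" "nc \<le> X" "nl \<le> X" "na \<le> X" by (auto simp: X_def)
  let ?M = "\<lambda>x. size (c x) + 2 * size (l x) + size (a x) + size (l x) * poly q (size (c x) + size (l x))"
  let ?h = "\<lambda>x. size x + poly pc (size x) + poly pl (size x) + poly pa (size x) +
      size (l x) * poly p (?M x) + size (sfold f (c x) (l x) (a x)) + 3"
  have "\<exists>t s. exec (Seq (Seq (Seq (Seq (Seq (Copy X 0) (cc (X + 1) X)) (cl (X + 2) X)) (ca (X + 3) X))
      (While (X + 2) (b (X + 2) (X + 3) (X + 1) (X + 4)))) (Copy 0 (X + 3))) ((\<lambda>_. NIL)(0 := x)) t s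
      \<and> s 0 = sfold f (c x) (l x) (a x) \<and> t \<le> ?h x" for x
  proof -
    let ?s = "((\<lambda>_. NIL)(0 := x))(X := x)"
    have 0: "exec (Copy X 0) ((\<lambda>_. NIL)(0 := x)) (1 + size x) ?s"
      using exec.Copy[of X 0 "(\<lambda>_. NIL)(0 := x)"] by simp
    obtain t1 s1 where s1: "exec (cc (X + 1) X) ?s t1 s1" "s1 (X + 1) = c x" "s1 X = x"
      "t1 \<le> poly pc (size x)"
      using callsD[OF cc X(2) order_refl, of "X + 1" ?s] by auto
    obtain t2 s2 where s2: "exec (cl (X + 2) X) s1 t2 s2" "s2 (X + 2) = l x" "s2 (X + 1) = c x" "s2 X = x"
      "t2 \<le> poly pl (size x)"
      using callsD[OF cl X(3) order_refl, of "X + 2" s1] s1 by auto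
    obtain t3 s3 where s3: "exec (ca (X + 3) X) s2 t3 s3" "s3 (X + 3) = a x" "s3 (X + 2) = l x"
      "s3 (X + 1) = c x" "t3 \<le> poly pa (size x)"
      using callsD[OF ca X(4) order_refl, of "X + 3" s2] s2 by auto
    obtain t4 s4 where s4: "exec (While (X + 2) (b (X + 2) (X + 3) (X + 1) (X + 4))) s3 t4 s4"
      "s4 (X + 3) = sfold f (c x) (l x) (a x)" "t4 \<le> 1 + size (l x) * poly p (?M x)"
      using b[unfolded loops_def, rule_format, of "X + 2" "X + 3" "X + 1" "X + 4" s3
          "poly q (size (c x) + size (l x))" "?M x", unfolded s3] X by fastforce
    show ?thesis
      using exec.Seq[OF exec.Seq[OF exec.Seq[OF exec.Seq[OF exec.Seq[OF 0 s1(1)] s2(1)] s3(1)] s4(1)]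
          exec.Copy[of 0 "X + 3" s4]]
      apply (intro exI conjI, assumption) 
      subgoal using s4(2) by simp
      subgoal using s1(4) s2(5) s3(5) s4(2,3) by simp
      done
  qed
  note ex = this
  \<comment> \<open>The final copy into register 0 costs the size of the result, so this size needs
    a polynomial bound as well.\<close>
  have bnd: "size (sfold f c l a) \<le> size a + size l * G"
    if "poly q (size c + size l) \<le> G" for c l a G
    using that
  proof (induction l arbitrary: a)
    case (CONS h l)
    have "poly q (size c + size l) \<le> G"
      using poly_nat_mono[of "size c + size l" "size c + size (CONS h l)" q] CONS.prems by simp
    note IH = CONS.IH(2)[OF this, of "f (CONS c (CONS h a))"]
    have "poly q (size c + size h) \<le> G"
      using poly_nat_mono[of "size c + size h" "size c + size (CONS h l)" q] CONS.prems by simp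
    with IH g[of c h a] show ?case by (simp add: algebra_simps)
  qed simp
  have M: "poly_bounded ?M"
    by (intro poly_bounded_intros assms(2-4)[THEN poly_bounded_poly_time])
  have S: "poly_bounded (\<lambda>x. size (sfold f (c x) (l x) (a x)))"
    by (rule poly_bounded_mono[OF M]) (rule order_trans[OF bnd[OF order_refl]], simp)
  have "poly_bounded ?h"
    by (intro poly_bounded_intros M S assms(2-4)[THEN poly_bounded_poly_time])
  with ex show ?thesis by (rule poly_timeI)
qed

section \<open>Lists and numbers in polynomial time\<close>

lemmas poly_time_intros = poly_time_const poly_time_id poly_time_hd poly_time_tl poly_time_cons poly_time_if

definition srevapp :: "sexp \<Rightarrow> sexp \<Rightarrow> sexp" where
  "srevapp l a = sfold (\<lambda>z. CONS (hd_sexp (tl_sexp z)) (tl_sexp (tl_sexp z))) NIL l a"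

text \<open>Pushing each result in reverse onto the accumulator adds exactly its size, which fits
  the growth condition of a fold; one reversal at the end restores the order.\<close>

definition sconcat :: "(sexp \<Rightarrow> sexp) \<Rightarrow> sexp \<Rightarrow> sexp \<Rightarrow> sexp" where
  "sconcat h c l = srevapp (sfold (\<lambda>z. srevapp (h (CONS (hd_sexp z) (hd_sexp (tl_sexp z))))
     (tl_sexp (tl_sexp z))) c l NIL) NIL"

definition smap :: "(sexp \<Rightarrow> sexp) \<Rightarrow> sexp \<Rightarrow> sexp \<Rightarrow> sexp" where
  "smap h c l = sconcat (\<lambda>z. CONS (h z) NIL) c l"

definition sappend :: "sexp \<Rightarrow> sexp \<Rightarrow> sexp" where
  "sappend l r = srevapp (srevapp l NIL) r"

definition srepeat :: "sexp \<Rightarrow> sexp \<Rightarrow> sexp" where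
  "srepeat k a = sfold (\<lambda>z. CONS (hd_sexp z) (tl_sexp (tl_sexp z))) a k NIL"

definition sdrop :: "sexp \<Rightarrow> sexp \<Rightarrow> sexp" where
  "sdrop k l = sfold (\<lambda>z. tl_sexp (tl_sexp (tl_sexp z))) NIL k l"

text \<open>The names are produced from \<open>k - 1\<close> downwards. Each is cut from the context
  \<open>k\<close> and not copied from the counter in the accumulator, because the growth of a fold
  step must be bounded by the context and the element alone.\<close>

definition srange :: "sexp \<Rightarrow> sexp" where
  "srange k = tl_sexp (sfold (\<lambda>z. CONS (CONS NIL (hd_sexp (tl_sexp (tl_sexp z))))
     (CONS (tl_sexp (sdrop (hd_sexp (tl_sexp (tl_sexp z))) (hd_sexp z))) (tl_sexp (tl_sexp (tl_sexp z)))))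
     k k (CONS NIL NIL))"

lemma size_tl_le: "size (tl_sexp x) \<le> size x"
  by (cases x) auto

lemma size_hd_tl_le: "size (hd_sexp x) + size (tl_sexp x) \<le> size x"
  by (cases x) auto

lemma poly_time_srevapp [intro]:
  "poly_time l \<Longrightarrow> poly_time a \<Longrightarrow> poly_time (\<lambda>x. srevapp (l x) (a x))"
  unfolding srevapp_def
  by (rule poly_time_sfold[where q = "[:1, 1:]"]) (intro poly_time_intros | simp)+

lemma size_srevapp: "size (srevapp l a) = size l + size a"
  unfolding srevapp_def by (induction l arbitrary: a) auto

lemma poly_time_sconcat [intro]:
  assumes h: "poly_time h" and c: "poly_time c" and l: "poly_time l"
  shows "poly_time (\<lambda>x. sconcat h (c x) (l x))"
proof -
  obtain q where q: "\<And>x. size (h x) \<le> poly q (size x)" using poly_time_size_bound[OF h] by blast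
  have "poly_time (\<lambda>x. sfold (\<lambda>z. srevapp (h (CONS (hd_sexp z) (hd_sexp (tl_sexp z))))
     (tl_sexp (tl_sexp z))) (c x) (l x) NIL)"
  proof (rule poly_time_sfold[where q = "pcompose q [:1, 1:]"])
    show "poly_time (\<lambda>z. srevapp (h (CONS (hd_sexp z) (hd_sexp (tl_sexp z)))) (tl_sexp (tl_sexp z)))"
      by (intro poly_time_srevapp poly_time_comp[OF h] poly_time_intros)
    fix c k a
    have "size (h (CONS c k)) \<le> poly (pcompose q [:1, 1:]) (size c + size k)"
      using q[of "CONS c k"] by (simp add: poly_pcompose)
    then show "size (srevapp (h (CONS (hd_sexp (CONS c (CONS k a))) (hd_sexp (tl_sexp (CONS c (CONS k a))))))
        (tl_sexp (tl_sexp (CONS c (CONS k a))))) \<le> size a + poly (pcompose q [:1, 1:]) (size c + size k)"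
      by (simp add: size_srevapp)
  qed (use c l in \<open>auto intro: poly_time_const\<close>)
  then show ?thesis unfolding sconcat_def by (intro poly_time_srevapp poly_time_const)
qed

lemma poly_time_smap [intro]:
  "poly_time h \<Longrightarrow> poly_time c \<Longrightarrow> poly_time l \<Longrightarrow> poly_time (\<lambda>x. smap h (c x) (l x))"
  unfolding smap_def by (intro poly_time_sconcat poly_time_cons poly_time_const)

lemma poly_time_sappend [intro]:
  "poly_time l \<Longrightarrow> poly_time a \<Longrightarrow> poly_time (\<lambda>x. sappend (l x) (a x))"
  unfolding sappend_def by (intro poly_time_srevapp poly_time_const)

lemma poly_time_srepeat [intro]:
  "poly_time k \<Longrightarrow> poly_time a \<Longrightarrow> poly_time (\<lambda>x. srepeat (k x) (a x))"
  unfolding srepeat_def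
  by (rule poly_time_sfold[where q = "[:1, 1:]"]) (intro poly_time_intros | simp)+

lemma poly_time_sdrop [intro]:
  "poly_time k \<Longrightarrow> poly_time l \<Longrightarrow> poly_time (\<lambda>x. sdrop (k x) (l x))"
  unfolding sdrop_def
  by (rule poly_time_sfold[where q = 0]) (intro poly_time_intros | simp add: size_tl_le)+

lemma size_sdrop: "size (sdrop k l) \<le> size l"
  unfolding sdrop_def
proof (induction k arbitrary: l)
  case (CONS h k)
  then show ?case using CONS.IH(2)[of "tl_sexp l"] size_tl_le[of l] by (auto intro: order_trans)
qed simp

lemma poly_time_srange [intro]:
  assumes "poly_time k"
  shows "poly_time (\<lambda>x. srange (k x))"
  unfolding srange_def
proof (rule poly_time_tl, rule poly_time_sfold[where q = "[:3, 1:]"])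
  show "poly_time (\<lambda>z. CONS (CONS NIL (hd_sexp (tl_sexp (tl_sexp z))))
     (CONS (tl_sexp (sdrop (hd_sexp (tl_sexp (tl_sexp z))) (hd_sexp z))) (tl_sexp (tl_sexp (tl_sexp z)))))"
    by (intro poly_time_intros poly_time_sdrop)
  fix c h a
  have "size (tl_sexp (sdrop (hd_sexp a) c)) \<le> size c"
    by (rule order_trans[OF size_tl_le size_sdrop])
  with size_hd_tl_le[of a]
  show "size (CONS (CONS NIL (hd_sexp (tl_sexp (tl_sexp (CONS c (CONS h a))))))
     (CONS (tl_sexp (sdrop (hd_sexp (tl_sexp (tl_sexp (CONS c (CONS h a))))) (hd_sexp (CONS c (CONS h a)))))
       (tl_sexp (tl_sexp (tl_sexp (CONS c (CONS h a))))))) \<le> size a + poly [:3, 1:] (size c + size h)"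
    by simp
qed (use assms in \<open>auto intro: poly_time_const\<close>)

lemma enc_unary_list: "enc_unary k = enc_list (\<lambda>_. NIL) (replicate k ())"
  by (induction k) auto

lemma srevapp_enc_list: "srevapp (enc_list e xs) (enc_list e ys) = enc_list e (rev xs @ ys)"
  unfolding srevapp_def
proof (induction xs arbitrary: ys)
  case (Cons x xs)
  from Cons.IH[of "x # ys"] show ?case by simp
qed simp

lemma sappend_enc_list: "sappend (enc_list e xs) (enc_list e ys) = enc_list e (xs @ ys)"
  using srevapp_enc_list[of e xs "[]"] srevapp_enc_list[of e "rev xs" ys] by (simp add: sappend_def)

lemma sappend_enc_unary: "sappend (enc_unary m) (enc_unary n) = enc_unary (m + n)"
  by (simp add: enc_unary_list sappend_enc_list replicate_add)

lemma sconcat_enc_list: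
  assumes "\<And>x. x \<in> set xs \<Longrightarrow> h (CONS c (e x)) = enc_list e' (k x)"
  shows "sconcat h c (enc_list e xs) = enc_list e' (concat (map k xs))"
proof -
  have "sfold (\<lambda>z. srevapp (h (CONS (hd_sexp z) (hd_sexp (tl_sexp z)))) (tl_sexp (tl_sexp z)))
      c (enc_list e xs) (enc_list e' ys) = enc_list e' (rev (concat (map k xs)) @ ys)" for ys
    using assms
  proof (induction xs arbitrary: ys)
    case (Cons x xs)
    then show ?case by (simp add: srevapp_enc_list)
  qed simp
  from this[of "[]"] show ?thesis
    using srevapp_enc_list[of e' "rev (concat (map k xs))" "[]"] by (simp add: sconcat_def)
qed

lemma smap_enc_list:
  assumes "\<And>x. x \<in> set xs \<Longrightarrow> h (CONS c (e x)) = e' (k x)"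
  shows "smap h c (enc_list e xs) = enc_list e' (map k xs)"
proof -
  have "concat (map (\<lambda>x. [k x]) xs) = map k xs" by (induction xs) auto
  then show ?thesis
    using sconcat_enc_list[of xs "\<lambda>z. CONS (h z) NIL" c e e' "\<lambda>x. [k x]"] assms by (simp add: smap_def)
qed

lemma srepeat_enc: "srepeat (enc_unary k) (e x) = enc_list e (replicate k x)"
proof -
  have "sfold (\<lambda>z. CONS (hd_sexp z) (tl_sexp (tl_sexp z))) (e x) (enc_unary k) (enc_list e ys) =
      enc_list e (replicate k x @ ys)" for ys
  proof (induction k arbitrary: ys)
    case (Suc k)
    from Suc.IH[of "x # ys"] show ?case by (simp add: replicate_app_Cons_same)
  qed simp
  from this[of "[]"] show ?thesis by (simp add: srepeat_def)
qed

lemma sdrop_enc_list: "sdrop (enc_unary k) (enc_list e xs) = enc_list e (drop k xs)"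
  unfolding sdrop_def
proof (induction k arbitrary: xs)
  case (Suc k)
  then show ?case by (cases xs) (use Suc.IH[of "[]"] in auto)
qed simp

lemma sdrop_enc_unary: "sdrop (enc_unary k) (enc_unary n) = enc_unary (n - k)"
  using sdrop_enc_list[of k "\<lambda>_. NIL" "replicate n ()"] by (simp add: enc_unary_list[symmetric])

lemma srange_enc_unary: "srange (enc_unary n) = enc_list enc_unary [0..<n]"
proof -
  let ?f = "\<lambda>z. CONS (CONS NIL (hd_sexp (tl_sexp (tl_sexp z))))
     (CONS (tl_sexp (sdrop (hd_sexp (tl_sexp (tl_sexp z))) (hd_sexp z))) (tl_sexp (tl_sexp (tl_sexp z))))"
  have tl: "tl_sexp (enc_unary m) = enc_unary (m - 1)" for m by (cases m) auto
  have "sfold ?f (enc_unary n) (enc_unary m) (CONS (enc_unary (n - m)) (enc_list enc_unary [m..<n])) =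
      CONS (enc_unary n) (enc_list enc_unary [0..<n])" if "m \<le> n" for m
    using that
  proof (induction m)
    case (Suc m)
    then have "n - m = Suc (n - Suc m)" "n - (n - Suc m) - 1 = m" by auto
    moreover from Suc.prems have "[m..<n] = m # [Suc m..<n]" by (simp add: upt_rec)
    ultimately show ?case using Suc by (simp add: sdrop_enc_unary tl)
  qed simp
  from this[of n] show ?thesis by (simp add: srange_def)
qed

section \<open>Comparison of unary and of binary numbers\<close>

definition sequal :: "sexp \<Rightarrow> sexp \<Rightarrow> sexp" where
  "sequal k m = (if sdrop k m = NIL then (if sdrop m k = NIL then CONS NIL NIL else NIL) else NIL)"

lemma poly_time_sequal [intro]:
  "poly_time k \<Longrightarrow> poly_time m \<Longrightarrow> poly_time (\<lambda>x. sequal (k x) (m x))"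
  unfolding sequal_def by (intro poly_time_intros poly_time_sdrop)

lemma enc_unary_eq_NIL: "enc_unary k = NIL \<longleftrightarrow> k = 0"
  by (cases k) auto

text \<open>On unary codes \<open>sdrop\<close> is truncated subtraction, and both differences
  vanish exactly for equal numbers.\<close>

lemma sequal_enc_unary: "sequal (enc_unary k) (enc_unary m) = NIL \<longleftrightarrow> k \<noteq> m"
  by (auto simp: sequal_def sdrop_enc_unary enc_unary_eq_NIL)

text \<open>Comparison of binary numbers, least significant bit first: the flag records the
  comparison of the bits read so far, and the most significant difference wins.\<close>

definition scompare_bit :: "sexp \<Rightarrow> sexp" where
  "scompare_bit z = CONS (tl_sexp (hd_sexp (tl_sexp (tl_sexp z))))
     (if hd_sexp (tl_sexp z) = NIL
      then if hd_sexp (hd_sexp (tl_sexp (tl_sexp z))) = NIL then tl_sexp (tl_sexp (tl_sexp z)) else CONS NIL NIL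
      else if hd_sexp (hd_sexp (tl_sexp (tl_sexp z))) = NIL then NIL else tl_sexp (tl_sexp (tl_sexp z)))"

text \<open>Bits left over from the second number make it the larger one, since the code of a number
  has no leading zeros. If the second number is the shorter one, its missing bits have been read as
  zeros, because \<open>hd_sexp NIL = NIL\<close>.\<close>

definition scompare_end :: "sexp \<Rightarrow> sexp" where
  "scompare_end r = (if hd_sexp r = NIL then tl_sexp r else CONS NIL NIL)"

definition sless_eq :: "sexp \<Rightarrow> sexp \<Rightarrow> sexp" where
  "sless_eq k m = scompare_end (sfold scompare_bit NIL k (CONS m (CONS NIL NIL)))"

lemma poly_time_sless_eq [intro]:
  assumes "poly_time k" "poly_time m"
  shows "poly_time (\<lambda>x. sless_eq (k x) (m x))"
  unfolding sless_eq_def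
proof (rule poly_time_comp[where f = scompare_end])
  show "poly_time scompare_end" unfolding scompare_end_def by (intro poly_time_intros)
  show "poly_time (\<lambda>x. sfold scompare_bit NIL (k x) (CONS (m x) (CONS NIL NIL)))"
  proof (rule poly_time_sfold[where q = "[:2:]"])
    show "poly_time scompare_bit" unfolding scompare_bit_def by (intro poly_time_intros)
    show "size (scompare_bit (CONS c (CONS h a))) \<le> size a + poly [:2:] (size c + size h)" for c h a
      using size_hd_tl_le[of a] size_tl_le[of "hd_sexp a"] by (simp add: scompare_bit_def)
  qed (intro poly_time_intros assms)+
qed

lemma enc_nat_0: "enc_nat 0 = NIL"
  by (simp add: enc_nat_def bits.simps[of 0])

lemma enc_nat_pos: "0 < n \<Longrightarrow> enc_nat n = CONS (enc_bool (odd n)) (enc_nat (n div 2))"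
  by (simp add: enc_nat_def bits.simps[of n])

lemma enc_nat_simps: "hd_sexp (enc_nat n) = enc_bool (odd n)" "tl_sexp (enc_nat n) = enc_nat (n div 2)"
  "enc_nat n = NIL \<longleftrightarrow> n = 0"
  by (cases "n = 0"; simp add: enc_nat_0 enc_nat_pos)+

lemma enc_bool_eq_NIL: "enc_bool b = NIL \<longleftrightarrow> \<not> b"
  by (cases b) auto

lemma sless_eq_enc_nat: "sless_eq (enc_nat k) (enc_nat m) = NIL \<longleftrightarrow> \<not> k \<le> m"
proof -
  \<comment> \<open>The induction needs an arbitrary flag \<open>b\<close>, which decides the case
    of equal remaining parts. The initial flag \<open>CONS NIL NIL\<close> lets equality count as
    less or equal.\<close>
  have "scompare_end (sfold scompare_bit NIL (enc_nat k) (CONS (enc_nat m) b)) = NIL \<longleftrightarrow> \<not> (k < m \<or> k = m \<and> b \<noteq> NIL)" for b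
  proof (induction k arbitrary: m b rule: less_induct)
    case (less k)
    show ?case
    proof (cases "k = 0")
      case True
      then show ?thesis by (simp add: enc_nat_0 enc_nat_simps scompare_end_def)
    next
      case False
      then have e: "enc_nat k = CONS (enc_bool (odd k)) (enc_nat (k div 2))"
        by (simp add: enc_nat_pos)
      define b' where "b' = (if even k then if even m then b else CONS NIL NIL else if even m then NIL else b)"
      have "sfold scompare_bit NIL (enc_nat k) (CONS (enc_nat m) b) =
          sfold scompare_bit NIL (enc_nat (k div 2)) (CONS (enc_nat (m div 2)) b')"
        by (simp add: e enc_nat_simps enc_bool_eq_NIL b'_def scompare_bit_def)
      also have "scompare_end \<dots> = NIL \<longleftrightarrow> \<not> (k div 2 < m div 2 \<or> k div 2 = m div 2 \<and> b' \<noteq> NIL)"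
        using False by (intro less.IH) simp
      also have "\<dots> \<longleftrightarrow> \<not> (k < m \<or> k = m \<and> b \<noteq> NIL)"
      proof -
        have b': "b' \<noteq> NIL \<longleftrightarrow> (if even k = even m then b \<noteq> NIL else odd m)" by (simp add: b'_def)
        have "k div 2 < m div 2 \<or> k div 2 = m div 2 \<and> (even k = even m \<or> odd m) \<longleftrightarrow> k \<le> m"
          "k div 2 < m div 2 \<or> k div 2 = m div 2 \<and> even k \<noteq> even m \<and> odd m \<longleftrightarrow> k < m"
          by presburger+
        then show ?thesis unfolding b' by (cases "b = NIL") auto
      qed
      finally show ?thesis .
    qed
  qed
  from this[of "CONS NIL NIL"] show ?thesis by (auto simp: sless_eq_def)
qed

definition sdouble :: "sexp \<Rightarrow> sexp" where "sdouble a = CONS NIL a"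

text \<open>The bits come least significant first, so a leading \<open>NIL\<close> doubles. For 0 it
  would leave the canonical encoding, hence the positivity assumption.\<close>

lemma sdouble_enc_nat: "0 < m \<Longrightarrow> (sdouble ^^ k) (enc_nat m) = enc_nat (2 ^ k * m)"
proof (induction k)
  case (Suc k)
  have "CONS NIL (enc_nat i) = enc_nat (2 * i)" if "0 < i" for i
    using that by (simp add: enc_nat_pos)
  with Suc show ?case by (simp add: sdouble_def mult.assoc)
qed simp

lemma poly_time_sdouble [intro]: "poly_time a \<Longrightarrow> poly_time (\<lambda>x. (sdouble ^^ k) (a x))"
  by (induction k) (auto simp: sdouble_def)

section \<open>Spending in markets of readers\<close>

text \<open>A reader \<open>(d, u, w)\<close> has source \<open>u\<close> with cap \<open>1 / d\<close> and target \<open>w\<close>; if \<open>u = w\<close>, it only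
  wants \<open>w\<close>.\<close>

type_synonym reader = "nat \<times> nat \<times> nat"

text \<open>Filling the cap \<open>1 / d\<close> of the source costs \<open>p u / d\<close>; this
  cost is cut off at the budget.\<close>

definition demand :: "(nat \<Rightarrow> real) \<Rightarrow> reader \<Rightarrow> real" where
  "demand p = (\<lambda>(d, u, w). if u = w then 0 else min 1 (p u / real d))"

definition ideal :: "(nat \<Rightarrow> real) \<Rightarrow> nat \<Rightarrow> reader \<Rightarrow> real" where
  "ideal p j = (\<lambda>(d, u, w). (if j = w then 1 - demand p (d, u, w) else 0) +
     (if j = u \<and> u \<noteq> w then demand p (d, u, w) else 0))"

definition concerns :: "nat \<Rightarrow> reader \<Rightarrow> bool" where
  "concerns j = (\<lambda>(d, u, w). j = u \<or> j = w)"

text \<open>The target is tested before the source, so that \<open>u = w\<close> gives a purely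
  linear buyer.\<close>

definition reader_utility :: "nat \<Rightarrow> reader \<Rightarrow> (nat \<Rightarrow> real) \<Rightarrow> real" where
  "reader_utility G = (\<lambda>(d, u, w) y. \<Sum>j<G. if j = w then y j else
     if j = u then 5000 * min (y j) (1 / real d) else 0)"

lemma reader_utility_eq:
  "u < G \<Longrightarrow> w < G \<Longrightarrow> reader_utility G (d, u, w) y =
     y w + (if u = w then 0 else 5000 * min (y u) (1 / real d))"
proof -
  assume "u < G" "w < G"
  have "reader_utility G (d, u, w) y = (\<Sum>j<G. (if j = w then y w else 0) +
     (if j = u then if u = w then 0 else 5000 * min (y u) (1 / real d) else 0))"
    unfolding reader_utility_def prod.case by (rule sum.cong) auto
  with \<open>u < G\<close> \<open>w < G\<close> show ?thesis by (simp add: sum.distrib)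
qed

text \<open>Here \<open>r\<close> is the utility bought by a unit of money spent on the capped good, relative to the
  other good, \<open>q\<close> is the exact optimal spending on it, \<open>q'\<close> the actual one, \<open>s\<close> the
  spending on the other good and \<open>W\<close> the wasted money.\<close>

lemma spending_near_optimal:
  fixes r q q' s W \<delta> e :: real
  assumes "0 \<le> \<delta>" "\<delta> \<le> 1" "0 \<le> r" "0 \<le> q'" "q' \<le> q" "q \<le> 1" "0 \<le> W"
    and b: "s + q' + W \<le> 1" and 1: "1 - \<delta> \<le> s + r * q'"
    and 2: "(1 - \<delta>) * (1 - q + r * q) \<le> s + r * q'" and e: "\<delta> * (1 + r * q) \<le> e"
  shows "W \<le> e" "1 - q - e \<le> s" "2 \<le> r \<Longrightarrow> q - e \<le> q'"
proof -
  have q: "0 \<le> q" using assms by simp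
  have 0: "0 \<le> \<delta> * (r * q)" "0 \<le> \<delta> * q" "\<delta> * q \<le> \<delta>" "r * q' \<le> r * q" "0 \<le> r * q'"
    using assms q by (simp_all add: mult_left_mono mult_left_le)
  have e': "\<delta> + \<delta> * (r * q) \<le> e" using e by (simp add: algebra_simps)
  have 2: "1 - q + r * q - \<delta> + \<delta> * q - \<delta> * (r * q) \<le> s + r * q'" using 2 by (simp add: algebra_simps)
  show "1 - q - e \<le> s" using 2 e' 0 by linarith
  \<comment> \<open>The loss \<open>(r - 1) * (q - q')\<close> from underusing the capped good and
    the waste fit into the error together.\<close>
  have c: "r * (q - q') - (q - q') + W \<le> e"
    using 2 b e' 0 by (simp add: algebra_simps)
  \<comment> \<open>For \<open>r < 1\<close> underusing the capped good is a gain and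
    \<open>c\<close> does not bound the waste; then the comparison with spending everything on the
    other good does.\<close>
  show "W \<le> e"
  proof (cases "r \<ge> 1")
    case True
    then have "(q - q') \<le> r * (q - q')" using assms by (simp add: mult_right_mono[of 1 r "q - q'", simplified])
    with c show ?thesis by linarith
  next
    case False
    then have "r * q' \<le> q'" using assms by (simp add: mult_left_le_one_le)
    with b 1 e' 0 show ?thesis by linarith
  qed
  show "q - e \<le> q'" if "2 \<le> r"
  proof -
    have "2 * (q - q') \<le> r * (q - q')" using that assms by (intro mult_right_mono) auto
    moreover have "z - (q - q') + W \<le> e \<Longrightarrow> 2 * (q - q') \<le> z \<Longrightarrow> q - e \<le> q'" for z
      using \<open>0 \<le> W\<close> by argo
    ultimately show ?thesis using c by blast
  qed
qed

section \<open>Near-optimal readers and the prices of their goods\<close>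

locale reader_equilibrium =
  fixes L :: "reader list" and G :: nat and p :: "nat \<Rightarrow> real"
    and x :: "nat \<Rightarrow> nat \<Rightarrow> real" and \<delta> :: real and K :: nat
  assumes readers: "\<And>d u w. (d, u, w) \<in> set L \<Longrightarrow> 0 < d \<and> u < G \<and> w < G"
    and filler: "\<And>j. j < G \<Longrightarrow> \<exists>d. (d, j, j) \<in> set L"
    and delta: "0 \<le> \<delta>" "\<delta> \<le> 1 / 10"
    and price_nonneg: "\<And>j. j < G \<Longrightarrow> 0 \<le> p j"
    and bundle_nonneg: "\<And>i j. i < length L \<Longrightarrow> j < G \<Longrightarrow> 0 \<le> x i j"
    and bundle_budget: "\<And>i. i < length L \<Longrightarrow> (\<Sum>j<G. p j * x i j) \<le> 1"
    and bundle_optimal: "\<And>i y. i < length L \<Longrightarrow> (\<And>j. j < G \<Longrightarrow> 0 \<le> y j) \<Longrightarrow>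
      (\<Sum>j<G. p j * y j) \<le> 1 \<Longrightarrow>
      (1 - \<delta>) * reader_utility G (L ! i) y \<le> reader_utility G (L ! i) (x i)"
    and clearing: "\<And>j. j < G \<Longrightarrow> \<bar>(\<Sum>i<length L. x i j) - 1\<bar> \<le> 1 / 9"
    and degree: "\<And>j. j < G \<Longrightarrow> card {i. i < length L \<and> concerns j (L ! i)} \<le> K"
begin

definition source where "source i = fst (snd (L ! i))"
definition target where "target i = snd (snd (L ! i))"
definition cap where "cap i = 1 / real (fst (L ! i))"
text \<open>Money that buys no utility: spent on goods that are neither source nor target, or on the
  source beyond its cap. The target is tested before the source, so a buyer with
  \<open>u = w\<close> wastes nothing on its good.\<close>

definition waste where "waste i j = (if j = target i then 0 else if j = source i then
  p j * (x i j - min (x i j) (cap i)) else p j * x i j)"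
definition spent where "spent i = p (target i) * x i (target i)"
definition read where "read i = (if source i = target i then 0 else p (source i) * min (x i (source i)) (cap i))"
text \<open>This is the error \<open>\<delta> * (1 + r * q)\<close> of
  \<open>spending_near_optimal\<close> with \<open>r * q\<close> replaced by the upper bound
  \<open>5000 * p (target i)\<close>, which is valid because caps are at most 1.\<close>

definition err where "err i = \<delta> * (1 + 5000 * p (target i))"
text \<open>Bounds how far the money spent on \<open>j\<close> can be from the ideal: the errors of
  the readers concerned, and the waste of all readers, including those that do not value
  \<open>j\<close>.\<close>

definition bad where
  "bad j = (\<Sum>i<length L. (if concerns j (L ! i) then err i else 0) + waste i j)"

lemma reader_eq: "L ! i = (fst (L ! i), source i, target i)"
  by (simp add: source_def target_def)

lemma concerns_iff: "concerns j (L ! i) \<longleftrightarrow> j = source i \<or> j = target i"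
  by (subst reader_eq) (simp add: concerns_def)

lemma ideal_eq: "ideal p j (L ! i) = (if j = target i then 1 - demand p (L ! i) else 0) +
     (if j = source i \<and> source i \<noteq> target i then demand p (L ! i) else 0)"
  by (subst (1 2 3) reader_eq) (simp add: ideal_def del: prod.collapse)

lemma reader_bounds:
  assumes "i < length L"
  shows "source i < G" "target i < G" "0 < cap i" "cap i \<le> 1"
proof -
  have "(fst (L ! i), source i, target i) \<in> set L"
    using nth_mem[OF assms] reader_eq[of i] by simp
  from readers[OF this] show "source i < G" "target i < G" "0 < cap i" "cap i \<le> 1"
    by (auto simp: cap_def)
qed

lemma sold_bounds:
  assumes "j < G"
  shows "8 / 9 \<le> (\<Sum>i<length L. x i j)" "(\<Sum>i<length L. x i j) \<le> 10 / 9"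
  using clearing[OF assms] by linarith+

text \<open>Below 4/5 the buyer that wants only \<open>j\<close> can afford 5/4 units. Being nearly
  optimal it takes at least 9/8 units, more than the 10/9 that are sold at most.\<close>

lemma price_lower:
  assumes "j < G"
  shows "4 / 5 \<le> p j"
proof (rule ccontr)
  assume "\<not> 4 / 5 \<le> p j"
  from filler[OF assms] obtain d where "(d, j, j) \<in> set L" by blast
  then obtain i where i: "i < length L" "L ! i = (d, j, j)" by (auto simp: in_set_conv_nth)
  let ?y = "\<lambda>k. if k = j then 5 / 4 else (0 :: real)"
  have "(\<Sum>k<G. p k * ?y k) = (\<Sum>k<G. if k = j then p j * (5 / 4) else 0)"
    by (rule sum.cong) auto
  then have "(\<Sum>k<G. p k * ?y k) = p j * (5 / 4)" using assms by simp
  with \<open>\<not> 4 / 5 \<le> p j\<close> have "(1 - \<delta>) * reader_utility G (L ! i) ?y \<le> reader_utility G (L ! i) (x i)"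
    by (intro bundle_optimal[OF i(1)]) auto
  with assms have "(1 - \<delta>) * (5 / 4) \<le> x i j"
    by (simp add: i reader_utility_eq)
  also have "x i j \<le> (\<Sum>i<length L. x i j)"
    using i bundle_nonneg assms by (intro member_le_sum) auto
  also have "\<dots> \<le> 10 / 9" by (rule sold_bounds[OF assms])
  finally show False using delta by simp
qed

lemma payment_split:
  "p j * x i j = (if j = target i then spent i else 0) + (if j = source i \<and> source i \<noteq> target i then read i else 0) + waste i j"
  by (auto simp: spent_def read_def waste_def algebra_simps)

lemma waste_nonneg: "i < length L \<Longrightarrow> j < G \<Longrightarrow> 0 \<le> waste i j"
  unfolding waste_def using price_nonneg bundle_nonneg by auto

lemma reader_spending:
  assumes i: "i < length L"
  shows "spent i + read i + (\<Sum>j<G. waste i j) \<le> 1"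
proof -
  have "(\<Sum>j<G. p j * x i j) = spent i + read i + (\<Sum>j<G. waste i j)"
    using reader_bounds[OF i]
    by (subst payment_split) (simp add: sum.distrib read_def)
  with bundle_budget[OF i] show ?thesis by simp
qed

lemma demand_eq: "demand p (L ! i) = (if source i = target i then 0 else min 1 (cap i * p (source i)))"
  by (subst reader_eq) (simp add: demand_def cap_def)

lemma utility_eq: "i < length L \<Longrightarrow> reader_utility G (L ! i) y =
     y (target i) + (if source i = target i then 0 else 5000 * min (y (source i)) (cap i))"
  using reader_bounds[of i] by (subst reader_eq) (simp add: reader_utility_eq cap_def)

text \<open>Multiplied by the price of the target, the utility of the bundle becomes
  \<open>spent i + r * read i\<close>, where \<open>r\<close> is the relative value of the source.
  Comparing with two bundles, all money on the target (\<open>?y1\<close>) and the cap filled before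
  the target (\<open>?y2\<close>), gives the hypotheses of
  \<open>spending_near_optimal\<close>.\<close>

lemma reader_facts:
  assumes i: "i < length L"
  shows "0 \<le> read i" "read i \<le> demand p (L ! i)" "demand p (L ! i) \<le> 1"
    "(\<Sum>j<G. waste i j) \<le> err i" "1 - demand p (L ! i) - err i \<le> spent i"
    "p (source i) \<le> 2000 \<Longrightarrow> demand p (L ! i) - err i \<le> read i" "0 \<le> spent i" "0 \<le> err i"
proof -
  note rb = reader_bounds[OF i]
  have pos: "0 < p (source i)" "0 < p (target i)" using price_lower rb by fastforce+
  have xn: "0 \<le> x i (source i)" "0 \<le> x i (target i)" using bundle_nonneg i rb by auto
  define q where "q = demand p (L ! i)"
  define r where "r = 5000 * p (target i) / p (source i)"
  have W: "0 \<le> (\<Sum>j<G. waste i j)" using waste_nonneg i by (intro sum_nonneg) auto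
  show s: "0 \<le> spent i" using xn pos by (simp add: spent_def)
  show q': "0 \<le> read i" using xn pos rb by (simp add: read_def)
  show q1: "demand p (L ! i) \<le> 1" by (simp add: demand_eq)
  have q0: "0 \<le> q" using rb pos by (simp add: q_def demand_eq)
  have b: "spent i + read i + (\<Sum>j<G. waste i j) \<le> 1" by (rule reader_spending[OF i])
  show q'q: "read i \<le> demand p (L ! i)"
  proof (cases "source i = target i")
    case False
    have "p (source i) * min (x i (source i)) (cap i) \<le> p (source i) * cap i"
      using pos by (intro mult_left_mono) auto
    with False b s W show ?thesis by (auto simp: read_def demand_eq mult.commute)
  qed (simp add: read_def demand_eq)
  have r0: "0 \<le> r" using pos by (simp add: r_def)
  have V: "p (target i) * reader_utility G (L ! i) (x i) = spent i + r * read i"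
    unfolding utility_eq[OF i] using pos
    by (auto simp: spent_def read_def r_def algebra_simps)
  let ?y1 = "\<lambda>k. if k = target i then 1 / p (target i) else (0 :: real)"
  have "(\<Sum>k<G. p k * ?y1 k) = (\<Sum>k<G. if k = target i then 1 else 0)"
    using pos by (intro sum.cong) auto
  then have "(1 - \<delta>) * reader_utility G (L ! i) ?y1 \<le> reader_utility G (L ! i) (x i)"
    using pos rb by (intro bundle_optimal[OF i]) auto
  moreover have "1 / p (target i) \<le> reader_utility G (L ! i) ?y1"
    using rb by (simp add: utility_eq[OF i])
  ultimately have "(1 - \<delta>) * (1 / p (target i)) \<le> reader_utility G (L ! i) (x i)"
    using delta by (meson diff_ge_0_iff_ge mult_left_mono order_trans one_le_numeral divide_le_eq_1_pos zero_less_numeral)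
  then have 1: "1 - \<delta> \<le> spent i + r * read i"
    unfolding V[symmetric] using pos by (simp add: field_simps)
  let ?y2 = "\<lambda>k. if k = target i then (1 - q) / p (target i) else if k = source i then q / p (source i) else (0 :: real)"
  have 2: "(1 - \<delta>) * (1 - q + r * q) \<le> spent i + r * read i"
  proof (cases "source i = target i")
    case True
    then have "q = 0" by (simp add: q_def demand_eq)
    with 1 show ?thesis by simp
  next
    case False
    have "(\<Sum>k<G. p k * ?y2 k) = (\<Sum>k<G. (if k = target i then 1 - q else 0) + (if k = source i then q else 0))"
      using pos False by (intro sum.cong) auto
    also have "\<dots> = 1" using rb by (simp add: sum.distrib)
    finally have "(1 - \<delta>) * reader_utility G (L ! i) ?y2 \<le> reader_utility G (L ! i) (x i)"
      using pos q0 q1 by (intro bundle_optimal[OF i]) (auto simp: q_def)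
    moreover have "reader_utility G (L ! i) ?y2 = (1 - q) / p (target i) + 5000 * (q / p (source i))"
    proof -
      have "q / p (source i) \<le> cap i" using False pos by (simp add: q_def demand_eq field_simps min_def)
      with False show ?thesis by (simp add: utility_eq[OF i] min_absorb1)
    qed
    ultimately have "p (target i) * ((1 - \<delta>) * ((1 - q) / p (target i) + 5000 * (q / p (source i))))
        \<le> spent i + r * read i"
      unfolding V[symmetric] using pos by (intro mult_left_mono) auto
    also have "p (target i) * ((1 - \<delta>) * ((1 - q) / p (target i) + 5000 * (q / p (source i)))) =
        (1 - \<delta>) * (1 - q + r * q)"
      using pos by (simp add: r_def field_simps)
    finally show ?thesis .
  qed
  have "r * q \<le> 5000 * p (target i)"
  proof -
    have "q \<le> p (source i)"
      using rb pos by (auto simp: q_def demand_eq min_le_iff_disj mult_left_le_one_le)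
    then have "r * q \<le> r * p (source i)" using r0 by (rule mult_left_mono)
    also have "\<dots> = 5000 * p (target i)" using pos by (simp add: r_def)
    finally show ?thesis .
  qed
  then have e: "\<delta> * (1 + r * q) \<le> err i"
    unfolding err_def using delta by (intro mult_left_mono) auto
  show "0 \<le> err i" using delta pos by (simp add: err_def)
  have d: "\<delta> \<le> 1" using delta by simp
  note near = spending_near_optimal[OF delta(1) d r0 q' q'q[folded q_def] q1[folded q_def] W b 1 2 e]
  show "(\<Sum>j<G. waste i j) \<le> err i" "1 - demand p (L ! i) - err i \<le> spent i"
    using near by (simp_all add: q_def)
  assume "p (source i) \<le> 2000"
  \<comment> \<open>The target costs at least 4/5, so \<open>r\<close> is at least
    \<open>5000 * (4 / 5) / 2000 = 2\<close>.\<close>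
  with price_lower[OF rb(2)] pos have "2 \<le> r" by (simp add: r_def field_simps)
  with near show "demand p (L ! i) - err i \<le> read i" by (simp add: q_def)
qed

section \<open>Money balance of a single good\<close>

lemma money: "p j * (\<Sum>i<length L. x i j) = (\<Sum>i<length L. p j * x i j)"
  by (simp add: sum_distrib_left)

text \<open>Between 8/9 and 10/9 units are sold, which ties the price to the money spent. The bound
  on \<open>p j\<close> ensures that the readers with source \<open>j\<close> almost fill their
  caps.\<close>

lemma money_lower:
  assumes "j < G" "p j \<le> 2000"
  shows "(\<Sum>i<length L. ideal p j (L ! i)) - bad j \<le> 10 / 9 * p j"
proof -
  have "(\<Sum>i<length L. ideal p j (L ! i)) - bad j =
     (\<Sum>i<length L. ideal p j (L ! i) - ((if concerns j (L ! i) then err i else 0) + waste i j))"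
    by (simp add: bad_def sum_subtractf)
  also have "\<dots> \<le> (\<Sum>i<length L. p j * x i j)"
  proof (rule sum_mono)
    fix i assume "i \<in> {..<length L}"
    then have i: "i < length L" by simp
    show "ideal p j (L ! i) - ((if concerns j (L ! i) then err i else 0) + waste i j) \<le> p j * x i j"
      using reader_facts[OF i] waste_nonneg[OF i assms(1)] assms(2)
      by (subst payment_split) (auto simp: ideal_eq concerns_iff read_def)
  qed
  also have "\<dots> \<le> p j * (10 / 9)"
    unfolding money[symmetric] using sold_bounds[OF assms(1)] price_nonneg[OF assms(1)]
    by (intro mult_left_mono) auto
  finally show ?thesis by simp
qed

text \<open>A reader never reads more than its demand, but one that reads too little can overspend
  on its target. Hence the price bounds concern the sources of the readers with target
  \<open>j\<close> and not \<open>j\<close> itself.\<close>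

lemma money_upper:
  assumes "j < G" "\<And>d v. (d, v, j) \<in> set L \<Longrightarrow> v \<noteq> j \<Longrightarrow> p v \<le> 2000"
  shows "8 / 9 * p j \<le> (\<Sum>i<length L. ideal p j (L ! i)) + bad j"
proof -
  have "8 / 9 * p j = p j * (8 / 9)" by simp
  also have "\<dots> \<le> (\<Sum>i<length L. p j * x i j)"
    unfolding money[symmetric] using sold_bounds[OF assms(1)] price_nonneg[OF assms(1)]
    by (intro mult_left_mono) auto
  also have "\<dots> \<le> (\<Sum>i<length L. ideal p j (L ! i) + ((if concerns j (L ! i) then err i else 0) + waste i j))"
  proof (rule sum_mono)
    fix i assume "i \<in> {..<length L}"
    then have i: "i < length L" by simp
    have "spent i \<le> 1 - demand p (L ! i) + err i" if "j = target i"
    proof (cases "source i = target i")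
      case False
      have "(fst (L ! i), source i, j) \<in> set L" using nth_mem[OF i] reader_eq[of i] that by simp
      from assms(2)[OF this] that False have "p (source i) \<le> 2000" by simp
      then show ?thesis
        using reader_facts[OF i] reader_spending[OF i]
          sum_nonneg[of "{..<G}" "waste i"] waste_nonneg[OF i] by fastforce
    next
      case True
      then show ?thesis
        using reader_facts[OF i] reader_spending[OF i]
          sum_nonneg[of "{..<G}" "waste i"] waste_nonneg[OF i] by (fastforce simp: demand_eq)
    qed
    then show "p j * x i j \<le> ideal p j (L ! i) + ((if concerns j (L ! i) then err i else 0) + waste i j)"
      using reader_facts[OF i]
      by (subst payment_split) (auto simp: ideal_eq concerns_iff read_def)
  qed
  also have "\<dots> = (\<Sum>i<length L. ideal p j (L ! i)) + bad j"
    by (simp add: bad_def sum.distrib)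
  finally show ?thesis .
qed

text \<open>At most \<open>K\<close> readers value \<open>j\<close>, each with one unit of money;
  what the others pay for \<open>j\<close> is waste.\<close>

lemma price_upper:
  assumes "j < G"
  shows "p j \<le> 9 / 8 * (real K + bad j)"
proof -
  have "p j * (8 / 9) \<le> (\<Sum>i<length L. p j * x i j)"
    unfolding money[symmetric] using sold_bounds[OF assms(1)] price_nonneg[OF assms(1)]
    by (intro mult_left_mono) auto
  also have "\<dots> \<le> (\<Sum>i<length L. (if concerns j (L ! i) then 1 else 0) +
      ((if concerns j (L ! i) then err i else 0) + waste i j))"
  proof (rule sum_mono)
    fix i assume "i \<in> {..<length L}"
    then have i: "i < length L" by simp
    have "spent i \<le> 1" "read i \<le> 1"
      using reader_facts[OF i] reader_spending[OF i]
          sum_nonneg[of "{..<G}" "waste i"] waste_nonneg[OF i] by fastforce+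
    then show "p j * x i j \<le> (if concerns j (L ! i) then 1 else 0) +
      ((if concerns j (L ! i) then err i else 0) + waste i j)"
      using reader_facts(8)[OF i]
      by (subst payment_split) (auto simp: concerns_iff)
  qed
  also have "\<dots> = real (card {i. i < length L \<and> concerns j (L ! i)}) + bad j"
    by (simp add: bad_def sum.distrib sum.If_cases Int_def)
  also have "\<dots> \<le> real K + bad j" using degree[OF assms] by simp
  finally show ?thesis by simp
qed

lemma bad_nonneg: "j < G \<Longrightarrow> 0 \<le> bad j"
  unfolding bad_def using reader_facts(8) waste_nonneg by (intro sum_nonneg add_nonneg_nonneg) auto

section \<open>Deviations summed over all goods\<close>

lemma total_price: "(\<Sum>j<G. p j) \<le> 9 / 8 * real (length L)"
proof -
  have "8 / 9 * (\<Sum>j<G. p j) = (\<Sum>j<G. p j * (8 / 9))"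
    by (subst sum_distrib_right[symmetric]) simp
  also have "\<dots> \<le> (\<Sum>j<G. p j * (\<Sum>i<length L. x i j))"
    using sold_bounds price_nonneg by (intro sum_mono mult_left_mono) auto
  also have "\<dots> = (\<Sum>i<length L. \<Sum>j<G. p j * x i j)"
    unfolding money by (rule sum.swap)
  also have "\<dots> \<le> (\<Sum>i<length L. 1)" using bundle_budget by (intro sum_mono) auto
  finally show ?thesis by simp
qed

text \<open>A single target price has no useful bound here, but every good is a target at most
  \<open>K\<close> times and the sum of all prices is bounded by the total budget. The constant is
  \<open>5625 = 5000 * 9 / 8\<close>.\<close>

lemma total_err: "(\<Sum>i<length L. err i) \<le> \<delta> * real (length L) * (1 + 5625 * real K)"
proof -
  have "(\<Sum>i<length L. p (target i)) = (\<Sum>i<length L. \<Sum>j<G. if j = target i then p j else 0)"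
    using reader_bounds by (intro sum.cong) auto
  also have "\<dots> = (\<Sum>j<G. \<Sum>i<length L. if j = target i then p j else 0)" by (rule sum.swap)
  also have "\<dots> \<le> (\<Sum>j<G. real K * p j)"
  proof (rule sum_mono)
    fix j assume "j \<in> {..<G}"
    then have j: "j < G" by simp
    have "(\<Sum>i<length L. if P i then c else 0) = real (card {i. i < length L \<and> P i}) * c"
      for P and c :: real by (simp add: sum.If_cases Int_def)
    then have "(\<Sum>i<length L. if j = target i then p j else 0) = real (card {i. i < length L \<and> j = target i}) * p j" .
    also have "\<dots> \<le> real (card {i. i < length L \<and> concerns j (L ! i)}) * p j"
      using price_nonneg[OF j]
      by (intro mult_right_mono of_nat_mono card_mono) (auto simp: concerns_iff)
    also have "\<dots> \<le> real K * p j"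
      using price_nonneg[OF j] degree[OF j] by (intro mult_right_mono) auto
    finally show "(\<Sum>i<length L. if j = target i then p j else 0) \<le> real K * p j" .
  qed
  also have "\<dots> = real K * (\<Sum>j<G. p j)" by (simp add: sum_distrib_left)
  also have "\<dots> \<le> real K * (9 / 8 * real (length L))"
    using total_price by (intro mult_left_mono) auto
  finally have "real (length L) + 5000 * (\<Sum>i<length L. p (target i)) \<le>
      real (length L) * (1 + 5625 * real K)" by (simp add: algebra_simps)
  moreover have "(\<Sum>i<length L. err i) = \<delta> * (real (length L) + 5000 * (\<Sum>i<length L. p (target i)))"
    by (simp add: err_def sum_distrib_left[symmetric] sum.distrib)
  ultimately show ?thesis using delta by (simp add: mult_left_mono mult.assoc)
qed

text \<open>The error of a reader enters at most three times: at its source, at its target, and as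
  the bound on its total waste.\<close>

lemma total_bad: "(\<Sum>j<G. bad j) \<le> 3 * \<delta> * real (length L) * (1 + 5625 * real K)"
proof -
  have "(\<Sum>j<G. bad j) = (\<Sum>i<length L. \<Sum>j<G. (if concerns j (L ! i) then err i else 0) + waste i j)"
    unfolding bad_def by (rule sum.swap)
  also have "\<dots> \<le> (\<Sum>i<length L. 3 * err i)"
  proof (rule sum_mono)
    fix i assume "i \<in> {..<length L}"
    then have i: "i < length L" by simp
    have "(\<Sum>j<G. if concerns j (L ! i) then err i else 0) \<le>
        (\<Sum>j<G. (if j = source i then err i else 0) + (if j = target i then err i else 0))"
      using reader_facts(8)[OF i] by (intro sum_mono) (auto simp: concerns_iff)
    also have "\<dots> = 2 * err i" using reader_bounds[OF i] by (simp add: sum.distrib)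
    finally show "(\<Sum>j<G. (if concerns j (L ! i) then err i else 0) + waste i j) \<le> 3 * err i"
      using reader_facts(4)[OF i] by (simp add: sum.distrib)
  qed
  also have "\<dots> = 3 * (\<Sum>i<length L. err i)" by (simp add: sum_distrib_left)
  finally show ?thesis using total_err by linarith
qed

end

section \<open>Gates as groups of readers\<close>

text \<open>
  The goods are the nodes, an auxiliary good \<open>n + v\<close> for every node \<open>v\<close> and a dummy good
  \<open>2 * n\<close>, without which the empty circuit would give a market without buyers. A node is
  \<open>Zero\<close> if its price is at most 32 and \<open>One\<close> if it is at least 512. The readers of a good can
  consume at most 5/6 of it (as in 350/420 and 94/342 + 282/512), and 8/9 is on sale; the
  single unit of money spent on a switched off good then buys at least 1/18, so that 32 leaves
  some slack.
\<close>

fun gate_readers :: "nat \<Rightarrow> gate \<Rightarrow> reader list" where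
  "gate_readers n (NAND u v w) = replicate 350 (420, u, w) @ replicate 350 (420, v, w)"
| "gate_readers n (PURIFY u v w) = replicate 94 (342, u, n + v) @ replicate 282 (512, u, n + w) @
     replicate 250 (300, n + v, v) @ replicate 250 (300, n + w, w)"

fun gate_goods :: "nat \<Rightarrow> gate \<Rightarrow> nat set" where
  "gate_goods n (NAND u v w) = {u, v, w}"
| "gate_goods n (PURIFY u v w) = {u, v, w, n + v, n + w}"

definition circuit_readers :: "pure_circuit \<Rightarrow> reader list" where
  "circuit_readers = (\<lambda>(n, C). map (\<lambda>j. (1, j, j)) [0..<2 * n + 1] @ concat (map (gate_readers n) C))"

lemma gate_readers_goods:
  "(d, u, w) \<in> set (gate_readers n g) \<Longrightarrow> 0 < d \<and> u \<in> gate_goods n g \<and> w \<in> gate_goods n g"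
  by (cases g) auto

lemma length_gate_readers: "length (gate_readers n g) \<le> 876"
  by (cases g) auto

section \<open>Counting the gates and readers of a good\<close>

lemma sum_list_map_concat:
  fixes h :: "'a \<Rightarrow> 'b :: comm_monoid_add"
  shows "sum_list (map h (concat xs)) = sum_list (map (\<lambda>ys. sum_list (map h ys)) xs)"
  by (induction xs) auto

lemma sum_circuit_readers:
  fixes h :: "reader \<Rightarrow> 'a :: comm_monoid_add"
  shows "(\<Sum>i<length (circuit_readers (n, C)). h (circuit_readers (n, C) ! i)) =
    (\<Sum>j<2 * n + 1. h (1, j, j)) + (\<Sum>k<length C. sum_list (map h (gate_readers n (C ! k))))"
proof -
  have eq: "sum_list (map f xs) = (\<Sum>i<length xs. f (xs ! i))" for f :: "'b \<Rightarrow> 'a" and xs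
    by (simp add: sum_list_sum_nth atLeast0LessThan)
  have "(\<Sum>i<length (circuit_readers (n, C)). h (circuit_readers (n, C) ! i)) =
      sum_list (map h (circuit_readers (n, C)))" by (simp only: eq)
  also have "\<dots> = sum_list (map (\<lambda>j. h (1, j, j)) [0..<2 * n + 1]) +
      sum_list (map (\<lambda>g. sum_list (map h (gate_readers n g))) C)"
    unfolding circuit_readers_def prod.case map_append sum_list_append sum_list_map_concat map_map comp_def ..
  also have "sum_list (map (\<lambda>j. h (1, j, j)) [0..<2 * n + 1]) = (\<Sum>j<2 * n + 1. h (1, j, j))"
    by (simp only: sum_list_distinct_conv_sum_set[OF distinct_upt] set_upt atLeast0LessThan)
  also have "sum_list (map (\<lambda>g. sum_list (map h (gate_readers n g))) C) =
      (\<Sum>k<length C. sum_list (map h (gate_readers n (C ! k))))" by (rule eq)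
  finally show ?thesis .
qed

lemma gate_goods_bound:
  assumes "valid_pure_circuit (n, C)" "g \<in> set C" "j \<in> gate_goods n g"
  shows "j < 2 * n"
  using assms by (cases g) (fastforce simp: valid_pure_circuit_def)+

lemma valid_node:
  assumes "valid_pure_circuit (n, C)" "single_input_use (n, C)" "v < n"
  obtains k1 k2 where "k1 < length C" "k2 < length C" "k1 \<noteq> k2"
    "v \<in> gate_outputs (C ! k1)" "v \<in> gate_inputs (C ! k2)"
    "\<forall>k<length C. v \<in> gate_outputs (C ! k) \<longrightarrow> k = k1"
    "\<forall>k<length C. v \<in> gate_inputs (C ! k) \<longrightarrow> k = k2"
proof -
  obtain k1 where k1: "k1 < length C" "v \<in> gate_outputs (C ! k1)"
    "\<forall>k<length C. v \<in> gate_outputs (C ! k) \<longrightarrow> k = k1"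
  proof -
    have "\<exists>!k. k < length C \<and> v \<in> gate_outputs (C ! k)"
      using assms(1,3) unfolding valid_pure_circuit_def by simp
    then show thesis by (elim ex1E) (rule that; blast)
  qed
  obtain k2 where k2: "k2 < length C" "v \<in> gate_inputs (C ! k2)"
    "\<forall>k<length C. v \<in> gate_inputs (C ! k) \<longrightarrow> k = k2"
  proof -
    have "\<exists>!k. k < length C \<and> v \<in> gate_inputs (C ! k)"
      using assms(2,3) unfolding single_input_use_def by simp
    then show thesis by (elim ex1E) (rule that; blast)
  qed
  have "distinct (gate_nodes (C ! k1))"
    using assms(1) nth_mem[OF k1(1)] unfolding valid_pure_circuit_def prod.case by blast
  then have "k1 \<noteq> k2" using k1(2) k2(2) by (cases "C ! k1") auto
  with k1 k2 show ?thesis by (intro that)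
qed

lemma gate_goods_node:
  assumes "valid_pure_circuit (n, C)" "k < length C" "j \<in> gate_goods n (C ! k)"
  shows "if j < n then j \<in> gate_inputs (C ! k) \<or> j \<in> gate_outputs (C ! k)
    else j - n \<in> gate_outputs (C ! k)"
proof -
  have "set (gate_nodes (C ! k)) \<subseteq> {..<n}"
    using assms(1) nth_mem[OF assms(2)] unfolding valid_pure_circuit_def prod.case by blast
  with assms(3) show ?thesis by (cases "C ! k") auto
qed

text \<open>A node belongs to the gate that outputs it and to the gate that reads it, an auxiliary
  good \<open>n + v\<close> at most to the gate that outputs \<open>v\<close>, and the dummy good to
  no gate.\<close>

lemma card_gates_of_good:
  assumes "valid_pure_circuit (n, C)" "single_input_use (n, C)" "j < 2 * n + 1"
  shows "card {k. k < length C \<and> j \<in> gate_goods n (C ! k)} \<le> 2"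
proof (cases "j = 2 * n")
  case True
  then have "{k. k < length C \<and> j \<in> gate_goods n (C ! k)} = {}"
    using gate_goods_bound[OF assms(1)] by force
  then show ?thesis by (simp only: card.empty zero_le)
next
  case False
  define v where "v = (if j < n then j else j - n)"
  have "v < n" using False assms(3) by (auto simp: v_def)
  from valid_node[OF assms(1,2) this] obtain k1 k2 where k: "k1 < length C" "k2 < length C" "k1 \<noteq> k2"
    "v \<in> gate_outputs (C ! k1)" "v \<in> gate_inputs (C ! k2)"
    "\<forall>k<length C. v \<in> gate_outputs (C ! k) \<longrightarrow> k = k1"
    "\<forall>k<length C. v \<in> gate_inputs (C ! k) \<longrightarrow> k = k2" .
  from k(6,7) have "{k. k < length C \<and> j \<in> gate_goods n (C ! k)} \<subseteq> {k1, k2}"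
    using gate_goods_node[OF assms(1), of _ j] unfolding v_def by (auto split: if_splits)
  then have "card {k. k < length C \<and> j \<in> gate_goods n (C ! k)} \<le> card {k1, k2}"
    by (intro card_mono) auto
  also have "\<dots> \<le> 2" by (simp add: card_insert_if)
  finally show ?thesis .
qed

lemma circuit_readers_bounds:
  assumes "valid_pure_circuit (n, C)" "(d, u, w) \<in> set (circuit_readers (n, C))"
  shows "0 < d \<and> u < 2 * n + 1 \<and> w < 2 * n + 1"
proof -
  have "(d = 1 \<and> u = w \<and> w < 2 * n + 1) \<or> (\<exists>g\<in>set C. (d, u, w) \<in> set (gate_readers n g))"
    using assms(2) unfolding circuit_readers_def by auto
  then show ?thesis
    using gate_readers_goods gate_goods_bound[OF assms(1)] by fastforce
qed

text \<open>\<open>1753 = 1 + 2 * 876\<close>: the buyer that wants only \<open>j\<close>, and at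
  most \<open>94 + 282 + 250 + 250 = 876\<close> readers from each of at most two gates.\<close>

lemma circuit_degree:
  assumes "valid_pure_circuit (n, C)" "single_input_use (n, C)" "j < 2 * n + 1"
  shows "card {i. i < length (circuit_readers (n, C)) \<and> concerns j (circuit_readers (n, C) ! i)} \<le> 1753"
proof -
  let ?h = "\<lambda>r. if concerns j r then 1 else 0 :: nat"
  let ?L = "circuit_readers (n, C)"
  have "card {i. i < length ?L \<and> concerns j (?L ! i)} = (\<Sum>i<length ?L. ?h (?L ! i))"
    by (simp add: sum.If_cases Int_def)
  also have "\<dots> = (\<Sum>i<2 * n + 1. ?h (1, i, i)) + (\<Sum>k<length C. sum_list (map ?h (gate_readers n (C ! k))))"
    by (rule sum_circuit_readers)
  also have "(\<Sum>i<2 * n + 1. ?h (1, i, i)) = 1"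
    using assms(3) by (simp add: concerns_def)
  also have "(\<Sum>k<length C. sum_list (map ?h (gate_readers n (C ! k)))) \<le>
      (\<Sum>k<length C. if j \<in> gate_goods n (C ! k) then 876 else 0)"
  proof (rule sum_mono)
    fix k
    show "sum_list (map ?h (gate_readers n (C ! k))) \<le> (if j \<in> gate_goods n (C ! k) then 876 else 0)"
    proof (cases "j \<in> gate_goods n (C ! k)")
      case True
      have "sum_list (map ?h rs) \<le> length rs" for rs by (induction rs) auto
      with True length_gate_readers[of n "C ! k"] show ?thesis by (auto intro: order_trans)
    next
      case False
      then have "\<forall>r \<in> set (gate_readers n (C ! k)). ?h r = 0"
        using gate_readers_goods by (fastforce simp: concerns_def)
      with False show ?thesis by (simp add: sum_list_nonneg_eq_0_iff)
    qed
  qed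
  also have "\<dots> = 876 * card {k. k < length C \<and> j \<in> gate_goods n (C ! k)}"
    by (simp add: sum.If_cases Int_def)
  also have "\<dots> \<le> 876 * 2" using card_gates_of_good[OF assms] by simp
  finally show ?thesis by simp
qed

lemma nodes_le_gates:
  assumes "valid_pure_circuit (n, C)"
  shows "n \<le> 2 * length C"
proof -
  have "{..<n} \<subseteq> (\<Union>k<length C. gate_outputs (C ! k))"
    using assms unfolding valid_pure_circuit_def by fastforce
  moreover have fin: "finite (gate_outputs g)" and two: "card (gate_outputs g) \<le> 2" for g
    by (cases g; simp add: card_insert_if)+
  ultimately have "card {..<n} \<le> card (\<Union>k<length C. gate_outputs (C ! k))"
    by (intro card_mono) auto
  also have "\<dots> \<le> (\<Sum>k<length C. card (gate_outputs (C ! k)))" by (intro card_UN_le) auto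
  also have "\<dots> \<le> (\<Sum>k<length C. 2)" using two by (intro sum_mono) auto
  finally show ?thesis by simp
qed

text \<open>To the 876 readers per gate come \<open>2 * n + 1\<close> buyers of a single good, at
  most \<open>4 * length C + 1\<close> and hence at most \<open>5 * length C\<close> for a nonempty
  circuit.\<close>

lemma length_circuit_readers:
  assumes "valid_pure_circuit (n, C)" "C \<noteq> []"
  shows "length (circuit_readers (n, C)) \<le> 881 * length C"
proof -
  have "length (concat (map (gate_readers n) C)) \<le> 876 * length C"
    by (induction C) (use length_gate_readers in \<open>auto intro: add_mono\<close>)
  moreover have "1 \<le> length C" using assms(2) by (cases C) auto
  ultimately show ?thesis
    using nodes_le_gates[OF assms(1)] by (simp add: circuit_readers_def)
qed

text \<open>The spending of the readers of a node good, as a function of its price.\<close>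

definition reading :: "real \<Rightarrow> real \<Rightarrow> bool" where
  "reading P R \<longleftrightarrow> R = 350 * min 1 (P / 420) \<or> R = 94 * min 1 (P / 342) + 282 * min 1 (P / 512)"

text \<open>\<open>T\<close> is the income of the node without its own readers. The difference
  \<open>10 / 9 * P - R\<close> increases with \<open>P\<close> and is still below 219 at
  \<open>P = 512\<close>.\<close>

lemma node_price_high:
  assumes "reading P R" "T + R - 1 / 10 \<le> 10 / 9 * P" "222 \<le> T"
  shows "512 \<le> P"
proof (rule ccontr)
  assume "\<not> 512 \<le> P"
  with assms show False unfolding reading_def by (auto simp: min_def split: if_splits)
qed

lemma node_price_low:
  assumes "reading P R" "8 / 9 * P \<le> T + R + 1 / 10" "T \<le> 3 / 2" "0 \<le> P"
  shows "P \<le> 32"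
proof -
  \<comment> \<open>The readers fall short of \<open>8 / 9 * P\<close> by at least
    \<open>P / 18\<close>, so \<open>P\<close> is at most
    \<open>18 * (3 / 2 + 1 / 10) = 28.8\<close>.\<close>
  have "R \<le> 5 / 6 * P" using assms(1,4) unfolding reading_def by (auto simp: min_def split: if_splits)
  with assms show ?thesis by linarith
qed

definition decode :: "real \<Rightarrow> pval" where
  "decode P = (if P \<le> 32 then Zero else if 512 \<le> P then One else Bot)"

lemma decode_simps [simp]:
  "decode P = Zero \<longleftrightarrow> P \<le> 32" "decode P = One \<longleftrightarrow> 512 \<le> P"
  "Zero = decode P \<longleftrightarrow> P \<le> 32" "One = decode P \<longleftrightarrow> 512 \<le> P"
  by (auto simp: decode_def)

section \<open>Money flowing through the goods of a circuit\<close>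

locale circuit_equilibrium = reader_equilibrium "circuit_readers (n, C)" "2 * n + 1" p x \<delta> 1753
  for n C p x \<delta> +
  assumes valid: "valid_pure_circuit (n, C)" and single: "single_input_use (n, C)"
begin

abbreviation "income j \<equiv> \<Sum>i<length (circuit_readers (n, C)). ideal p j (circuit_readers (n, C) ! i)"

text \<open>What the readers of gate \<open>k\<close> ideally spend on \<open>j\<close>, whether
  \<open>j\<close> is their source or their target.\<close>

definition flow where "flow k j = sum_list (map (ideal p j) (gate_readers n (C ! k)))"

lemma flow_eq_0: "j \<notin> gate_goods n (C ! k) \<Longrightarrow> flow k j = 0"
proof -
  assume "j \<notin> gate_goods n (C ! k)"
  then have "map (ideal p j) (gate_readers n (C ! k)) = map (\<lambda>_. 0) (gate_readers n (C ! k))"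
    using gate_readers_goods by (fastforce simp: ideal_def)
  then show ?thesis unfolding flow_def by (simp only: sum_list_0)
qed

lemma income_eq: "j < 2 * n + 1 \<Longrightarrow> income j = 1 + (\<Sum>k<length C. flow k j)"
  by (subst sum_circuit_readers) (simp add: flow_def ideal_def demand_def)

lemma gate_nodes_valid:
  "k < length C \<Longrightarrow> distinct (gate_nodes (C ! k)) \<and> set (gate_nodes (C ! k)) \<subseteq> {..<n}"
  using valid nth_mem[of k C] unfolding valid_pure_circuit_def prod.case by blast

lemma income_aux:
  assumes "k < length C" "v \<in> gate_outputs (C ! k)"
  shows "income (n + v) = 1 + flow k (n + v)"
proof -
  have v: "v < n" using gate_nodes_valid[OF assms(1)] assms(2) by (cases "C ! k") auto
  from valid_node[OF valid single v] obtain k1 k2 where k: "k1 < length C" "k2 < length C" "k1 \<noteq> k2"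
    "v \<in> gate_outputs (C ! k1)" "v \<in> gate_inputs (C ! k2)"
    "\<forall>k<length C. v \<in> gate_outputs (C ! k) \<longrightarrow> k = k1"
    "\<forall>k<length C. v \<in> gate_inputs (C ! k) \<longrightarrow> k = k2" .
  note k1 = k(6)
  have "(\<Sum>k'<length C. flow k' (n + v)) = (\<Sum>k'\<in>{k}. flow k' (n + v))"
  proof (rule sum.mono_neutral_right)
    show "\<forall>k'\<in>{..<length C} - {k}. flow k' (n + v) = 0"
    proof
      fix k' assume "k' \<in> {..<length C} - {k}"
      then have "v \<notin> gate_outputs (C ! k')" using k1[rule_format, of k'] k1[rule_format, of k] assms by auto
      then have "n + v \<notin> gate_goods n (C ! k')"
        using gate_goods_node[OF valid, of k' "n + v"] \<open>k' \<in> _\<close> by auto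
      then show "flow k' (n + v) = 0" by (rule flow_eq_0)
    qed
  qed (use assms in auto)
  with v show ?thesis by (simp add: income_eq)
qed

lemma flow_input:
  assumes "k < length C" "v \<in> gate_inputs (C ! k)"
  shows "reading (p v) (flow k v)"
  using gate_nodes_valid[OF assms(1)] assms(2)
  by (cases "C ! k") (auto simp: reading_def flow_def ideal_def demand_def sum_list_replicate)

text \<open>Exactly two gates touch a node: the one that outputs it contributes
  \<open>flow k v\<close>, the one that reads it contributes \<open>R\<close>. The 1 comes from the
  buyer that wants only \<open>v\<close>.\<close>

lemma income_node:
  assumes "k < length C" "v \<in> gate_outputs (C ! k)"
  obtains R where "reading (p v) R" "income v = 1 + flow k v + R"
proof -
  have v: "v < n" using gate_nodes_valid[OF assms(1)] assms(2) by (cases "C ! k") auto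
  from valid_node[OF valid single v] obtain k1 k2 where
    k: "k1 < length C" "k2 < length C" "k1 \<noteq> k2"
    "v \<in> gate_outputs (C ! k1)" "v \<in> gate_inputs (C ! k2)"
    "\<forall>k<length C. v \<in> gate_outputs (C ! k) \<longrightarrow> k = k1"
    "\<forall>k<length C. v \<in> gate_inputs (C ! k) \<longrightarrow> k = k2" .
  have "k = k1" using k(6) assms by blast
  have "(\<Sum>k'<length C. flow k' v) = (\<Sum>k'\<in>{k, k2}. flow k' v)"
  proof (rule sum.mono_neutral_right)
    show "\<forall>k'\<in>{..<length C} - {k, k2}. flow k' v = 0"
    proof
      fix k' assume k': "k' \<in> {..<length C} - {k, k2}"
      then have "v \<notin> gate_outputs (C ! k')" "v \<notin> gate_inputs (C ! k')"
        using k(6)[rule_format, of k'] k(7)[rule_format, of k'] \<open>k = k1\<close> by auto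
      then have "v \<notin> gate_goods n (C ! k')"
        using gate_goods_node[OF valid, of k' v] k' v by auto
      then show "flow k' v = 0" by (rule flow_eq_0)
    qed
  qed (use k(2) assms(1) in auto)
  also have "\<dots> = flow k v + flow k2 v" using k(3) \<open>k = k1\<close> by simp
  finally have "income v = 1 + flow k v + flow k2 v" using v by (simp add: income_eq)
  with flow_input[OF k(2,5)] show ?thesis by (rule that)
qed

section \<open>Gates whose goods carry little waste\<close>

definition undisturbed where "undisturbed k \<longleftrightarrow> (\<forall>j\<in>gate_goods n (C ! k). bad j \<le> 1 / 10)"

text \<open>The general price bound gives \<open>9 / 8 * (1753 + 1 / 10)\<close>, which is less than
  2000.\<close>

lemma undisturbed_price: "k < length C \<Longrightarrow> undisturbed k \<Longrightarrow> j \<in> gate_goods n (C ! k) \<Longrightarrow> p j \<le> 2000"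
  using price_upper[of j] gate_goods_bound[OF valid, of "C ! k" j] by (auto simp: undisturbed_def)

text \<open>All gate readers with target \<open>j\<close> come from gate \<open>k\<close> itself, so
  their sources have bounded prices and nothing has to be assumed about the neighbouring
  gates.\<close>

lemma undisturbed_money:
  assumes "k < length C" "undisturbed k" "j \<in> gate_goods n (C ! k)" "j \<notin> gate_inputs (C ! k)"
  shows "8 / 9 * p j \<le> income j + 1 / 10" "income j - 1 / 10 \<le> 10 / 9 * p j"
proof -
  have j: "j < 2 * n + 1" using gate_goods_bound[OF valid, of "C ! k" j] assms by auto
  have b: "bad j \<le> 1 / 10" using assms by (auto simp: undisturbed_def)
  have "p v \<le> 2000" if r: "(d, v, j) \<in> set (circuit_readers (n, C))" "v \<noteq> j" for d v
  proof -
    from r obtain g where "g \<in> set C" "(d, v, j) \<in> set (gate_readers n g)"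
      unfolding circuit_readers_def by auto
    then obtain k' where k': "k' < length C" "(d, v, j) \<in> set (gate_readers n (C ! k'))"
      by (metis in_set_conv_nth)
    \<comment> \<open>\<open>a\<close> is the node to which the good \<open>j\<close> belongs; its
      unique output gate identifies \<open>k'\<close> with \<open>k\<close>.\<close>
    define a where "a = (if j < n then j else j - n)"
    have a: "a \<in> gate_outputs (C ! k)"
      using gate_goods_node[OF valid assms(1,3)] assms(4) by (auto simp: a_def split: if_splits)
    have "j \<notin> gate_inputs (C ! k')"
      using gate_nodes_valid[OF k'(1)] k'(2) by (cases "C ! k'") auto
    moreover have "j \<in> gate_goods n (C ! k')" using gate_readers_goods[OF k'(2)] by blast
    ultimately have a': "a \<in> gate_outputs (C ! k')"
      using gate_goods_node[OF valid k'(1), of j] by (auto simp: a_def split: if_splits)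
    have "a < n" using gate_nodes_valid[OF assms(1)] a by (cases "C ! k") auto
    then have "\<exists>!k. k < length C \<and> a \<in> gate_outputs (C ! k)"
      using valid unfolding valid_pure_circuit_def by simp
    with a a' assms(1) k'(1) have "k = k'" by blast
    with gate_readers_goods[OF k'(2)] undisturbed_price[OF assms(1,2)] show ?thesis by blast
  qed
  then have "8 / 9 * p j \<le> income j + bad j" by (rule money_upper[OF j])
  with b show "8 / 9 * p j \<le> income j + 1 / 10" by linarith
  from money_lower[OF j undisturbed_price[OF assms(1-3)]] b show "income j - 1 / 10 \<le> 10 / 9 * p j" by linarith
qed

text \<open>The bounds 221 and 1/2 are those of \<open>node_price_high\<close> and
  \<open>node_price_low\<close> without the one unit of the buyer that wants only
  \<open>v\<close>.\<close>

lemma output_price: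
  assumes "k < length C" "undisturbed k" "v \<in> gate_outputs (C ! k)"
  shows "221 \<le> flow k v \<Longrightarrow> 512 \<le> p v" "flow k v \<le> 1 / 2 \<Longrightarrow> p v \<le> 32"
proof -
  from income_node[OF assms(1,3)] obtain R where R: "reading (p v) R" "income v = 1 + flow k v + R" .
  have v: "v \<in> gate_goods n (C ! k)" "v \<notin> gate_inputs (C ! k)" "v < n"
    using assms(3) gate_nodes_valid[OF assms(1)] by (cases "C ! k"; auto)+
  note m = undisturbed_money[OF assms(1,2) v(1,2), unfolded R(2)]
  show "512 \<le> p v" if "221 \<le> flow k v"
    using node_price_high[OF R(1), of "1 + flow k v"] m that by simp
  show "p v \<le> 32" if "flow k v \<le> 1 / 2"
    using node_price_low[OF R(1), of "1 + flow k v"] m that price_nonneg[of v] v(3) by simp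
qed

text \<open>\<open>y\<close> is the money arriving from the group that reads \<open>u\<close>. Below
  300 the readers of the auxiliary good spend 5/6 of its price, so \<open>y = 84\<close> would
  already force a price of \<open>18 / 5 * (1 + 84 - 1 / 10)\<close>, which exceeds 300.\<close>

lemma purify_aux_price:
  assumes "k < length C" "undisturbed k" "C ! k = PURIFY u v w" "b \<in> {v, w}"
    and "flow k (n + b) = y + 250 * min 1 (p (n + b) / 300)"
  shows "84 \<le> y \<Longrightarrow> 300 \<le> p (n + b)" "y \<le> 1 / 2 \<Longrightarrow> p (n + b) \<le> 32"
proof -
  have inc: "income (n + b) = 1 + (y + 250 * min 1 (p (n + b) / 300))"
    using income_aux[OF assms(1), of b] assms(3-5) by auto
  have g: "n + b \<in> gate_goods n (C ! k)" "n + b \<notin> gate_inputs (C ! k)" "b < n"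
    using assms gate_nodes_valid[OF assms(1)] by auto
  note m = undisturbed_money[OF assms(1,2) g(1,2), unfolded inc]
  have "0 \<le> p (n + b)" using price_nonneg[of "n + b"] g(3) by simp
  then show "84 \<le> y \<Longrightarrow> 300 \<le> p (n + b)" "y \<le> 1 / 2 \<Longrightarrow> p (n + b) \<le> 32"
    using m by (auto simp: min_def split: if_splits)
qed

text \<open>An input of price at most 32 leaves \<open>350 * (1 - 32 / 420)\<close>, more than 323,
  for \<open>w\<close>; two inputs of price at least 420 leave nothing.\<close>

lemma undisturbed_nand:
  assumes k: "k < length C" "undisturbed k" and g: "C ! k = NAND u v w"
  shows "satisfies (\<lambda>v. decode (p v)) (C ! k)"
proof -
  have d: "u \<noteq> w" "v \<noteq> w" "u < n" "v < n" "w < n" using gate_nodes_valid[OF k(1)] g by auto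
  have f: "flow k w = 350 * (1 - min 1 (p u / 420)) + 350 * (1 - min 1 (p v / 420))"
    using d by (simp add: flow_def g ideal_def demand_def sum_list_replicate)
  have "w \<in> gate_outputs (C ! k)" by (simp add: g)
  note o = output_price[OF k this, unfolded f]
  show ?thesis unfolding g
    using o by (auto simp: min_def split: if_splits)
qed

text \<open>The source price 342 is the dividing line. From there on the first group no longer
  supports \<open>n + v\<close>, and \<open>v\<close> is \<open>One\<close>; up to there the second
  group still sends at least \<open>282 * (1 - 342 / 512)\<close>, more than 93, to
  \<open>n + w\<close>, and \<open>w\<close> is \<open>Zero\<close>. For pure inputs the other
  output agrees: \<open>94 * (1 - 32 / 342)\<close> is more than 85, and an auxiliary price of at
  most 32 leaves \<open>250 * (1 - 32 / 300)\<close>, more than 223, for the output.\<close>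

lemma undisturbed_purify:
  assumes k: "k < length C" "undisturbed k" and g: "C ! k = PURIFY u v w"
  shows "satisfies (\<lambda>v. decode (p v)) (C ! k)"
proof -
  have d: "u \<noteq> v" "u \<noteq> w" "v \<noteq> w" "u < n" "v < n" "w < n" using gate_nodes_valid[OF k(1)] g by auto
  have fa: "flow k (n + v) = 94 * (1 - min 1 (p u / 342)) + 250 * min 1 (p (n + v) / 300)"
    "flow k (n + w) = 282 * (1 - min 1 (p u / 512)) + 250 * min 1 (p (n + w) / 300)"
    using d by (simp_all add: flow_def g ideal_def demand_def sum_list_replicate)
  have fo: "flow k v = 250 * (1 - min 1 (p (n + v) / 300))" "flow k w = 250 * (1 - min 1 (p (n + w) / 300))"
    using d by (simp_all add: flow_def g ideal_def demand_def sum_list_replicate)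
  have vo: "v \<in> gate_outputs (C ! k)" "w \<in> gate_outputs (C ! k)" by (simp_all add: g)
  note a = purify_aux_price[OF k g _ fa(1)] purify_aux_price[OF k g _ fa(2)]
  note o = output_price[OF k vo(1), unfolded fo] output_price[OF k vo(2), unfolded fo]
  have v1: "512 \<le> p v" if "342 \<le> p u" using a(2) o(1) that by (simp add: min_def split: if_splits)
  have w1: "512 \<le> p w" if "512 \<le> p u" using a(4) o(3) that by (simp add: min_def split: if_splits)
  have v0: "p v \<le> 32" if "p u \<le> 32" using a(1) o(2) that by (simp add: min_def split: if_splits)
  have w0: "p w \<le> 32" if "p u \<le> 342" using a(3) o(4) that by (simp add: min_def split: if_splits)
  show ?thesis unfolding g using v1 w1 v0 w0 by (cases "342 \<le> p u") (auto simp: decode_def)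
qed

lemma undisturbed_satisfied: "k < length C \<Longrightarrow> undisturbed k \<Longrightarrow> satisfies (\<lambda>v. decode (p v)) (C ! k)"
  using undisturbed_nand undisturbed_purify by (cases "C ! k") auto

text \<open>Markov's inequality: each disturbed gate has a good with \<open>bad\<close> above 1/10,
  and a good belongs to at most two gates.\<close>

lemma card_not_undisturbed: "real (card {k. k < length C \<and> \<not> undisturbed k}) \<le> 20 * (\<Sum>j<2 * n + 1. bad j)"
proof -
  have goods: "gate_goods n (C ! k) \<subseteq> {..<2 * n + 1}" if "k < length C" for k
    using gate_goods_bound[OF valid, of "C ! k"] that by fastforce
  have "1 / 10 * real (card {k. k < length C \<and> \<not> undisturbed k}) =
      (\<Sum>k<length C. if \<not> undisturbed k then 1 / 10 else 0)"
    by (simp add: sum.If_cases Int_def)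
  also have "\<dots> \<le> (\<Sum>k<length C. \<Sum>j<2 * n + 1. if j \<in> gate_goods n (C ! k) then bad j else 0)"
  proof (rule sum_mono)
    fix k assume "k \<in> {..<length C}"
    then have k: "k < length C" by simp
    have nn: "0 \<le> (if j \<in> gate_goods n (C ! k) then bad j else 0)" if "j < 2 * n + 1" for j
      using bad_nonneg[OF that] by simp
    show "(if \<not> undisturbed k then 1 / 10 else 0) \<le>
        (\<Sum>j<2 * n + 1. if j \<in> gate_goods n (C ! k) then bad j else 0)"
    proof (cases "undisturbed k")
      case True
      moreover have "0 \<le> (\<Sum>j<2 * n + 1. if j \<in> gate_goods n (C ! k) then bad j else 0)"
        using nn by (intro sum_nonneg) (simp only: lessThan_iff)
      ultimately show ?thesis by (simp only: not_True_eq_False if_False)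
    next
      case False
      then obtain j where j: "j \<in> gate_goods n (C ! k)" "1 / 10 < bad j"
        unfolding undisturbed_def by (auto simp: not_le)
      have "(if j \<in> gate_goods n (C ! k) then bad j else 0) \<le>
          (\<Sum>j<2 * n + 1. if j \<in> gate_goods n (C ! k) then bad j else 0)"
        using goods[OF k] j(1) nn by (intro member_le_sum) (auto simp only: lessThan_iff finite_lessThan)
      with False j show ?thesis by (simp only: if_True not_False_eq_True)
    qed
  qed
  also have "\<dots> = (\<Sum>j<2 * n + 1. \<Sum>k<length C. if j \<in> gate_goods n (C ! k) then bad j else 0)"
    by (rule sum.swap)
  also have "\<dots> = (\<Sum>j<2 * n + 1. real (card {k. k < length C \<and> j \<in> gate_goods n (C ! k)}) * bad j)"
    by (intro sum.cong) (simp_all add: sum.If_cases Int_def)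
  also have "\<dots> \<le> (\<Sum>j<2 * n + 1. 2 * bad j)"
  proof (rule sum_mono)
    fix j assume "j \<in> {..<2 * n + 1}"
    with card_gates_of_good[OF valid single, of j] bad_nonneg[of j]
    show "real (card {k. k < length C \<and> j \<in> gate_goods n (C ! k)}) * bad j \<le> 2 * bad j"
      by (intro mult_right_mono) auto
  qed
  finally show ?thesis by (simp add: sum_distrib_left[symmetric])
qed

text \<open>The constant \<open>10 ^ 12\<close> absorbs
  \<open>20 * 3 * 881 * (1 + 5625 * 1753)\<close>, which is about
  \<open>5.2 * 10 ^ 11\<close>.\<close>

lemma satisfied_gates:
  "(1 - 10 ^ 12 * \<delta>) * real (length C) \<le>
     real (card {k. k < length C \<and> satisfies (\<lambda>v. decode (p v)) (C ! k)})"
proof (cases "C = []")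
  case False
  have "20 * (\<Sum>j<2 * n + 1. bad j) \<le>
      20 * (3 * \<delta> * real (length (circuit_readers (n, C))) * (1 + 5625 * real 1753))"
    using total_bad by simp
  also have "\<dots> \<le> 20 * (3 * \<delta> * real (881 * length C) * (1 + 5625 * real 1753))"
    using length_circuit_readers[OF valid False] delta
    by (intro mult_left_mono mult_right_mono of_nat_mono) auto
  also have "\<dots> \<le> 10 ^ 12 * \<delta> * real (length C)"
    using mult_nonneg_nonneg[OF delta(1), of "real (length C)"] by simp
  finally have bad: "real (card {k. k < length C \<and> \<not> undisturbed k}) \<le> 10 ^ 12 * \<delta> * real (length C)"
    using card_not_undisturbed by linarith
  have "{..<length C} \<subseteq> {k. k < length C \<and> satisfies (\<lambda>v. decode (p v)) (C ! k)} \<union>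
      {k. k < length C \<and> \<not> undisturbed k}" using undisturbed_satisfied by auto
  then have "card {..<length C} \<le> card ({k. k < length C \<and> satisfies (\<lambda>v. decode (p v)) (C ! k)} \<union>
      {k. k < length C \<and> \<not> undisturbed k})" by (intro card_mono) auto
  also have "\<dots> \<le> card {k. k < length C \<and> satisfies (\<lambda>v. decode (p v)) (C ! k)} +
      card {k. k < length C \<and> \<not> undisturbed k}" by (rule card_Un_le)
  finally show ?thesis using bad by (simp add: algebra_simps)
qed simp

end

section \<open>The market of a circuit\<close>

definition reader_pieces :: "reader \<Rightarrow> nat \<Rightarrow> pieces" where
  "reader_pieces = (\<lambda>(d, u, w) j. if j = w then ([], 1) else if j = u
     then ([(1 / of_nat d, 5000 / of_nat d)], 0) else ([], 0))"

definition circuit_market :: "pure_circuit \<Rightarrow> market_data" where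
  "circuit_market = (\<lambda>(n, C). (2 * n + 1,
     map (\<lambda>r. (1, map (reader_pieces r) [0..<2 * n + 1])) (circuit_readers (n, C))))"

lemma eval_pieces_simps:
  "eval_pieces ([], 0) = (\<lambda>x. 0)" "eval_pieces ([], 1) = (\<lambda>x. x)"
  "0 < d \<Longrightarrow> eval_pieces ([(1 / of_nat d, 5000 / of_nat d)], 0) = (\<lambda>x. 5000 * min x (1 / real d))"
  by (auto simp: eval_pieces_def fun_eq_iff of_rat_divide field_simps min_def)

lemma eval_reader_pieces: "0 < d \<Longrightarrow> eval_pieces (reader_pieces (d, u, w) j) =
   (if j = w then (\<lambda>x. x) else if j = u then (\<lambda>x. 5000 * min x (1 / real d)) else (\<lambda>x. 0))"
  by (simp add: reader_pieces_def eval_pieces_simps del: of_nat_eq_1_iff)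

section \<open>Capped utilities and their slopes\<close>

lemma plc_utility_zero: "plc_utility (\<lambda>x. 0)"
  unfolding plc_utility_def piecewise_linear_def
  by (auto intro!: exI[of _ "{}"] exI[of _ 0] mono_onI simp: concave_on_const)

lemma plc_utility_linear: "plc_utility (\<lambda>x. x)"
proof -
  have "piecewise_linear (\<lambda>x. x)"
    unfolding piecewise_linear_def
  proof (intro exI[of _ "{}"] conjI allI impI)
    show "\<exists>m c. \<forall>x\<in>{a<..<b}. x = m * x + c" for a b :: real
      by (intro exI[of _ 1] exI[of _ 0]) simp
  qed simp
  then show ?thesis
    unfolding plc_utility_def by (auto intro!: mono_onI simp: concave_on_iff)
qed

lemma plc_utility_capped:
  assumes "0 \<le> (c :: real)"
  shows "plc_utility (\<lambda>x. 5000 * min x c)"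
  unfolding plc_utility_def
proof (intro conjI)
  show "continuous_on {0..} (\<lambda>x. 5000 * min x c)" by (intro continuous_intros)
  show "mono_on {0..} (\<lambda>x. 5000 * min x c)" by (rule mono_onI) auto
  show "concave_on {0..} (\<lambda>x. 5000 * min x c)"
    unfolding concave_on_iff
  proof (intro conjI ballI allI impI)
    fix x y u v :: real
    assume uv: "0 \<le> u" "0 \<le> v" "u + v = 1"
    have "u * min x c + v * min y c \<le> u * x + v * y"
      using uv by (intro add_mono mult_left_mono) auto
    moreover have "u * min x c + v * min y c \<le> u * c + v * c"
      using uv by (intro add_mono mult_left_mono) auto
    moreover have "u * c + v * c = c" using uv(3) by (metis distrib_right mult_1)
    ultimately have "u * min x c + v * min y c \<le> min (u * x + v * y) c" by simp
    then have "5000 * (u * min x c + v * min y c) \<le> 5000 * min (u * x + v * y) c"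
      by (rule mult_left_mono) simp
    then show "u * (5000 * min x c) + v * (5000 * min y c) \<le> 5000 * min (u *\<^sub>R x + v *\<^sub>R y) c"
      by (simp only: real_scaleR_def distrib_left mult.left_commute[of u] mult.left_commute[of v])
  qed simp
  show "piecewise_linear (\<lambda>x. 5000 * min x c)"
    unfolding piecewise_linear_def
  proof (intro exI[of _ "{c}"] conjI allI impI)
    fix a b :: real assume ab: "0 \<le> a \<and> a < b \<and> {a<..<b} \<inter> {c} = {}"
    then consider "b \<le> c" | "c \<le> a" by fastforce
    then show "\<exists>m k. \<forall>x\<in>{a<..<b}. 5000 * min x c = m * x + k"
    proof cases
      case 1
      then show ?thesis by (intro exI[of _ 5000] exI[of _ 0]) auto
    next
      case 2
      then show ?thesis by (intro exI[of _ 0] exI[of _ "5000 * c"]) auto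
    qed
  qed simp
qed (use assms in auto)

text \<open>On an interval where \<open>f\<close> is affine every secant from the left end has the
  same slope, so it suffices to know one of them.\<close>

lemma slopes_subset:
  assumes "\<And>a b. 0 \<le> a \<Longrightarrow> a < b \<Longrightarrow> \<exists>d\<in>{a<..b}. \<exists>m\<in>S. f d - f a = m * (d - a)"
  shows "slopes f \<subseteq> S"
proof
  fix m assume "m \<in> slopes f"
  then obtain a b c where ab: "0 \<le> a" "a < b" "\<forall>x\<in>{a..b}. f x = m * x + c"
    unfolding slopes_def by blast
  from assms[OF ab(1,2)] obtain d m' where d: "d \<in> {a<..b}" "m' \<in> S" "f d - f a = m' * (d - a)" by blast
  have "f d - f a = m * (d - a)" using ab d(1) by (simp add: algebra_simps)
  with d show "m \<in> S" by simp
qed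

lemma slopes_zero: "slopes (\<lambda>x. 0) \<subseteq> {0}"
  by (rule slopes_subset) auto

lemma slopes_linear: "slopes (\<lambda>x. x) \<subseteq> {1}"
  by (rule slopes_subset) auto

lemma slopes_capped: "slopes (\<lambda>x. 5000 * min x c) \<subseteq> {0, 5000}"
proof (rule slopes_subset)
  fix a b :: real assume ab: "0 \<le> a" "a < b"
  show "\<exists>d\<in>{a<..b}. \<exists>m\<in>{0, 5000}. 5000 * min d c - 5000 * min a c = m * (d - a)"
  proof (cases "c \<le> a")
    case True
    with ab show ?thesis by (intro bexI[of _ b] bexI[of _ 0]) auto
  next
    case False
    \<comment> \<open>The secant up to \<open>min b c\<close> stays on the rising piece.\<close>
    with ab show ?thesis by (intro bexI[of _ "min b c"] bexI[of _ 5000]) (auto simp: min_def algebra_simps)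
  qed
qed

lemma linear_capped_simps:
  "linear_capped (\<lambda>x. 0)" "linear_capped (\<lambda>x. x)" "0 \<le> c \<Longrightarrow> linear_capped (\<lambda>x. 5000 * min x c)"
proof -
  show "linear_capped (\<lambda>x. 0)"
    unfolding linear_capped_def by (intro exI[of _ 0] exI[of _ "0 :: ereal"]) (auto simp: zero_ereal_def)
  show "linear_capped (\<lambda>x. x)"
    unfolding linear_capped_def by (intro exI[of _ 1] exI[of _ "\<infinity> :: ereal"] conjI) auto
  show "linear_capped (\<lambda>x. 5000 * min x c)" if "0 \<le> c"
    unfolding linear_capped_def using that
    by (intro exI[of _ 5000] exI[of _ "ereal (5000 * c)"] conjI) (auto simp: min_def)
qed

section \<open>Validity of the constructed market\<close>

context
  fixes n :: nat and C :: "gate list"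
  assumes valid: "valid_pure_circuit (n, C)"
begin

lemma market_simps:
  "goods (market_of (circuit_market (n, C))) = {..<2 * n + 1}" "buyers (market_of (circuit_market (n, C))) = {..<length (circuit_readers (n, C))}"
  "i < length (circuit_readers (n, C)) \<Longrightarrow> budget (market_of (circuit_market (n, C))) i = 1"
  "i < length (circuit_readers (n, C)) \<Longrightarrow> j < 2 * n + 1 \<Longrightarrow> util (market_of (circuit_market (n, C))) i j = eval_pieces (reader_pieces (circuit_readers (n, C) ! i) j)"
  by (simp_all add: market_of_def circuit_market_def del: upt_Suc)

lemma reader_cases:
  assumes "i < length (circuit_readers (n, C))"
  obtains d u w where "circuit_readers (n, C) ! i = (d, u, w)" "0 < d" "u < 2 * n + 1" "w < 2 * n + 1"
  using circuit_readers_bounds[OF valid] nth_mem[OF assms] by (metis prod_cases3)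

lemma util_eq:
  assumes "i < length (circuit_readers (n, C))" "circuit_readers (n, C) ! i = (d, u, w)" "0 < d" "j < 2 * n + 1"
  shows "util (market_of (circuit_market (n, C))) i j =
    (if j = w then (\<lambda>x. x) else if j = u then (\<lambda>x. 5000 * min x (1 / real d)) else (\<lambda>x. 0))"
  using assms by (simp add: market_simps eval_reader_pieces)

lemma circuit_fisher_market: "fisher_market (market_of (circuit_market (n, C)))"
proof -
  have "plc_utility (util (market_of (circuit_market (n, C))) i j)" if i: "i < length (circuit_readers (n, C))" and j: "j < 2 * n + 1" for i j
  proof -
    from reader_cases[OF i] obtain d u w where r: "circuit_readers (n, C) ! i = (d, u, w)" "0 < d" by metis
    show ?thesis unfolding util_eq[OF i r j]
      using plc_utility_zero plc_utility_linear plc_utility_capped[of "1 / real d"] by simp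
  qed
  moreover have "length (circuit_readers (n, C)) \<noteq> 0" by (simp add: circuit_readers_def)
  ultimately show ?thesis
    by (auto simp: fisher_market_def market_simps)
qed

lemma circuit_valid_market: "valid_market_data (circuit_market (n, C))"
proof -
  have s: "sorted_wrt (<) (0 # map fst ps)"
    if "(d, u, w) \<in> set (circuit_readers (n, C))" "reader_pieces (d, u, w) j = (ps, s)" for d u w j ps s
    using circuit_readers_bounds[OF valid that(1)] that(2) by (auto simp: reader_pieces_def split: if_splits)
  have m: "\<exists>j<2 * n + 1. strict_mono_on {0..} (util (market_of (circuit_market (n, C))) i j)" if i: "i < length (circuit_readers (n, C))" for i
  proof -
    from reader_cases[OF i] obtain d u w where r: "circuit_readers (n, C) ! i = (d, u, w)" "0 < d" "w < 2 * n + 1" by metis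
    with util_eq[OF i r(1,2,3)] show ?thesis
      by (intro exI[of _ w]) (simp add: strict_mono_on_def)
  qed
  have eq: "circuit_market (n, C) = (2 * n + 1, map (\<lambda>r. (1, map (reader_pieces r) [0..<2 * n + 1])) (circuit_readers (n, C)))"
    by (simp add: circuit_market_def)
  show ?thesis
    unfolding valid_market_data_def eq prod.case
    unfolding eq[symmetric]
  proof (intro conjI)
    show "\<forall>(e, us)\<in>set (map (\<lambda>r. (1 :: rat, map (reader_pieces r) [0..<2 * n + 1])) (circuit_readers (n, C))).
        length us = 2 * n + 1 \<and> (\<forall>(ps, s)\<in>set us. sorted_wrt (<) (0 # map fst ps))"
    proof clarify
      fix e us assume "(e, us) \<in> set (map (\<lambda>r. (1 :: rat, map (reader_pieces r) [0..<2 * n + 1])) (circuit_readers (n, C)))"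
      then obtain d u w where r: "(d, u, w) \<in> set (circuit_readers (n, C))"
        "us = map (reader_pieces (d, u, w)) [0..<2 * n + 1]" by (auto simp del: upt_Suc)
      show "length us = 2 * n + 1 \<and> (\<forall>(ps, s)\<in>set us. sorted_wrt (<) (0 # map fst ps))"
      proof (intro conjI ballI)
        show "length us = 2 * n + 1" unfolding r(2) by simp
        fix y assume "y \<in> set us"
        then obtain j where "y = reader_pieces (d, u, w) j" unfolding r(2) by auto
        with s[OF r(1), of j] show "case y of (ps, s) \<Rightarrow> sorted_wrt (<) (0 # map fst ps)"
          by (auto split: prod.splits)
      qed
    qed
  qed (use m circuit_fisher_market in simp_all)
qed

end

section \<open>The simple family and soundness of the decoding\<close>

definition circuit_markets :: "(nat, nat) market set" where
  "circuit_markets = {market_of (circuit_market I) |I. valid_pure_circuit I \<and> single_input_use I}"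

lemma circuit_marketsE:
  assumes "M \<in> circuit_markets"
  obtains n C where "valid_pure_circuit (n, C)" "single_input_use (n, C)" "M = market_of (circuit_market (n, C))"
  using assms unfolding circuit_markets_def by auto

lemma simple_family_circuit_markets: "simple_family circuit_markets"
proof -
  have 1: "fisher_market M \<and> (\<forall>i \<in> buyers M. budget M i = 1 \<and>
         (\<forall>j \<in> goods M. linear_capped (util M i j)) \<and>
         (\<exists>j \<in> goods M. \<exists>a > 0. \<forall>x \<ge> 0. util M i j x = a * x))" if "M \<in> circuit_markets" for M
    using that
  proof (cases rule: circuit_marketsE)
    case (1 n C)
    let ?L = "circuit_readers (n, C)"
    have "(\<forall>j < 2 * n + 1. linear_capped (util M i j)) \<and>
         (\<exists>j < 2 * n + 1. \<exists>a > 0. \<forall>x \<ge> 0. util M i j x = a * x)" if i: "i < length ?L" for i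
    proof -
      from reader_cases[OF 1(1) i] obtain d u w where
        r: "?L ! i = (d, u, w)" "0 < d" "w < 2 * n + 1" by metis
      note u = util_eq[OF 1(1) i r(1,2), folded 1(3)]
      have "\<forall>j < 2 * n + 1. linear_capped (util M i j)"
        using u r(2) linear_capped_simps by auto
      moreover have "\<forall>x \<ge> 0. util M i w x = 1 * x" using u[OF r(3)] by simp
      ultimately show ?thesis using r(3) zero_less_one by blast
    qed
    note * = this
    show ?thesis
    proof (intro conjI ballI)
      show "fisher_market M" using circuit_fisher_market[OF 1(1)] by (simp only: 1(3))
    next
      fix i assume "i \<in> buyers M"
      then have i: "i < length ?L" by (simp only: 1(3) market_simps(2)[OF 1(1)] lessThan_iff)
      show "budget M i = 1" by (simp only: 1(3) market_simps(3)[OF 1(1) i])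
      show "\<exists>j\<in>goods M. \<exists>a>0. \<forall>x\<ge>0. util M i j x = a * x"
        using *[OF i] unfolding 1(3) market_simps(1)[OF 1(1)] by blast
      fix j assume "j \<in> goods M"
      then have "j < 2 * n + 1" by (simp only: 1(3) market_simps(1)[OF 1(1)] lessThan_iff)
      then show "linear_capped (util M i j)" using *[OF i] by blast
    qed
  qed
  have 2: "card {j \<in> goods M. nonzero_utility (util M i j)} \<le> 2"
    if "M \<in> circuit_markets" "i \<in> buyers M" for M i
    using that(1)
  proof (cases rule: circuit_marketsE)
    case (1 n C)
    let ?L = "circuit_readers (n, C)"
    have i: "i < length ?L" using that(2) by (simp add: 1(3) market_simps[OF 1(1)])
    from reader_cases[OF 1(1) i] obtain d u w where
      r: "?L ! i = (d, u, w)" "0 < d" by metis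
    have "{j \<in> goods M. nonzero_utility (util M i j)} \<subseteq> {u, w}"
      using util_eq[OF 1(1) i r, folded 1(3)]
      by (auto simp: 1(3) market_simps(1)[OF 1(1)] nonzero_utility_def split: if_splits)
    then have "card {j \<in> goods M. nonzero_utility (util M i j)} \<le> card {u, w}"
      by (intro card_mono) auto
    also have "\<dots> \<le> 2" by (simp add: card_insert_if)
    finally show ?thesis .
  qed
  have 3: "card {i \<in> buyers M. nonzero_utility (util M i j)} \<le> 1753"
    if "M \<in> circuit_markets" "j \<in> goods M" for M j
    using that(1)
  proof (cases rule: circuit_marketsE)
    case (1 n C)
    let ?L = "circuit_readers (n, C)"
    have j: "j < 2 * n + 1" using that(2) by (simp add: 1(3) market_simps[OF 1(1)])
    have "concerns j (?L ! i)" if i: "i < length ?L" and nz: "nonzero_utility (util M i j)" for i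
    proof -
      from reader_cases[OF 1(1) i] obtain d u w where r: "?L ! i = (d, u, w)" "0 < d" by metis
      from nz show ?thesis unfolding util_eq[OF 1(1) i r j, folded 1(3)] r
        by (auto simp: concerns_def nonzero_utility_def split: if_splits)
    qed
    then have "{i \<in> buyers M. nonzero_utility (util M i j)} \<subseteq> {i. i < length ?L \<and> concerns j (?L ! i)}"
      by (auto simp: 1(3) market_simps(2)[OF 1(1)])
    then have "card {i \<in> buyers M. nonzero_utility (util M i j)} \<le> card {i. i < length ?L \<and> concerns j (?L ! i)}"
      by (intro card_mono) auto
    also have "\<dots> \<le> 1753" by (rule circuit_degree[OF 1(1,2) j])
    finally show ?thesis .
  qed
  have 4: "(\<Union>j \<in> goods M. slopes (util M i j)) - {0} \<subseteq> {1, 5000}"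
    if "M \<in> circuit_markets" "i \<in> buyers M" for M i
    using that(1)
  proof (cases rule: circuit_marketsE)
    case (1 n C)
    let ?L = "circuit_readers (n, C)"
    have i: "i < length ?L" using that(2) by (simp add: 1(3) market_simps[OF 1(1)])
    from reader_cases[OF 1(1) i] obtain d u w where
      r: "?L ! i = (d, u, w)" "0 < d" by metis
    have "slopes (util M i j) \<subseteq> {0, 1, 5000}" if "j \<in> goods M" for j
    proof -
      from that have j: "j < 2 * n + 1" by (simp add: 1(3) market_simps[OF 1(1)])
      show ?thesis unfolding util_eq[OF 1(1) i r j, folded 1(3)]
        using slopes_zero slopes_linear slopes_capped[of "1 / real d"] by auto
    qed
    then show ?thesis by fastforce
  qed
  show ?thesis
    unfolding simple_family_def
  proof (intro conjI)
    show "\<exists>K :: real. \<forall>M\<in>circuit_markets. \<forall>i\<in>buyers M.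
       \<forall>m\<in>(\<Union>j\<in>goods M. slopes (util M i j)) - {0}.
       \<forall>m'\<in>(\<Union>j\<in>goods M. slopes (util M i j)) - {0}. m / m' \<le> K"
    proof (intro exI[of _ 5000] ballI)
      fix M :: "(nat, nat) market" and i m m'
      assume M: "M \<in> circuit_markets" "i \<in> buyers M"
        and m: "m \<in> (\<Union>j\<in>goods M. slopes (util M i j)) - {0}" "m' \<in> (\<Union>j\<in>goods M. slopes (util M i j)) - {0}"
      from m 4[OF M] have "m \<in> {1, 5000}" "m' \<in> {1, 5000}" by blast+
      then show "m / m' \<le> 5000" by auto
    qed
  qed (use 1 2 3 in blast)+
qed

lemma satisfies_cong: "(\<And>v. v \<in> set (gate_nodes g) \<Longrightarrow> x v = y v) \<Longrightarrow> satisfies x g = satisfies y g"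
  by (cases g) auto

lemma circuit_market_sound:
  assumes valid: "valid_pure_circuit (n, C)" and single: "single_input_use (n, C)"
    and \<epsilon>: "\<epsilon> < 1 / 9" and \<delta>: "0 \<le> \<delta>" "\<delta> \<le> 1 / 10" "10 ^ 12 * \<delta> \<le> \<gamma>"
    and sol: "market_solution \<epsilon> \<delta> (circuit_market (n, C)) (ps, xs)"
  shows "pure_circuit_solution \<gamma> (n, C) (map (\<lambda>v. decode (of_rat (ps ! v))) [0..<n])"
proof -
  let ?L = "circuit_readers (n, C)" and ?M = "market_of (circuit_market (n, C))"
  define p :: "nat \<Rightarrow> real" where "p = (\<lambda>j. of_rat (ps ! j))"
  define x :: "nat \<Rightarrow> nat \<Rightarrow> real" where "x = (\<lambda>i j. of_rat (xs ! i ! j))"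
  have "approx_equilibrium \<epsilon> \<delta> ?M p x"
    using sol unfolding market_solution_def circuit_market_def p_def x_def by simp
  then have eq: "\<And>j. j < 2 * n + 1 \<Longrightarrow> 0 \<le> p j"
    "\<And>i. i < length ?L \<Longrightarrow> approx_optimal \<delta> ?M p i (x i)"
    "\<And>j. j < 2 * n + 1 \<Longrightarrow> \<bar>(\<Sum>i<length ?L. x i j) - 1\<bar> \<le> \<epsilon>"
    unfolding approx_equilibrium_def market_simps[OF valid] by auto
  have util: "bundle_utility ?M i y = reader_utility (2 * n + 1) (?L ! i) y" if i: "i < length ?L" for i y
  proof -
    from reader_cases[OF valid i] obtain d u w where r: "?L ! i = (d, u, w)" "0 < d" by metis
    show ?thesis unfolding bundle_utility_def reader_utility_def market_simps(1)[OF valid] r(1) prod.case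
      by (rule sum.cong) (use util_eq[OF valid i r] in auto)
  qed
  have budget: "y \<in> budget_set ?M p i \<longleftrightarrow>
      (\<forall>j<2 * n + 1. 0 \<le> y j) \<and> (\<Sum>j<2 * n + 1. p j * y j) \<le> 1" if "i < length ?L" for i y
    using that unfolding budget_set_def by (auto simp only: market_simps[OF valid] mem_Collect_eq lessThan_iff)
  interpret circuit_equilibrium n C p x \<delta>
  proof
    fix d u w assume "(d, u, w) \<in> set ?L"
    then show "0 < d \<and> u < 2 * n + 1 \<and> w < 2 * n + 1" by (rule circuit_readers_bounds[OF valid])
  next
    fix j assume "j < 2 * n + 1"
    then have "(1, j, j) \<in> set ?L" unfolding circuit_readers_def by force
    then show "\<exists>d. (d, j, j) \<in> set ?L" ..
  next
    fix i j assume "i < length ?L" "j < 2 * n + 1"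
    with eq(2)[of i] budget[of i] show "0 \<le> x i j" unfolding approx_optimal_def by blast
  next
    fix i assume "i < length ?L"
    with eq(2)[of i] budget[of i] show "(\<Sum>j<2 * n + 1. p j * x i j) \<le> 1"
      unfolding approx_optimal_def by blast
  next
    fix i and y :: "nat \<Rightarrow> real"
    assume i: "i < length ?L" and y: "\<And>j. j < 2 * n + 1 \<Longrightarrow> 0 \<le> y j" "(\<Sum>j<2 * n + 1. p j * y j) \<le> 1"
    \<comment> \<open>The optimum is a supremum over the affordable bundles, so near-optimality
      holds against each of them separately.\<close>
    have "ereal (bundle_utility ?M i y) \<le> opt_utility ?M p i"
      unfolding opt_utility_def using budget[OF i, of y] y by (intro SUP_upper) blast
    then have "ereal (1 - \<delta>) * ereal (bundle_utility ?M i y) \<le> ereal (1 - \<delta>) * opt_utility ?M p i"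
      using \<delta> by (intro ereal_mult_left_mono) auto
    also have "\<dots> \<le> ereal (bundle_utility ?M i (x i))"
      using eq(2)[OF i] unfolding approx_optimal_def by blast
    finally show "(1 - \<delta>) * reader_utility (2 * n + 1) (?L ! i) y \<le> reader_utility (2 * n + 1) (?L ! i) (x i)"
      by (simp add: util[OF i])
  next
    fix j assume "j < 2 * n + 1"
    with eq(3)[of j] \<epsilon> show "\<bar>(\<Sum>i<length ?L. x i j) - 1\<bar> \<le> 1 / 9" by linarith
  qed (use eq(1) \<delta> valid single circuit_degree[OF valid single] in auto)
  have "satisfies (\<lambda>v. map (\<lambda>v. decode (of_rat (ps ! v))) [0..<n] ! v) (C ! k) =
      satisfies (\<lambda>v. decode (p v)) (C ! k)" if "k < length C" for k
    using gate_nodes_valid[OF that] by (intro satisfies_cong) (auto simp: p_def)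
  then have "{k. k < length C \<and> satisfies (\<lambda>v. map (\<lambda>v. decode (of_rat (ps ! v))) [0..<n] ! v) (C ! k)} =
      {k. k < length C \<and> satisfies (\<lambda>v. decode (p v)) (C ! k)}" by blast
  moreover have "(1 - \<gamma>) * real (length C) \<le> (1 - 10 ^ 12 * \<delta>) * real (length C)"
    using \<delta>(3) by (intro mult_right_mono) auto
  ultimately show ?thesis
    using satisfied_gates unfolding pure_circuit_solution_def by simp
qed

section \<open>The reduction\<close>

text \<open>The argument of \<open>sentry\<close> encodes the pieces for the capped good and the names of the
  two goods of a reader, followed by the good in question.\<close>

definition sentry :: "sexp \<Rightarrow> sexp" where
  "sentry z = (if sequal (tl_sexp z) (tl_sexp (tl_sexp (hd_sexp z))) = NIL
     then if sequal (tl_sexp z) (hd_sexp (tl_sexp (hd_sexp z))) = NIL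
       then enc_pieces ([], 0) else hd_sexp (hd_sexp z)
     else enc_pieces ([], 1))"

definition cap_pieces :: "nat \<Rightarrow> pieces" where
  "cap_pieces d = ([(1 / of_nat d, 5000 / of_nat d)], 0)"

text \<open>Only finitely many values of \<open>d\<close> occur, so \<open>d\<close> is a parameter
  of the program and the code of the capped pieces a constant; no rational arithmetic has to be
  programmed.\<close>

definition sbuyer :: "sexp \<Rightarrow> nat \<Rightarrow> sexp \<Rightarrow> sexp \<Rightarrow> sexp" where
  "sbuyer js d u w = CONS (enc_rat 1) (smap sentry (CONS (enc_pieces (cap_pieces d)) (CONS u w)) js)"

abbreviation "enc_buyer \<equiv> enc_pair enc_rat (enc_list enc_pieces)"

abbreviation buyer :: "nat \<Rightarrow> reader \<Rightarrow> rat \<times> pieces list" where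
  "buyer G r \<equiv> (1, map (reader_pieces r) [0..<G])"

lemma poly_time_sentry: "poly_time sentry"
  unfolding sentry_def by (intro poly_time_intros poly_time_sequal)

lemma poly_time_sbuyer:
  "poly_time js \<Longrightarrow> poly_time u \<Longrightarrow> poly_time w \<Longrightarrow> poly_time (\<lambda>x. sbuyer (js x) d (u x) (w x))"
  unfolding sbuyer_def by (intro poly_time_cons poly_time_const poly_time_smap poly_time_sentry)

lemma sbuyer_enc:
  "sbuyer (enc_list enc_unary [0..<G]) d (enc_unary u) (enc_unary w) = enc_buyer (buyer G (d, u, w))"
proof -
  have "smap sentry (CONS (enc_pieces (cap_pieces d)) (CONS (enc_unary u) (enc_unary w)))
      (enc_list enc_unary [0..<G]) = enc_list enc_pieces (map (reader_pieces (d, u, w)) [0..<G])"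
    by (rule smap_enc_list) (auto simp: sentry_def sequal_enc_unary reader_pieces_def cap_pieces_def)
  then show ?thesis by (simp add: sbuyer_def enc_pair_def)
qed

definition sfiller :: "sexp \<Rightarrow> sexp" where
  "sfiller z = sbuyer (hd_sexp z) 1 (tl_sexp z) (tl_sexp z)"

text \<open>The argument of \<open>sgate\<close> encodes the number of nodes and the list of all goods, followed
  by the gate.\<close>

definition sgate :: "sexp \<Rightarrow> sexp" where
  "sgate z = (\<lambda>n js tag u v w. if tag = NIL
     then sappend (srepeat (enc_unary 350) (sbuyer js 420 u w)) (srepeat (enc_unary 350) (sbuyer js 420 v w))
     else sappend (srepeat (enc_unary 94) (sbuyer js 342 u (sappend n v)))
       (sappend (srepeat (enc_unary 282) (sbuyer js 512 u (sappend n w)))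
       (sappend (srepeat (enc_unary 250) (sbuyer js 300 (sappend n v) v))
         (srepeat (enc_unary 250) (sbuyer js 300 (sappend n w) w)))))
     (hd_sexp (hd_sexp z)) (tl_sexp (hd_sexp z)) (hd_sexp (tl_sexp z)) (hd_sexp (tl_sexp (tl_sexp z)))
     (hd_sexp (tl_sexp (tl_sexp (tl_sexp z)))) (tl_sexp (tl_sexp (tl_sexp (tl_sexp z))))"

definition sgoods :: "sexp \<Rightarrow> sexp" where
  "sgoods x = CONS NIL (sappend (hd_sexp x) (hd_sexp x))"

definition smarket :: "sexp \<Rightarrow> sexp" where
  "smarket x = CONS (sgoods x)
     (sappend (smap sfiller (srange (sgoods x)) (srange (sgoods x)))
       (sconcat sgate (CONS (hd_sexp x) (srange (sgoods x))) (tl_sexp x)))"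

lemma poly_time_sfiller: "poly_time sfiller"
  unfolding sfiller_def by (intro poly_time_sbuyer poly_time_intros)

lemma poly_time_sgate: "poly_time sgate"
  unfolding sgate_def
  by (intro poly_time_if poly_time_sappend poly_time_srepeat poly_time_sbuyer poly_time_intros)

lemma poly_time_sgoods: "poly_time sgoods"
  unfolding sgoods_def by (intro poly_time_sappend poly_time_intros)

lemma poly_time_smarket: "poly_time smarket"
  unfolding smarket_def
  by (intro poly_time_cons poly_time_sappend poly_time_smap poly_time_sconcat poly_time_srange
      poly_time_sfiller poly_time_sgate poly_time_sgoods poly_time_hd poly_time_tl poly_time_id)

lemma sgate_enc:
  "sgate (CONS (CONS (enc_unary n) (enc_list enc_unary [0..<G])) (enc_gate g)) =
     enc_list enc_buyer (map (buyer G) (gate_readers n g))"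
proof (cases g)
  case (NAND u v w)
  have "sgate (CONS (CONS (enc_unary n) (enc_list enc_unary [0..<G])) (enc_gate g)) =
      sappend (srepeat (enc_unary 350) (enc_buyer (buyer G (420, u, w))))
        (srepeat (enc_unary 350) (enc_buyer (buyer G (420, v, w))))"
    by (simp add: NAND sgate_def sbuyer_enc)
  also have "\<dots> = enc_list enc_buyer (map (buyer G) (gate_readers n g))"
    unfolding srepeat_enc sappend_enc_list by (simp add: NAND map_replicate)
  finally show ?thesis .
next
  case (PURIFY u v w)
  have "sgate (CONS (CONS (enc_unary n) (enc_list enc_unary [0..<G])) (enc_gate g)) =
      sappend (srepeat (enc_unary 94) (enc_buyer (buyer G (342, u, n + v))))
       (sappend (srepeat (enc_unary 282) (enc_buyer (buyer G (512, u, n + w))))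
       (sappend (srepeat (enc_unary 250) (enc_buyer (buyer G (300, n + v, v))))
         (srepeat (enc_unary 250) (enc_buyer (buyer G (300, n + w, w))))))"
    by (simp add: PURIFY sgate_def sbuyer_enc sappend_enc_unary)
  also have "\<dots> = enc_list enc_buyer (map (buyer G) (gate_readers n g))"
    unfolding srepeat_enc sappend_enc_list by (simp add: PURIFY map_replicate)
  finally show ?thesis .
qed

lemma smarket_enc: "smarket (enc_pure_circuit I) = enc_market (circuit_market I)"
proof (cases I)
  case (Pair n C)
  let ?G = "2 * n + 1"
  have G: "sgoods (enc_pure_circuit I) = enc_unary ?G"
    by (simp add: Pair enc_pure_circuit_def enc_pair_def sgoods_def sappend_enc_unary mult_2)
  have 1: "smap sfiller (enc_list enc_unary [0..<?G]) (enc_list enc_unary [0..<?G]) =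
      enc_list enc_buyer (map (\<lambda>j. buyer ?G (1, j, j)) [0..<?G])"
    by (rule smap_enc_list) (simp only: sfiller_def hd_sexp.simps tl_sexp.simps sbuyer_enc)
  have 2: "sconcat sgate (CONS (enc_unary n) (enc_list enc_unary [0..<?G])) (enc_list enc_gate C) =
      enc_list enc_buyer (concat (map (\<lambda>g. map (buyer ?G) (gate_readers n g)) C))"
    by (rule sconcat_enc_list) (rule sgate_enc)
  have "hd_sexp (enc_pure_circuit I) = enc_unary n" "tl_sexp (enc_pure_circuit I) = enc_list enc_gate C"
    by (simp_all add: Pair enc_pure_circuit_def enc_pair_def)
  then show ?thesis
    unfolding smarket_def G srange_enc_unary
    by (simp only: 1 2 sappend_enc_list)
      (simp add: Pair enc_market_def enc_pair_def circuit_market_def circuit_readers_def map_concat comp_def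
        del: upt_Suc enc_unary.simps)
qed

text \<open>Prices are nonnegative, so their sign is ignored.\<close>

definition sdecode :: "sexp \<Rightarrow> sexp" where
  "sdecode q = (if sless_eq (tl_sexp (hd_sexp q)) ((sdouble ^^ 5) (tl_sexp (tl_sexp q))) = NIL
     then if sless_eq ((sdouble ^^ 9) (tl_sexp (tl_sexp q))) (tl_sexp (hd_sexp q)) = NIL
       then enc_pval Bot else enc_pval One
     else enc_pval Zero)"

definition sdecode_nth :: "sexp \<Rightarrow> sexp" where
  "sdecode_nth z = sdecode (hd_sexp (sdrop (tl_sexp z) (hd_sexp z)))"

definition ssolution :: "sexp \<Rightarrow> sexp" where
  "ssolution x = smap sdecode_nth (hd_sexp (tl_sexp x)) (srange (hd_sexp (hd_sexp x)))"

lemma poly_time_ssolution: "poly_time ssolution"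
proof -
  have d: "poly_time sdecode"
    unfolding sdecode_def by (intro poly_time_if poly_time_sless_eq poly_time_sdouble poly_time_intros)
  have "poly_time sdecode_nth"
    unfolding sdecode_nth_def by (intro poly_time_comp[OF d] poly_time_sdrop poly_time_intros)
  then show ?thesis
    unfolding ssolution_def by (intro poly_time_smap poly_time_srange poly_time_intros)
qed

text \<open>The thresholds 32 and 512 are powers of two. Multiplied out by the denominator, which is
  positive, the comparisons therefore need only doublings.\<close>

lemma sdecode_enc:
  assumes "0 \<le> (of_rat q :: real)"
  shows "sdecode (enc_rat q) = enc_pval (decode (of_rat q))"
proof -
  obtain a b where ab: "quotient_of q = (a, b)" by (cases "quotient_of q")
  have b: "0 < b" using quotient_of_denom_pos[OF ab] .
  have q: "(of_rat q :: real) = real_of_int a / real_of_int b"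
    using quotient_of_div[OF ab] by (simp add: of_rat_divide)
  have a: "0 \<le> a" using assms b unfolding q by (simp add: zero_le_divide_iff)
  have e: "enc_rat q = CONS (CONS (enc_bool False) (enc_nat (nat a))) (CONS (enc_bool False) (enc_nat (nat b)))"
    using a b by (simp add: enc_rat_def enc_int_def enc_pair_def ab)
  have 1: "nat a \<le> 2 ^ 5 * nat b \<longleftrightarrow> (of_rat q :: real) \<le> 32"
  proof -
    have "nat a \<le> 2 ^ 5 * nat b \<longleftrightarrow> a \<le> 32 * b" using a b by (simp add: nat_le_iff)
    also have "\<dots> \<longleftrightarrow> real_of_int a \<le> real_of_int (32 * b)" by (rule of_int_le_iff[symmetric])
    also have "\<dots> \<longleftrightarrow> (of_rat q :: real) \<le> 32" using b by (simp add: q field_simps)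
    finally show ?thesis .
  qed
  have 2: "2 ^ 9 * nat b \<le> nat a \<longleftrightarrow> 512 \<le> (of_rat q :: real)"
  proof -
    have "2 ^ 9 * nat b \<le> nat a \<longleftrightarrow> 512 * b \<le> a" using a b by (simp add: le_nat_iff)
    also have "\<dots> \<longleftrightarrow> real_of_int (512 * b) \<le> real_of_int a" by (rule of_int_le_iff[symmetric])
    also have "\<dots> \<longleftrightarrow> 512 \<le> (of_rat q :: real)" using b by (simp add: q field_simps)
    finally show ?thesis .
  qed
  have "0 < nat b" using b by simp
  then show ?thesis
    by (simp only: sdecode_def e hd_sexp.simps tl_sexp.simps sdouble_enc_nat sless_eq_enc_nat 1 2)
      (auto simp: decode_def)
qed

lemma ssolution_enc:
  assumes "n \<le> length ps" "\<And>j. j < n \<Longrightarrow> 0 \<le> (of_rat (ps ! j) :: real)"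
  shows "ssolution (CONS (enc_pure_circuit (n, C)) (enc_outcome (ps, xs))) =
    enc_list enc_pval (map (\<lambda>v. decode (of_rat (ps ! v))) [0..<n])"
proof -
  have "smap sdecode_nth (enc_list enc_rat ps) (enc_list enc_unary [0..<n]) =
      enc_list enc_pval (map (\<lambda>v. decode (of_rat (ps ! v))) [0..<n])"
  proof (rule smap_enc_list)
    fix j assume "j \<in> set [0..<n]"
    then have j: "j < n" by simp
    then have "drop j ps = ps ! j # drop (Suc j) ps" using assms(1) by (simp add: Cons_nth_drop_Suc)
    then show "sdecode_nth (CONS (enc_list enc_rat ps) (enc_unary j)) = enc_pval (decode (of_rat (ps ! j)))"
      using assms(2)[OF j] by (simp add: sdecode_nth_def sdrop_enc_list sdecode_enc)
  qed
  then show ?thesis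
    by (simp add: ssolution_def enc_pure_circuit_def enc_outcome_def enc_pair_def srange_enc_unary)
qed

section \<open>Composition of reductions and hardness\<close>

lemma reducible_trans:
  assumes "reducible A B" "reducible B D"
  shows "reducible A D"
proof -
  from assms(1) obtain f g where f: "poly_time f" "poly_time g"
    "\<And>x. x \<in> instances A \<Longrightarrow> f x \<in> instances B"
    "\<And>x y. x \<in> instances A \<Longrightarrow> y \<in> solutions B (f x) \<Longrightarrow> g (CONS x y) \<in> solutions A x"
    unfolding reducible_def by blast
  from assms(2) obtain f' g' where f': "poly_time f'" "poly_time g'"
    "\<And>x. x \<in> instances B \<Longrightarrow> f' x \<in> instances D"
    "\<And>x y. x \<in> instances B \<Longrightarrow> y \<in> solutions D (f' x) \<Longrightarrow> g' (CONS x y) \<in> solutions B x"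
    unfolding reducible_def by blast
  have "poly_time (\<lambda>x. f' (f x))" by (rule poly_time_comp[OF f'(1) f(1)])
  \<comment> \<open>The backward map \<open>g'\<close> expects an instance of \<open>B\<close>,
    which is recomputed as \<open>f\<close> of the original instance.\<close>
  moreover have "poly_time (\<lambda>z. g (CONS (hd_sexp z) (g' (CONS (f (hd_sexp z)) (tl_sexp z)))))"
    by (intro poly_time_comp[OF f(2)] poly_time_comp[OF f'(2)] poly_time_comp[OF f(1)] poly_time_intros)
  ultimately show ?thesis
    unfolding reducible_def using f f'
    by (intro exI[of _ "\<lambda>x. f' (f x)"]
        exI[of _ "\<lambda>z. g (CONS (hd_sexp z) (g' (CONS (f (hd_sexp z)) (tl_sexp z))))"]) auto
qed

lemma pure_circuit_reducible_market:
  assumes "\<epsilon> < 1 / 9" "0 \<le> \<delta>" "\<delta> \<le> 1 / 10" "10 ^ 12 * \<delta> \<le> \<gamma>"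
  shows "reducible (pure_circuit_problem \<gamma> {I. single_input_use I}) (market_problem \<epsilon> \<delta> circuit_markets)"
  unfolding reducible_def
proof (intro exI conjI ballI)
  show "poly_time smarket" by (rule poly_time_smarket)
  show "poly_time ssolution" by (rule poly_time_ssolution)
  fix x assume "x \<in> instances (pure_circuit_problem \<gamma> {I. single_input_use I})"
  then obtain n C where x: "x = enc_pure_circuit (n, C)" and valid: "valid_pure_circuit (n, C)"
    and single: "single_input_use (n, C)"
    unfolding pure_circuit_problem_def by auto
  have fx: "smarket x = enc_market (circuit_market (n, C))" by (simp add: x smarket_enc)
  show "smarket x \<in> instances (market_problem \<epsilon> \<delta> circuit_markets)"
  proof -
    have "market_of (circuit_market (n, C)) \<in> circuit_markets"
      using valid single unfolding circuit_markets_def by blast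
    then show ?thesis
      using circuit_valid_market[OF valid]
      unfolding market_problem_def fx search_problem.simps mem_Collect_eq by blast
  qed
  fix y assume "y \<in> solutions (market_problem \<epsilon> \<delta> circuit_markets) (smarket x)"
  then obtain ps xs where y: "y = enc_outcome (ps, xs)"
    and sol: "market_solution \<epsilon> \<delta> (circuit_market (n, C)) (ps, xs)"
    unfolding market_problem_def fx by (auto dest: injD[OF inj_enc_market])
  have ps: "length ps = 2 * n + 1" "\<And>j. j < 2 * n + 1 \<Longrightarrow> 0 \<le> (of_rat (ps ! j) :: real)"
    using sol by (auto simp: market_solution_def circuit_market_def market_of_def approx_equilibrium_def)
  have "ssolution (CONS x y) = enc_list enc_pval (map (\<lambda>v. decode (of_rat (ps ! v))) [0..<n])"
    unfolding x y by (rule ssolution_enc) (use ps in auto)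
  moreover have "pure_circuit_solution \<gamma> (n, C) (map (\<lambda>v. decode (of_rat (ps ! v))) [0..<n])"
    by (rule circuit_market_sound[OF valid single assms sol])
  ultimately show "ssolution (CONS x y) \<in> solutions (pure_circuit_problem \<gamma> {I. single_input_use I}) x"
    unfolding pure_circuit_problem_def x by auto
qed

theorem theorem4p1:
  fixes \<epsilon> :: real
  assumes "0 \<le> \<epsilon>" and "\<epsilon> < 1 / 9"
    and "PCP_for_PPAD_conjecture"
  shows "\<exists>\<delta>::real. 0 < \<delta> \<and> \<delta> \<le> 1 \<and>
    (\<exists>F :: (nat, nat) market set. simple_family F \<and> PPAD_hard (market_problem \<epsilon> \<delta> F))"
proof -
  from assms(3) obtain \<gamma> :: real where \<gamma>: "\<gamma> > 0"
    "PPAD_hard (pure_circuit_problem \<gamma> {I. single_input_use I})"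
    unfolding PCP_for_PPAD_conjecture_def by blast
  \<comment> \<open>The bound 1/10 is what \<open>price_lower\<close> asks for, and
    \<open>10 ^ 12\<close> is the loss factor of \<open>satisfied_gates\<close>.\<close>
  define \<delta> where "\<delta> = min (1 / 10) (\<gamma> / 10 ^ 12)"
  have \<delta>: "0 < \<delta>" "\<delta> \<le> 1 / 10" "10 ^ 12 * \<delta> \<le> \<gamma>"
    using \<gamma>(1) by (auto simp: \<delta>_def min_def)
  have "reducible (pure_circuit_problem \<gamma> {I. single_input_use I}) (market_problem \<epsilon> \<delta> circuit_markets)"
    using assms(2) \<delta> by (intro pure_circuit_reducible_market) auto
  with \<gamma>(2) have "PPAD_hard (market_problem \<epsilon> \<delta> circuit_markets)"
    unfolding PPAD_hard_def using reducible_trans by blast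
  with \<delta> simple_family_circuit_markets show ?thesis by (intro exI[of _ \<delta>]) auto
qed

end
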